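(* Let $\mathcal{I}$ be a generalised inverse category and let $\mathcal{E}$ be a category with pullbacks admitting all limits indexed by $\mathcal{I}^-(i)$ for $i \in \mathcal{I}$. Let $f : B \to A$ be a map in $\mathcal{E}^{\mathcal{I}}$. Assume that 1. each component $f_i : Bi \to Ai$ in $\mathcal{E}$, for $i \in \mathcal{I}$, is powerful; 2. the map $M_i f : M_i B \to M_i A$ in $\mathcal{E}$ is powerful for each $n \in \mathbb{N}$ and $i \in \mathbb{G}_n(\mathcal{I})$; 3. each $\mathbb{G}_n(\mathcal{I})$ is connected or $\mathcal{E}$ has an initial object. Then pulling back along $f$ admits a right adjoint $\Pi_B$. For each $g : C \to B$ in $\mathcal{E}^{\mathcal{I}}/B$, the value of $\Pi_B g : \Pi_B C \to A$ at $i \in \mathcal{I}$ is given by the pullback $(\Pi_B C)i$ in $\mathcal{E}$ of the map $$\Pi_{Bi}(g_i, m_i C) : \Pi_{Bi}Ci \to \Pi_{Bi}(Bi \times_{M_i B} M_i C)$$ and the composite $$Ai \times_{M_i A} M_i(\Pi_B C) \xrightarrow{Ai \times_{M_i A} M_i(\mathrm{ev})^\ddagger} Ai \times_{M_i A} \Pi_{M_i B} M_i C \xrightarrow{(Bi \times_{M_i B} \mathrm{ev})^\ddagger} \Pi_{Bi}(Bi \times_{M_i B} M_i C).$$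
   Context: A *generalised inverse category* is a category $\mathcal{I}$ with a function $\deg : \mathrm{ob}\,\mathcal{I} \to \mathbb{N}$ such that $\deg i > \deg j$ for every non-isomorphism $i \to j$ and $\deg i = \deg j$ for every isomorphism $i \cong j$. $\mathbb{G}_n(\mathcal{I})$ is the subgroupoid of $\mathcal{I}$ of objects of degree exactly $n$ and isomorphisms between them. $\mathcal{I}^-(i)$ is the full subcategory of the coslice $i/\mathcal{I}$ spanned by the strictly degree-decreasing maps out of $i$. For $X \in \mathcal{E}^{\mathcal{I}}$, the *matching object* at $i$ is $M_i X := \lim\big(\mathcal{I}^-(i) \to \mathcal{I} \xrightarrow{X} \mathcal{E}\big)$, functorial in $X$, and the *matching map* $m_i X : Xi \to M_i X$ is induced by the maps $X(u) : Xi \to Xj$ for $u : i \to j$ in $\mathcal{I}^-(i)$. A map is *powerful* if pullbacks along it exist and the pullback functor between slices has a right adjoint, the dependent product. $\Pi_{Bi}$ and $\Pi_{M_i B}$ are the right adjoints to pullback along $f_i$ and $M_i f$; $\mathrm{ev}$ denotes counits and $(-)^\ddagger$ transposes. $M_i(\mathrm{ev})^\ddagger : M_i(\Pi_B C) \to \Pi_{M_i B} M_i C$ is the transpose of $M_i B \times_{M_i A} M_i(\Pi_B C) \cong M_i(B \times_A \Pi_B C) \xrightarrow{M_i(\mathrm{ev})} M_i C$, and $Ai \times_{M_i A} M_i(\mathrm{ev})^\ddagger$ is its pullback along $m_i A$. $(Bi \times_{M_i B} \mathrm{ev})^\ddagger$ is the transpose of $Bi \times_{Ai}(Ai \times_{M_i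 A} \Pi_{M_i B}M_i C) \cong Bi \times_{M_i B}(M_i B \times_{M_i A} \Pi_{M_i B} M_i C) \to Bi \times_{M_i B} M_i C$, the pullback along $m_i B$ of $\mathrm{ev}$. $(g_i, m_i C) : Ci \to Bi \times_{M_i B} M_i C$ is the induced map. *)

theory Defs
  imports Main "HOL-Library.FuncSet"
begin

section \<open>Categories, functors, natural transformations\<close>

text \<open>\<open>g \<cdot>\<^bsub>C\<^esub> f\<close> is \<open>g\<close> after \<open>f\<close>.\<close>

record ('o, 'a) cat =
  Obj :: "'o set"
  Arr :: "'a set"
  Dom :: "'a \<Rightarrow> 'o"
  Cod :: "'a \<Rightarrow> 'o"
  Id :: "'o \<Rightarrow> 'a"
  Comp :: "'a \<Rightarrow> 'a \<Rightarrow> 'a" (infixl "\<cdot>\<index>" 70)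

definition hom :: "('o, 'a) cat \<Rightarrow> 'o \<Rightarrow> 'o \<Rightarrow> 'a set" where
  "hom C x y = {f \<in> Arr C. Dom C f = x \<and> Cod C f = y}"

locale category =
  fixes C :: "('o, 'a) cat" (structure)
  assumes Dom_in [simp]: "f \<in> Arr C \<Longrightarrow> Dom C f \<in> Obj C"
    and Cod_in [simp]: "f \<in> Arr C \<Longrightarrow> Cod C f \<in> Obj C"
    and Id_in: "x \<in> Obj C \<Longrightarrow> Id C x \<in> hom C x x"
    and Comp_in: "f \<in> hom C x y \<Longrightarrow> g \<in> hom C y z \<Longrightarrow> g \<cdot> f \<in> hom C x z"
    and Id_left: "f \<in> hom C x y \<Longrightarrow> Id C y \<cdot> f = f"
    and Id_right: "f \<in> hom C x y \<Longrightarrow> f \<cdot> Id C x = f"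
    and assoc: "f \<in> hom C w x \<Longrightarrow> g \<in> hom C x y \<Longrightarrow> h \<in> hom C y z \<Longrightarrow>
      h \<cdot> (g \<cdot> f) = (h \<cdot> g) \<cdot> f"

definition are_inverse :: "('o, 'a) cat \<Rightarrow> 'a \<Rightarrow> 'a \<Rightarrow> bool" where
  "are_inverse C u v \<longleftrightarrow> u \<in> Arr C \<and> v \<in> hom C (Cod C u) (Dom C u)
     \<and> v \<cdot>\<^bsub>C\<^esub> u = Id C (Dom C u) \<and> u \<cdot>\<^bsub>C\<^esub> v = Id C (Cod C u)"

definition is_iso :: "('o, 'a) cat \<Rightarrow> 'a \<Rightarrow> bool" where
  "is_iso C u \<longleftrightarrow> (\<exists>v. are_inverse C u v)"

definition inv_arr :: "('o, 'a) cat \<Rightarrow> 'a \<Rightarrow> 'a" where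
  "inv_arr C u = (THE v. are_inverse C u v)"

definition full_subcat :: "('o, 'a) cat \<Rightarrow> 'o set \<Rightarrow> ('o, 'a) cat" where
  "full_subcat C S = C\<lparr>Obj := Obj C \<inter> S, Arr := {f \<in> Arr C. Dom C f \<in> S \<and> Cod C f \<in> S}\<rparr>"

text \<open>Any two objects are linked by a finite zigzag of arrows; the empty category is allowed.\<close>

definition connected_cat :: "('o, 'a) cat \<Rightarrow> bool" where
  "connected_cat C \<longleftrightarrow> (\<forall>x\<in>Obj C. \<forall>y\<in>Obj C.
     (x, y) \<in> {(x, y). hom C x y \<noteq> {} \<or> hom C y x \<noteq> {}}\<^sup>*)"

definition has_initial_object :: "('o, 'a) cat \<Rightarrow> bool" where
  "has_initial_object C \<longleftrightarrow> (\<exists>z\<in>Obj C. \<forall>x\<in>Obj C. \<exists>!u. u \<in> hom C z x)"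

record ('o1, 'a1, 'o2, 'a2) funct =
  FObj :: "'o1 \<Rightarrow> 'o2"
  FArr :: "'a1 \<Rightarrow> 'a2"

definition is_functor ::
  "('o1, 'a1) cat \<Rightarrow> ('o2, 'a2) cat \<Rightarrow> ('o1, 'a1, 'o2, 'a2) funct \<Rightarrow> bool" where
  "is_functor C D F \<longleftrightarrow>
     (\<forall>x\<in>Obj C. FObj F x \<in> Obj D) \<and>
     (\<forall>u\<in>Arr C. FArr F u \<in> hom D (FObj F (Dom C u)) (FObj F (Cod C u))) \<and>
     (\<forall>x\<in>Obj C. FArr F (Id C x) = Id D (FObj F x)) \<and>
     (\<forall>u\<in>Arr C. \<forall>v\<in>Arr C. Cod C u = Dom C v \<longrightarrow>
        FArr F (v \<cdot>\<^bsub>C\<^esub> u) = FArr F v \<cdot>\<^bsub>D\<^esub> FArr F u)"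

record ('o1, 'a1, 'o2, 'a2) nat_trans =
  Src :: "('o1, 'a1, 'o2, 'a2) funct"
  Tgt :: "('o1, 'a1, 'o2, 'a2) funct"
  Cmp :: "'o1 \<Rightarrow> 'a2"

definition is_nat_trans ::
  "('o1, 'a1) cat \<Rightarrow> ('o2, 'a2) cat \<Rightarrow> ('o1, 'a1, 'o2, 'a2) nat_trans \<Rightarrow> bool" where
  "is_nat_trans C D t \<longleftrightarrow> is_functor C D (Src t) \<and> is_functor C D (Tgt t) \<and>
     (\<forall>x\<in>Obj C. Cmp t x \<in> hom D (FObj (Src t) x) (FObj (Tgt t) x)) \<and>
     (\<forall>u\<in>Arr C. Cmp t (Cod C u) \<cdot>\<^bsub>D\<^esub> FArr (Src t) u
               = FArr (Tgt t) u \<cdot>\<^bsub>D\<^esub> Cmp t (Dom C u))"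

text \<open>In the functor category, functors and natural transformations are normalised to be
  \<open>undefined\<close> off the source category, so that equality is equality on it.\<close>

definition ext_funct ::
  "('o1, 'a1) cat \<Rightarrow> ('o1, 'a1, 'o2, 'a2) funct \<Rightarrow> bool" where
  "ext_funct C F \<longleftrightarrow> FObj F \<in> extensional (Obj C) \<and> FArr F \<in> extensional (Arr C)"

definition functor_cat :: "('o1, 'a1) cat \<Rightarrow> ('o2, 'a2) cat \<Rightarrow>
    (('o1, 'a1, 'o2, 'a2) funct, ('o1, 'a1, 'o2, 'a2) nat_trans) cat" where
  "functor_cat C D = \<lparr>
     Obj = {F. is_functor C D F \<and> ext_funct C F},
     Arr = {t. is_nat_trans C D t \<and> ext_funct C (Src t) \<and> ext_funct C (Tgt t)
               \<and> Cmp t \<in> extensional (Obj C)},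
     Dom = Src,
     Cod = Tgt,
     Id = (\<lambda>F. \<lparr>Src = F, Tgt = F, Cmp = (\<lambda>x\<in>Obj C. Id D (FObj F x))\<rparr>),
     Comp = (\<lambda>s t. \<lparr>Src = Src t, Tgt = Tgt s, Cmp = (\<lambda>x\<in>Obj C. Cmp s x \<cdot>\<^bsub>D\<^esub> Cmp t x)\<rparr>)\<rparr>"


section \<open>Slices and coslices\<close>

text \<open>The middle entry of an arrow \<open>(a, h, b)\<close> of a (co)slice is its underlying arrow.\<close>

definition slice :: "('o, 'a) cat \<Rightarrow> 'o \<Rightarrow> ('a, 'a \<times> 'a \<times> 'a) cat" where
  "slice C z = \<lparr>
     Obj = {a \<in> Arr C. Cod C a = z},
     Arr = {(a, h, b). a \<in> Arr C \<and> Cod C a = z \<and> b \<in> Arr C \<and> Cod C b = z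
              \<and> h \<in> hom C (Dom C a) (Dom C b) \<and> b \<cdot>\<^bsub>C\<^esub> h = a},
     Dom = (\<lambda>(a, h, b). a),
     Cod = (\<lambda>(a, h, b). b),
     Id = (\<lambda>a. (a, Id C (Dom C a), a)),
     Comp = (\<lambda>(b, k, c) (a, h, b'). (a, k \<cdot>\<^bsub>C\<^esub> h, c))\<rparr>"

definition coslice :: "('o, 'a) cat \<Rightarrow> 'o \<Rightarrow> ('a, 'a \<times> 'a \<times> 'a) cat" where
  "coslice C z = \<lparr>
     Obj = {a \<in> Arr C. Dom C a = z},
     Arr = {(a, h, b). a \<in> Arr C \<and> Dom C a = z \<and> b \<in> Arr C \<and> Dom C b = z
              \<and> h \<in> hom C (Cod C a) (Cod C b) \<and> h \<cdot>\<^bsub>C\<^esub> a = b},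
     Dom = (\<lambda>(a, h, b). a),
     Cod = (\<lambda>(a, h, b). b),
     Id = (\<lambda>a. (a, Id C (Cod C a), a)),
     Comp = (\<lambda>(b, k, c) (a, h, b'). (a, k \<cdot>\<^bsub>C\<^esub> h, c))\<rparr>"

definition underlying :: "'a \<times> 'a \<times> 'a \<Rightarrow> 'a" where
  "underlying = (\<lambda>(a, h, b). h)"


section \<open>Pullbacks and limits\<close>

definition is_pullback :: "('o, 'a) cat \<Rightarrow> 'a \<Rightarrow> 'a \<Rightarrow> 'a \<Rightarrow> 'a \<Rightarrow> bool" where
  "is_pullback C f g p q \<longleftrightarrow>
     f \<in> Arr C \<and> g \<in> Arr C \<and> p \<in> Arr C \<and> q \<in> Arr C \<and>
     Cod C f = Cod C g \<and> Dom C p = Dom C q \<and> Cod C p = Dom C f \<and> Cod C q = Dom C g \<and>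
     f \<cdot>\<^bsub>C\<^esub> p = g \<cdot>\<^bsub>C\<^esub> q \<and>
     (\<forall>w. \<forall>x\<in>hom C w (Dom C f). \<forall>y\<in>hom C w (Dom C g). f \<cdot>\<^bsub>C\<^esub> x = g \<cdot>\<^bsub>C\<^esub> y \<longrightarrow>
        (\<exists>!h. h \<in> hom C w (Dom C p) \<and> p \<cdot>\<^bsub>C\<^esub> h = x \<and> q \<cdot>\<^bsub>C\<^esub> h = y))"

definition has_pullbacks_along :: "('o, 'a) cat \<Rightarrow> 'a \<Rightarrow> bool" where
  "has_pullbacks_along C f \<longleftrightarrow>
     (\<forall>g\<in>Arr C. Cod C g = Cod C f \<longrightarrow> (\<exists>p q. is_pullback C f g p q))"

definition has_pullbacks :: "('o, 'a) cat \<Rightarrow> bool" where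
  "has_pullbacks C \<longleftrightarrow> (\<forall>f\<in>Arr C. has_pullbacks_along C f)"

text \<open>An arbitrary choice of pullbacks: \<open>pb1 C f g\<close> and \<open>pb2 C f g\<close> are the projections from
  \<open>Dom f \<times> Dom g\<close> over the common codomain to \<open>Dom f\<close> and \<open>Dom g\<close>.\<close>

definition chosen_pb :: "('o, 'a) cat \<Rightarrow> 'a \<Rightarrow> 'a \<Rightarrow> 'a \<times> 'a" where
  "chosen_pb C f g = (SOME r. is_pullback C f g (fst r) (snd r))"

definition pb1 :: "('o, 'a) cat \<Rightarrow> 'a \<Rightarrow> 'a \<Rightarrow> 'a" where
  "pb1 C f g = fst (chosen_pb C f g)"

definition pb2 :: "('o, 'a) cat \<Rightarrow> 'a \<Rightarrow> 'a \<Rightarrow> 'a" where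
  "pb2 C f g = snd (chosen_pb C f g)"

text \<open>\<open>pb_pair C f g x y\<close> is the induced arrow \<open>(x, y)\<close> into the chosen pullback.\<close>

definition pb_pair :: "('o, 'a) cat \<Rightarrow> 'a \<Rightarrow> 'a \<Rightarrow> 'a \<Rightarrow> 'a \<Rightarrow> 'a" where
  "pb_pair C f g x y = (THE h. h \<in> hom C (Dom C x) (Dom C (pb1 C f g))
     \<and> pb1 C f g \<cdot>\<^bsub>C\<^esub> h = x \<and> pb2 C f g \<cdot>\<^bsub>C\<^esub> h = y)"

text \<open>Pulling back along \<open>f\<close>, from the slice over \<open>Cod f\<close> to the slice over \<open>Dom f\<close>.\<close>

definition pb_functor :: "('o, 'a) cat \<Rightarrow> 'a \<Rightarrow> ('a, 'a \<times> 'a \<times> 'a, 'a, 'a \<times> 'a \<times> 'a) funct" where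
  "pb_functor C f = \<lparr>
     FObj = pb1 C f,
     FArr = (\<lambda>(a, h, b). (pb1 C f a,
                          pb_pair C f b (pb1 C f a) (h \<cdot>\<^bsub>C\<^esub> pb2 C f a),
                          pb1 C f b))\<rparr>"

definition is_cone :: "('j, 'k) cat \<Rightarrow> ('o, 'a) cat \<Rightarrow> ('j, 'k, 'o, 'a) funct \<Rightarrow>
    'o \<Rightarrow> ('j \<Rightarrow> 'a) \<Rightarrow> bool" where
  "is_cone J C F x c \<longleftrightarrow> x \<in> Obj C \<and> (\<forall>j\<in>Obj J. c j \<in> hom C x (FObj F j)) \<and>
     (\<forall>w\<in>Arr J. FArr F w \<cdot>\<^bsub>C\<^esub> c (Dom J w) = c (Cod J w))"

definition is_limit :: "('j, 'k) cat \<Rightarrow> ('o, 'a) cat \<Rightarrow> ('j, 'k, 'o, 'a) funct \<Rightarrow>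
    'o \<Rightarrow> ('j \<Rightarrow> 'a) \<Rightarrow> bool" where
  "is_limit J C F l p \<longleftrightarrow> is_cone J C F l p \<and>
     (\<forall>x c. is_cone J C F x c \<longrightarrow>
        (\<exists>!h. h \<in> hom C x l \<and> (\<forall>j\<in>Obj J. p j \<cdot>\<^bsub>C\<^esub> h = c j)))"

definition has_limits_of_shape :: "('j, 'k) cat \<Rightarrow> ('o, 'a) cat \<Rightarrow> bool" where
  "has_limits_of_shape J C \<longleftrightarrow> (\<forall>F. is_functor J C F \<longrightarrow> (\<exists>l p. is_limit J C F l p))"

definition chosen_limit :: "('j, 'k) cat \<Rightarrow> ('o, 'a) cat \<Rightarrow> ('j, 'k, 'o, 'a) funct \<Rightarrow>
    'o \<times> ('j \<Rightarrow> 'a)" where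
  "chosen_limit J C F = (SOME r. is_limit J C F (fst r) (snd r))"

definition lim_obj :: "('j, 'k) cat \<Rightarrow> ('o, 'a) cat \<Rightarrow> ('j, 'k, 'o, 'a) funct \<Rightarrow> 'o" where
  "lim_obj J C F = fst (chosen_limit J C F)"

definition lim_proj :: "('j, 'k) cat \<Rightarrow> ('o, 'a) cat \<Rightarrow> ('j, 'k, 'o, 'a) funct \<Rightarrow> 'j \<Rightarrow> 'a" where
  "lim_proj J C F = snd (chosen_limit J C F)"

definition lim_lift :: "('j, 'k) cat \<Rightarrow> ('o, 'a) cat \<Rightarrow> ('j, 'k, 'o, 'a) funct \<Rightarrow>
    'o \<Rightarrow> ('j \<Rightarrow> 'a) \<Rightarrow> 'a" where
  "lim_lift J C F x c = (THE h. h \<in> hom C x (lim_obj J C F)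
     \<and> (\<forall>j\<in>Obj J. lim_proj J C F j \<cdot>\<^bsub>C\<^esub> h = c j))"


section \<open>Adjunctions and dependent products\<close>

text \<open>\<open>G\<close> is right adjoint to \<open>F : C \<rightarrow> D\<close> with counit \<open>e\<close>: the natural hom-set bijection sends
  \<open>h : x \<rightarrow> G d\<close> to \<open>e d \<circ> F h : F x \<rightarrow> d\<close>.\<close>

definition is_right_adjoint ::
  "('o1, 'a1) cat \<Rightarrow> ('o2, 'a2) cat \<Rightarrow> ('o1, 'a1, 'o2, 'a2) funct \<Rightarrow>
   ('o2, 'a2, 'o1, 'a1) funct \<Rightarrow> ('o2 \<Rightarrow> 'a2) \<Rightarrow> bool" where
  "is_right_adjoint C D F G e \<longleftrightarrow>
     is_functor C D F \<and> is_functor D C G \<and>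
     (\<forall>d\<in>Obj D. e d \<in> hom D (FObj F (FObj G d)) d) \<and>
     (\<forall>k\<in>Arr D. k \<cdot>\<^bsub>D\<^esub> e (Dom D k) = e (Cod D k) \<cdot>\<^bsub>D\<^esub> FArr F (FArr G k)) \<and>
     (\<forall>x\<in>Obj C. \<forall>d\<in>Obj D.
        bij_betw (\<lambda>h. e d \<cdot>\<^bsub>D\<^esub> FArr F h) (hom C x (FObj G d)) (hom D (FObj F x) d))"

definition powerful :: "('o, 'a) cat \<Rightarrow> 'a \<Rightarrow> bool" where
  "powerful C f \<longleftrightarrow> f \<in> Arr C \<and> has_pullbacks_along C f \<and>
     (\<exists>G e. is_right_adjoint (slice C (Cod C f)) (slice C (Dom C f)) (pb_functor C f) G e)"

text \<open>The dependent product along \<open>f\<close> and its counit, an arbitrary choice of right adjoint.\<close>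

definition chosen_dprod :: "('o, 'a) cat \<Rightarrow> 'a \<Rightarrow>
    ('a, 'a \<times> 'a \<times> 'a, 'a, 'a \<times> 'a \<times> 'a) funct \<times> ('a \<Rightarrow> 'a \<times> 'a \<times> 'a)" where
  "chosen_dprod C f = (SOME r.
     is_right_adjoint (slice C (Cod C f)) (slice C (Dom C f)) (pb_functor C f) (fst r) (snd r))"

definition dprod :: "('o, 'a) cat \<Rightarrow> 'a \<Rightarrow> ('a, 'a \<times> 'a \<times> 'a, 'a, 'a \<times> 'a \<times> 'a) funct" where
  "dprod C f = fst (chosen_dprod C f)"

definition dprod_ev :: "('o, 'a) cat \<Rightarrow> 'a \<Rightarrow> 'a \<Rightarrow> 'a \<times> 'a \<times> 'a" where
  "dprod_ev C f = snd (chosen_dprod C f)"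

text \<open>For \<open>a\<close> over \<open>Cod f\<close>, \<open>d\<close> over \<open>Dom f\<close> and an arrow \<open>k\<close> over \<open>Dom f\<close> from the pullback of
  \<open>a\<close> along \<open>f\<close> to \<open>d\<close>, the underlying arrow of the transpose of \<open>k\<close>.\<close>

definition dprod_transpose :: "('o, 'a) cat \<Rightarrow> 'a \<Rightarrow> 'a \<Rightarrow> 'a \<Rightarrow> 'a \<Rightarrow> 'a" where
  "dprod_transpose C f a d k = underlying
     (inv_into (hom (slice C (Cod C f)) a (FObj (dprod C f) d))
        (\<lambda>h. dprod_ev C f d \<cdot>\<^bsub>slice C (Dom C f)\<^esub> FArr (pb_functor C f) h)
        (pb1 C f a, k, d))"


section \<open>Generalised inverse categories and matching objects\<close>

definition generalised_inverse_category :: "('o, 'a) cat \<Rightarrow> ('o \<Rightarrow> nat) \<Rightarrow> bool" where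
  "generalised_inverse_category I deg \<longleftrightarrow> category I \<and>
     (\<forall>u\<in>Arr I. \<not> is_iso I u \<longrightarrow> deg (Dom I u) > deg (Cod I u)) \<and>
     (\<forall>u\<in>Arr I. is_iso I u \<longrightarrow> deg (Dom I u) = deg (Cod I u))"

definition deg_groupoid :: "('o, 'a) cat \<Rightarrow> ('o \<Rightarrow> nat) \<Rightarrow> nat \<Rightarrow> ('o, 'a) cat" where
  "deg_groupoid I deg n = I\<lparr>
     Obj := {i \<in> Obj I. deg i = n},
     Arr := {u \<in> Arr I. is_iso I u \<and> deg (Dom I u) = n \<and> deg (Cod I u) = n}\<rparr>"

definition lower_coslice :: "('o, 'a) cat \<Rightarrow> ('o \<Rightarrow> nat) \<Rightarrow> 'o \<Rightarrow> ('a, 'a \<times> 'a \<times> 'a) cat" where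
  "lower_coslice I deg i = full_subcat (coslice I i) {u. deg (Cod I u) < deg i}"

definition lower_diagram :: "('i, 'u) cat \<Rightarrow> ('i, 'u, 'o, 'a) funct \<Rightarrow>
    ('u, 'u \<times> 'u \<times> 'u, 'o, 'a) funct" where
  "lower_diagram I X = \<lparr>FObj = (\<lambda>u. FObj X (Cod I u)), FArr = (\<lambda>w. FArr X (underlying w))\<rparr>"

context
  fixes I :: "('i, 'u) cat" and deg :: "'i \<Rightarrow> nat" and E :: "('o, 'a) cat"
begin

definition match_obj :: "'i \<Rightarrow> ('i, 'u, 'o, 'a) funct \<Rightarrow> 'o" where
  "match_obj i X = lim_obj (lower_coslice I deg i) E (lower_diagram I X)"

definition match_arr :: "'i \<Rightarrow> ('i, 'u, 'o, 'a) nat_trans \<Rightarrow> 'a" where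
  "match_arr i t = lim_lift (lower_coslice I deg i) E (lower_diagram I (Tgt t))
     (match_obj i (Src t))
     (\<lambda>u. Cmp t (Cod I u) \<cdot>\<^bsub>E\<^esub> lim_proj (lower_coslice I deg i) E (lower_diagram I (Src t)) u)"

definition match_map :: "'i \<Rightarrow> ('i, 'u, 'o, 'a) funct \<Rightarrow> 'a" where
  "match_map i X = lim_lift (lower_coslice I deg i) E (lower_diagram I X) (FObj X i) (FArr X)"


section \<open>The maps in the description of the dependent product\<close>

text \<open>Throughout, \<open>f : B \<rightarrow> A\<close> and \<open>g : C \<rightarrow> B\<close> are arrows of the functor category, and
  \<open>Pi_arr f g\<close> is the dependent product of \<open>g\<close> along \<open>f\<close>, an arrow \<open>Pi C \<rightarrow> A\<close>. The counit
  at \<open>g\<close> has underlying natural transformation \<open>Pi_ev f g\<close>, from the pullback of \<open>B\<close> and \<open>Pi C\<close>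
  over \<open>A\<close> to \<open>C\<close>.\<close>

definition Pi_arr :: "('i, 'u, 'o, 'a) nat_trans \<Rightarrow> ('i, 'u, 'o, 'a) nat_trans \<Rightarrow>
    ('i, 'u, 'o, 'a) nat_trans" where
  "Pi_arr f g = FObj (dprod (functor_cat I E) f) g"

definition Pi_ev :: "('i, 'u, 'o, 'a) nat_trans \<Rightarrow> ('i, 'u, 'o, 'a) nat_trans \<Rightarrow>
    ('i, 'u, 'o, 'a) nat_trans" where
  "Pi_ev f g = underlying (dprod_ev (functor_cat I E) f g)"

text \<open>The canonical isomorphism from the pullback of \<open>M\<^sub>i f\<close> and \<open>M\<^sub>i t\<close> to \<open>M\<^sub>i\<close> of the pullback
  of \<open>f\<close> and \<open>t\<close>, and its analogue for evaluation at \<open>i\<close>; both are inverses of comparison arrows.\<close>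

definition match_pb_iso :: "'i \<Rightarrow> ('i, 'u, 'o, 'a) nat_trans \<Rightarrow> ('i, 'u, 'o, 'a) nat_trans \<Rightarrow> 'a" where
  "match_pb_iso i f t = inv_arr E (pb_pair E (match_arr i f) (match_arr i t)
     (match_arr i (pb1 (functor_cat I E) f t)) (match_arr i (pb2 (functor_cat I E) f t)))"

definition eval_pb_iso :: "'i \<Rightarrow> ('i, 'u, 'o, 'a) nat_trans \<Rightarrow> ('i, 'u, 'o, 'a) nat_trans \<Rightarrow> 'a" where
  "eval_pb_iso i f t = inv_arr E (pb_pair E (Cmp f i) (Cmp t i)
     (Cmp (pb1 (functor_cat I E) f t) i) (Cmp (pb2 (functor_cat I E) f t) i))"

text \<open>\<open>M\<^sub>i(ev)\<^sup>\<ddagger>\<close>, from \<open>M\<^sub>i (Pi C)\<close> to the dependent product of \<open>M\<^sub>i g\<close> along \<open>M\<^sub>i f\<close>.\<close>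

definition match_ev_transpose ::
  "'i \<Rightarrow> ('i, 'u, 'o, 'a) nat_trans \<Rightarrow> ('i, 'u, 'o, 'a) nat_trans \<Rightarrow> 'a" where
  "match_ev_transpose i f g =
     dprod_transpose E (match_arr i f) (match_arr i (Pi_arr f g)) (match_arr i g)
       (match_arr i (Pi_ev f g) \<cdot>\<^bsub>E\<^esub> match_pb_iso i f (Pi_arr f g))"

text \<open>Its pullback along the matching map of \<open>A\<close>.\<close>

definition pb_match_ev_transpose ::
  "'i \<Rightarrow> ('i, 'u, 'o, 'a) nat_trans \<Rightarrow> ('i, 'u, 'o, 'a) nat_trans \<Rightarrow> 'a" where
  "pb_match_ev_transpose i f g = underlying (FArr (pb_functor E (match_map i (Tgt f)))
     (match_arr i (Pi_arr f g), match_ev_transpose i f g,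
      FObj (dprod E (match_arr i f)) (match_arr i g)))"

text \<open>Write \<open>P\<close> for the domain of the dependent product \<open>p\<close> of \<open>M\<^sub>i g\<close> along \<open>M\<^sub>i f\<close>. The
  next arrow is the canonical isomorphism from \<open>Bi \<times> (Ai \<times> P)\<close> (over \<open>Ai\<close> and \<open>M\<^sub>i A\<close>) to
  \<open>Bi \<times> (M\<^sub>i B \<times> P)\<close> (over \<open>M\<^sub>i B\<close> and \<open>M\<^sub>i A\<close>), where \<open>m\<^sub>i A \<circ> f\<^sub>i = M\<^sub>i f \<circ> m\<^sub>i B\<close>.\<close>

definition base_change_iso ::
  "'i \<Rightarrow> ('i, 'u, 'o, 'a) nat_trans \<Rightarrow> ('i, 'u, 'o, 'a) nat_trans \<Rightarrow> 'a" where
  "base_change_iso i f g = (let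
       p = FObj (dprod E (match_arr i f)) (match_arr i g);
       x = pb1 E (match_map i (Tgt f)) p;
       toB = pb1 E (Cmp f i) x;
       toP = pb2 E (match_map i (Tgt f)) p \<cdot>\<^bsub>E\<^esub> pb2 E (Cmp f i) x
     in pb_pair E (match_map i (Src f)) (pb1 E (match_arr i f) p) toB
          (pb_pair E (match_arr i f) p (match_map i (Src f) \<cdot>\<^bsub>E\<^esub> toB) toP))"

text \<open>\<open>(Bi \<times> ev)\<^sup>\<ddagger>\<close>, with \<open>ev\<close> the counit for \<open>M\<^sub>i f\<close> pulled back along the matching map of \<open>B\<close>.\<close>

definition pb_ev_transpose ::
  "'i \<Rightarrow> ('i, 'u, 'o, 'a) nat_trans \<Rightarrow> ('i, 'u, 'o, 'a) nat_trans \<Rightarrow> 'a" where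
  "pb_ev_transpose i f g =
     dprod_transpose E (Cmp f i)
       (pb1 E (match_map i (Tgt f)) (FObj (dprod E (match_arr i f)) (match_arr i g)))
       (pb1 E (match_map i (Src f)) (match_arr i g))
       (underlying (FArr (pb_functor E (match_map i (Src f)))
            (dprod_ev E (match_arr i f) (match_arr i g)))
        \<cdot>\<^bsub>E\<^esub> base_change_iso i f g)"

text \<open>The dependent product along \<open>f\<^sub>i\<close> of \<open>(g\<^sub>i, m\<^sub>i C)\<close>.\<close>

definition Pi_gap_map ::
  "'i \<Rightarrow> ('i, 'u, 'o, 'a) nat_trans \<Rightarrow> ('i, 'u, 'o, 'a) nat_trans \<Rightarrow> 'a" where
  "Pi_gap_map i f g = underlying (FArr (dprod E (Cmp f i))
     (Cmp g i,
      pb_pair E (match_map i (Src f)) (match_arr i g) (Cmp g i) (match_map i (Src g)),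
      pb1 E (match_map i (Src f)) (match_arr i g)))"

text \<open>The canonical projections out of \<open>(Pi C)i\<close>: the transpose of \<open>ev\<^sub>i\<close>, and the arrow into
  \<open>Ai \<times> M\<^sub>i (Pi C)\<close> induced by the structure map of \<open>Pi C\<close> and its matching map.\<close>

definition Pi_proj_dprod ::
  "'i \<Rightarrow> ('i, 'u, 'o, 'a) nat_trans \<Rightarrow> ('i, 'u, 'o, 'a) nat_trans \<Rightarrow> 'a" where
  "Pi_proj_dprod i f g = dprod_transpose E (Cmp f i) (Cmp (Pi_arr f g) i) (Cmp g i)
     (Cmp (Pi_ev f g) i \<cdot>\<^bsub>E\<^esub> eval_pb_iso i f (Pi_arr f g))"

definition Pi_proj_match ::
  "'i \<Rightarrow> ('i, 'u, 'o, 'a) nat_trans \<Rightarrow> ('i, 'u, 'o, 'a) nat_trans \<Rightarrow> 'a" where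
  "Pi_proj_match i f g = pb_pair E (match_map i (Tgt f)) (match_arr i (Pi_arr f g))
     (Cmp (Pi_arr f g) i) (match_map i (Src (Pi_arr f g)))"

end

end

theory Submission
  imports Defs
begin

text \<open>By the Yoneda lemma, \<open>(\<Pi>\<^sub>B C)i\<close> has to represent the functor which takes \<open>x : X \<rightarrow> Ai\<close> to the set
  of natural families of maps \<open>X \<times> Bj \<rightarrow> Cj\<close> over \<open>Bj\<close> (the product being taken over \<open>Aj\<close>), one for
  each \<open>u : i \<rightarrow> j\<close>. The components at isomorphisms \<open>u\<close> are determined by the one at the identity, which
  amounts to a map from \<open>X\<close> to the dependent product of \<open>Ci\<close> along \<open>f\<^sub>i\<close>. All other \<open>u\<close> lower the
  degree, so by induction their components amount to a map from \<open>X\<close> to \<open>Ai \<times> M\<^sub>i(\<Pi>\<^sub>B C)\<close> over \<open>M\<^sub>i A\<close>.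
  Naturality says that the two maps agree in the dependent product of \<open>Bi \<times> M\<^sub>i C\<close> along \<open>f\<^sub>i\<close>.
  Hence the stated pullback is a representing object, and these objects assemble to a right adjoint.
  Any other right adjoint is isomorphic to this one, so that its values are representing objects and
  therefore again pullbacks.\<close>

section \<open>Categories\<close>

text \<open>The maps in the statement are built from chosen pullbacks, limits and right adjoints
  nested in one another, so a direct diagram chase would be buried in canonical isomorphisms. They
  are avoided by arguing with generalised elements throughout: a map out of a pullback is replaced
  by its values on pairs of arrows with a common domain that agree over the base, and a map into a
  dependent product is characterised by its values on such pairs. Equality of maps is tested on
  values, and each canonical isomorphism acts trivially on them. A second obstacle is that the value
  at i has to be produced before the dependent product exists as a functor. The induction therefore
  carries only the existence of a universal section at each object; the maps between the objects
  below i are recovered from their universal properties. The inductive step is phrased for an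
  arbitrary such lower diagram, so that it serves twice: once to construct universal sections, and
  once, applied to the chosen dependent product itself, to see that the projections named in the
  statement form a pullback.\<close>

context category
begin

lemma comp_arr [simp]: "f \<in> Arr C \<Longrightarrow> g \<in> Arr C \<Longrightarrow> Cod C f = Dom C g \<Longrightarrow> g \<cdot> f \<in> Arr C"
  using Comp_in[of f "Dom C f" "Cod C f" g "Cod C g"] by (simp add: hom_def)

lemma dom_comp [simp]: "f \<in> Arr C \<Longrightarrow> g \<in> Arr C \<Longrightarrow> Cod C f = Dom C g \<Longrightarrow> Dom C (g \<cdot> f) = Dom C f"
  using Comp_in[of f "Dom C f" "Cod C f" g "Cod C g"] by (simp add: hom_def)

lemma cod_comp [simp]: "f \<in> Arr C \<Longrightarrow> g \<in> Arr C \<Longrightarrow> Cod C f = Dom C g \<Longrightarrow> Cod C (g \<cdot> f) = Cod C g"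
  using Comp_in[of f "Dom C f" "Cod C f" g "Cod C g"] by (simp add: hom_def)

lemma id_arr [simp]: "x \<in> Obj C \<Longrightarrow> Id C x \<in> Arr C"
  and dom_id [simp]: "x \<in> Obj C \<Longrightarrow> Dom C (Id C x) = x"
  and cod_id [simp]: "x \<in> Obj C \<Longrightarrow> Cod C (Id C x) = x"
  using Id_in by (auto simp: hom_def)

lemma comp_id_left [simp]: "f \<in> Arr C \<Longrightarrow> Cod C f = y \<Longrightarrow> Id C y \<cdot> f = f"
  using Id_left[of f "Dom C f" y] by (simp add: hom_def)

lemma comp_id_right [simp]: "f \<in> Arr C \<Longrightarrow> Dom C f = x \<Longrightarrow> f \<cdot> Id C x = f"
  using Id_right[of f x "Cod C f"] by (simp add: hom_def)

lemma comp_assoc [simp]: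
  "f \<in> Arr C \<Longrightarrow> g \<in> Arr C \<Longrightarrow> h \<in> Arr C \<Longrightarrow> Cod C f = Dom C g \<Longrightarrow> Cod C g = Dom C h \<Longrightarrow>
   (h \<cdot> g) \<cdot> f = h \<cdot> (g \<cdot> f)"
  using assoc[of f "Dom C f" "Cod C f" g "Cod C g" h "Cod C h"] by (simp add: hom_def)

text \<open>Composites are normalised to the right by \<open>comp_assoc\<close>, so an equation
  \<open>g \<cdot> f = k\<close> no longer matches inside \<open>g \<cdot> (f \<cdot> h)\<close>.
  This extended form rewrites there; it is supplied by hand wherever a commuting square is used
  under a further arrow.\<close>

lemma comp_extend:
  assumes "g \<cdot> f = k" "f \<in> Arr C" "g \<in> Arr C" "h \<in> Arr C" "Cod C f = Dom C g" "Cod C h = Dom C f"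
  shows "g \<cdot> (f \<cdot> h) = k \<cdot> h"
  using assms by (metis comp_assoc)

lemma inverse_unique: "are_inverse C u v \<Longrightarrow> are_inverse C u w \<Longrightarrow> v = w"
proof -
  assume a: "are_inverse C u v" "are_inverse C u w"
  then have *: "u \<in> Arr C" "v \<in> Arr C" "w \<in> Arr C" "Dom C v = Cod C u" "Dom C w = Cod C u"
    "Cod C v = Dom C u" "Cod C w = Dom C u" by (auto simp: are_inverse_def hom_def)
  have "v = (w \<cdot> u) \<cdot> v" using a * unfolding are_inverse_def by simp
  also have "\<dots> = w \<cdot> (u \<cdot> v)" using * by simp
  also have "\<dots> = w" using a * unfolding are_inverse_def by simp
  finally show "v = w" .
qed

lemma inv_arr_eq: "are_inverse C u v \<Longrightarrow> inv_arr C u = v"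
  unfolding inv_arr_def using inverse_unique by blast

lemma is_iso_inv_arr: "is_iso C u \<Longrightarrow> are_inverse C u (inv_arr C u)"
  unfolding is_iso_def using inv_arr_eq by auto

section \<open>Pullback squares up to isomorphism\<close>

lemma is_pullbackD:
  assumes "is_pullback C f g p q"
  shows "f \<in> Arr C" "g \<in> Arr C" "p \<in> Arr C" "q \<in> Arr C" "Dom C q = Dom C p"
     "Cod C p = Dom C f" "Cod C q = Dom C g" "f \<cdot> p = g \<cdot> q" "Cod C g = Cod C f"
  using assms by (simp_all add: is_pullback_def)

lemma pullback_lift:
  assumes "is_pullback C f g p q" "x \<in> Arr C" "y \<in> Arr C" "Dom C x = Dom C y"
    "Cod C x = Dom C f" "Cod C y = Dom C g" "f \<cdot> x = g \<cdot> y"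
  obtains h where "h \<in> Arr C" "Dom C h = Dom C y" "Cod C h = Dom C p" "p \<cdot> h = x" "q \<cdot> h = y"
proof -
  have "x \<in> hom C (Dom C y) (Dom C f)" "y \<in> hom C (Dom C y) (Dom C g)"
    using assms(2-6) by (simp_all add: hom_def)
  then obtain h where "h \<in> hom C (Dom C y) (Dom C p)" "p \<cdot> h = x" "q \<cdot> h = y"
    using assms(1,7) unfolding is_pullback_def by blast
  moreover from this(1) have "h \<in> Arr C" "Dom C h = Dom C y" "Cod C h = Dom C p"
    by (simp_all add: hom_def)
  ultimately show ?thesis using that by blast
qed

lemma pullback_eqI:
  assumes "is_pullback C f g p q" "h \<in> Arr C" "h' \<in> Arr C" "Dom C h = Dom C h'"
    "Cod C h = Dom C p" "Cod C h' = Dom C p" "p \<cdot> h = p \<cdot> h'" "q \<cdot> h = q \<cdot> h'"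
  shows "h = h'"
proof -
  note pb = is_pullbackD[OF assms(1)]
  have "p \<cdot> h \<in> hom C (Dom C h) (Dom C f)" "q \<cdot> h \<in> hom C (Dom C h) (Dom C g)"
    using assms(2-6) pb by (simp_all add: hom_def)
  moreover have "f \<cdot> (p \<cdot> h) = g \<cdot> (q \<cdot> h)"
    using comp_extend[OF pb(8)] assms(2-6) pb by simp
  ultimately have "\<exists>!k. k \<in> hom C (Dom C h) (Dom C p) \<and> p \<cdot> k = p \<cdot> h \<and> q \<cdot> k = q \<cdot> h"
    using assms(1) unfolding is_pullback_def by blast
  moreover have "h \<in> hom C (Dom C h) (Dom C p)" "h' \<in> hom C (Dom C h) (Dom C p)"
    using assms(2-6) by (simp_all add: hom_def)
  ultimately show ?thesis using assms(7,8) by metis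
qed

lemma is_pullbackI:
  assumes "f \<in> Arr C" "g \<in> Arr C" "p \<in> Arr C" "q \<in> Arr C" "Cod C f = Cod C g" "Dom C p = Dom C q"
    "Cod C p = Dom C f" "Cod C q = Dom C g" "f \<cdot> p = g \<cdot> q"
    and ex: "\<And>x y. x \<in> Arr C \<Longrightarrow> y \<in> Arr C \<Longrightarrow> Dom C x = Dom C y \<Longrightarrow> Cod C x = Dom C f \<Longrightarrow>
      Cod C y = Dom C g \<Longrightarrow> f \<cdot> x = g \<cdot> y \<Longrightarrow>
      \<exists>h. h \<in> Arr C \<and> Dom C h = Dom C y \<and> Cod C h = Dom C p \<and> p \<cdot> h = x \<and> q \<cdot> h = y"
    and uni: "\<And>h h'. h \<in> Arr C \<Longrightarrow> h' \<in> Arr C \<Longrightarrow> Dom C h = Dom C h' \<Longrightarrow> Cod C h = Dom C p \<Longrightarrow>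
      Cod C h' = Dom C p \<Longrightarrow> p \<cdot> h = p \<cdot> h' \<Longrightarrow> q \<cdot> h = q \<cdot> h' \<Longrightarrow> h = h'"
  shows "is_pullback C f g p q"
proof -
  have "\<exists>!h. h \<in> hom C w (Dom C p) \<and> p \<cdot> h = x \<and> q \<cdot> h = y"
    if xy: "x \<in> hom C w (Dom C f)" "y \<in> hom C w (Dom C g)" "f \<cdot> x = g \<cdot> y" for w x y
  proof -
    obtain h where "h \<in> Arr C" "Dom C h = w" "Cod C h = Dom C p" "p \<cdot> h = x" "q \<cdot> h = y"
    proof -
      have "x \<in> Arr C" "y \<in> Arr C" "Dom C x = Dom C y" "Cod C x = Dom C f" "Cod C y = Dom C g" "Dom C y = w"
        using xy(1,2) by (simp_all add: hom_def)
      then show thesis using ex[of x y] xy(3) that by metis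
    qed
    then show ?thesis
      by (intro ex1I[of _ h]) (auto simp: hom_def intro: uni)
  qed
  then show ?thesis using assms(1-9) unfolding is_pullback_def by blast
qed

text \<open>The mediating arrow is the old one followed by \<open>t'\<close>, and uniqueness
  survives because \<open>t\<close> can be cancelled on the left. This and
  \<open>is_pullback_comparison\<close> make facts about one pullback available for all pullbacks of
  the same cospan.\<close>

lemma is_pullback_iso:
  assumes pb: "is_pullback C f g p q" and t: "are_inverse C t t'" "Cod C t = Dom C p"
  shows "is_pullback C f g (p \<cdot> t) (q \<cdot> t)"
proof -
  note pq = is_pullbackD[OF pb]
  have tt: "t \<in> Arr C" "t' \<in> Arr C" "Dom C t' = Dom C p" "Cod C t' = Dom C t"
    "t' \<cdot> t = Id C (Dom C t)" "t \<cdot> t' = Id C (Dom C p)"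
    using t by (auto simp: are_inverse_def hom_def)
  note T = tt t(2) pq(1-7) pq(9)
  show ?thesis
  proof (rule is_pullbackI)
    fix x y assume xy: "x \<in> Arr C" "y \<in> Arr C" "Dom C x = Dom C y" "Cod C x = Dom C f"
      "Cod C y = Dom C g" "f \<cdot> x = g \<cdot> y"
    obtain h where h: "h \<in> Arr C" "Dom C h = Dom C y" "Cod C h = Dom C p" "p \<cdot> h = x" "q \<cdot> h = y"
      using pullback_lift[OF pb xy] by blast
    have tth: "t \<cdot> (t' \<cdot> h) = h"
      using comp_extend[OF tt(6), of h] h(1-3) T by simp
    show "\<exists>h. h \<in> Arr C \<and> Dom C h = Dom C y \<and> Cod C h = Dom C (p \<cdot> t) \<and> p \<cdot> t \<cdot> h = x \<and> q \<cdot> t \<cdot> h = y"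
      by (rule exI[of _ "t' \<cdot> h"]) (use h T tth in simp)
  next
    fix h h' assume h: "h \<in> Arr C" "h' \<in> Arr C" "Dom C h = Dom C h'" "Cod C h = Dom C (p \<cdot> t)"
      "Cod C h' = Dom C (p \<cdot> t)" and eq: "p \<cdot> t \<cdot> h = p \<cdot> t \<cdot> h'" "q \<cdot> t \<cdot> h = q \<cdot> t \<cdot> h'"
    have "t \<cdot> h = t \<cdot> h'"
      by (rule pullback_eqI[OF pb]) (use h eq T in simp_all)
    then have "t' \<cdot> (t \<cdot> h) = t' \<cdot> (t \<cdot> h')" by simp
    then show "h = h'"
      using comp_extend[OF tt(5), of h] comp_extend[OF tt(5), of h'] h T by simp
  next
    show "f \<cdot> (p \<cdot> t) = g \<cdot> (q \<cdot> t)" using comp_extend[OF pq(8)] T by simp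
  qed (use T in simp_all)
qed

lemma is_pullback_comparison:
  assumes pb: "is_pullback C f g p q" and pb': "is_pullback C f g p' q'"
  obtains t t' where "are_inverse C t t'" "Dom C t = Dom C p'" "Cod C t = Dom C p" "p \<cdot> t = p'" "q \<cdot> t = q'"
proof -
  note pq = is_pullbackD[OF pb] and pq' = is_pullbackD[OF pb']
  obtain t where t: "t \<in> Arr C" "Dom C t = Dom C p'" "Cod C t = Dom C p" "p \<cdot> t = p'" "q \<cdot> t = q'"
    using pullback_lift[OF pb, of p' q'] pq pq' by auto
  obtain t' where t': "t' \<in> Arr C" "Dom C t' = Dom C p" "Cod C t' = Dom C p'" "p' \<cdot> t' = p" "q' \<cdot> t' = q"
    using pullback_lift[OF pb', of p q] pq pq' by auto
  have "t' \<cdot> t = Id C (Dom C p')"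
    by (rule pullback_eqI[OF pb'])
      (use comp_extend[OF t'(4), of t] comp_extend[OF t'(5), of t] t t' pq pq' in simp_all)
  moreover have "t \<cdot> t' = Id C (Dom C p)"
    by (rule pullback_eqI[OF pb])
      (use comp_extend[OF t(4), of t'] comp_extend[OF t(5), of t'] t t' pq pq' in simp_all)
  ultimately have "are_inverse C t t'"
    using t t' by (simp add: are_inverse_def hom_def)
  then show ?thesis using that t by blast
qed

section \<open>Chosen pullbacks\<close>

lemma chosen_pullback:
  assumes "has_pullbacks_along C f" "g \<in> Arr C" "Cod C g = Cod C f"
  shows "is_pullback C f g (pb1 C f g) (pb2 C f g)"
proof -
  obtain p q where "is_pullback C f g p q"
    using assms unfolding has_pullbacks_along_def by auto
  then have "is_pullback C f g (fst (p, q)) (snd (p, q))" by simp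
  then show ?thesis
    unfolding pb1_def pb2_def chosen_pb_def by (rule someI)
qed

context
  fixes f g :: 'a
  assumes pba: "has_pullbacks_along C f" and gA: "g \<in> Arr C" and gC: "Cod C g = Cod C f"
begin

lemma pb1_arr [simp]: "pb1 C f g \<in> Arr C" 
  and pb2_arr [simp]: "pb2 C f g \<in> Arr C" 
  and cod_pb1 [simp]: "Cod C (pb1 C f g) = Dom C f"
  and cod_pb2 [simp]: "Cod C (pb2 C f g) = Dom C g"
  and dom_pb2 [simp]: "Dom C (pb2 C f g) = Dom C (pb1 C f g)"
  and pb_comm: "f \<cdot> pb1 C f g = g \<cdot> pb2 C f g"
  using chosen_pullback[OF pba gA gC] by (auto simp: is_pullback_def)

lemma pb_pair:
  assumes "x \<in> Arr C" "y \<in> Arr C" "Dom C x = Dom C y" "Cod C x = Dom C f" "Cod C y = Dom C g"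
    "f \<cdot> x = g \<cdot> y"
  shows pb_pair_arr: "pb_pair C f g x y \<in> Arr C"
    and dom_pb_pair: "Dom C (pb_pair C f g x y) = Dom C y"
    and cod_pb_pair: "Cod C (pb_pair C f g x y) = Dom C (pb1 C f g)"
    and pb1_pb_pair: "pb1 C f g \<cdot> pb_pair C f g x y = x"
    and pb2_pb_pair: "pb2 C f g \<cdot> pb_pair C f g x y = y"
proof -
  have "\<exists>!h. h \<in> hom C (Dom C x) (Dom C (pb1 C f g)) \<and> pb1 C f g \<cdot> h = x \<and> pb2 C f g \<cdot> h = y"
  proof -
    have "x \<in> hom C (Dom C x) (Dom C f)" "y \<in> hom C (Dom C x) (Dom C g)"
      using assms by (simp_all add: hom_def)
    then show ?thesis
      using chosen_pullback[OF pba gA gC] assms(6) unfolding is_pullback_def by blast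
  qed
  from theI'[OF this] have "pb_pair C f g x y \<in> hom C (Dom C x) (Dom C (pb1 C f g)) \<and>
     pb1 C f g \<cdot> pb_pair C f g x y = x \<and> pb2 C f g \<cdot> pb_pair C f g x y = y"
    unfolding pb_pair_def .
  then show "pb_pair C f g x y \<in> Arr C" "Dom C (pb_pair C f g x y) = Dom C y"
    "Cod C (pb_pair C f g x y) = Dom C (pb1 C f g)"
    "pb1 C f g \<cdot> pb_pair C f g x y = x" "pb2 C f g \<cdot> pb_pair C f g x y = y"
    using assms(3) by (simp_all only: hom_def mem_Collect_eq)
qed

lemma pb_eqI:
  assumes "h \<in> Arr C" "h' \<in> Arr C" "Dom C h = Dom C h'"
    "Cod C h = Dom C (pb1 C f g)" "Cod C h' = Dom C (pb1 C f g)"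
    "pb1 C f g \<cdot> h = pb1 C f g \<cdot> h'" "pb2 C f g \<cdot> h = pb2 C f g \<cdot> h'"
  shows "h = h'"
  by (rule pullback_eqI[OF chosen_pullback[OF pba gA gC] assms])

lemma pb_pair_eqI:
  assumes "h \<in> Arr C" "Cod C h = Dom C (pb1 C f g)" "pb1 C f g \<cdot> h = x" "pb2 C f g \<cdot> h = y"
  shows "pb_pair C f g x y = h"
proof -
  have fA: "f \<in> Arr C" using chosen_pullback[OF pba gA gC] by (simp add: is_pullback_def)
  have "f \<cdot> x = g \<cdot> y" "x \<in> Arr C" "y \<in> Arr C" "Dom C x = Dom C h" "Dom C y = Dom C h" "Cod C x = Dom C f" "Cod C y = Dom C g"
    using assms comp_extend[OF pb_comm] fA gA gC by auto
  note * = this and pp = pb_pair[OF this(2,3) _ this(6,7,1)]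
  show ?thesis
    by (rule pb_eqI) (use * pp assms in simp_all)
qed

lemma pb_pair_comp:
  assumes "x \<in> Arr C" "y \<in> Arr C" "Dom C x = Dom C y" "Cod C x = Dom C f" "Cod C y = Dom C g"
    "f \<cdot> x = g \<cdot> y" "r \<in> Arr C" "Cod C r = Dom C y"
  shows "pb_pair C f g x y \<cdot> r = pb_pair C f g (x \<cdot> r) (y \<cdot> r)"
proof -
  note * = pb_pair[OF assms(1-6)]
  show ?thesis
    by (rule pb_pair_eqI[symmetric])
      (use assms * comp_extend[OF *(4)] comp_extend[OF *(5)] in auto)
qed

end

text \<open>\<open>match_pb_iso\<close> and \<open>eval_pb_iso\<close> are inverses of comparison
  arrows of this kind. The inverse is never computed: what matters is that, after a pairing of
  \<open>x\<close> and \<open>y\<close>, it is the arrow into the given pullback with components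
  \<open>x\<close> and \<open>y\<close>.\<close>

lemma comparison_inverse:
  assumes pb: "is_pullback C f g p q" and pba: "has_pullbacks_along C f"
    and xy: "x \<in> Arr C" "y \<in> Arr C" "Dom C x = Dom C y" "Cod C x = Dom C f" "Cod C y = Dom C g" "f \<cdot> x = g \<cdot> y"
  defines "k \<equiv> inv_arr C (pb_pair C f g p q)"
  shows "k \<in> Arr C" "Dom C k = Dom C (pb1 C f g)" "Cod C k = Dom C p"
    "k \<cdot> pb_pair C f g x y \<in> Arr C" "Dom C (k \<cdot> pb_pair C f g x y) = Dom C y"
    "Cod C (k \<cdot> pb_pair C f g x y) = Dom C p"
    "p \<cdot> (k \<cdot> pb_pair C f g x y) = x" "q \<cdot> (k \<cdot> pb_pair C f g x y) = y"
proof -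
  note P = is_pullbackD[OF pb]
  note ch = chosen_pullback[OF pba P(2,9)]
  note C = is_pullbackD[OF ch]
  obtain t t' where t: "are_inverse C t t'" "Dom C t = Dom C p" "Cod C t = Dom C (pb1 C f g)" 
     "pb1 C f g \<cdot> t = p" "pb2 C f g \<cdot> t = q"
    using is_pullback_comparison[OF ch pb] by blast
  have T: "t \<in> Arr C" "t' \<in> Arr C" "Dom C t' = Cod C t" "Cod C t' = Dom C t" "t \<cdot> t' = Id C (Cod C t)"
    using t(1) by (auto simp: are_inverse_def hom_def)
  have "pb_pair C f g p q = t"
    by (rule pb_pair_eqI[OF pba P(2,9)]) (use t T in simp_all)
  then have k: "k = t'" unfolding k_def using inv_arr_eq[OF t(1)] by simp
  note pp = pb_pair[OF pba P(2,9) xy]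
  have tt: "t \<cdot> (t' \<cdot> pb_pair C f g x y) = pb_pair C f g x y"
    using comp_extend[OF T(5), of "pb_pair C f g x y"] T pp t by simp
  show "k \<in> Arr C" "Dom C k = Dom C (pb1 C f g)" "Cod C k = Dom C p"
    "k \<cdot> pb_pair C f g x y \<in> Arr C" "Dom C (k \<cdot> pb_pair C f g x y) = Dom C y"
    "Cod C (k \<cdot> pb_pair C f g x y) = Dom C p"
    unfolding k using T t pp by simp_all
  show "p \<cdot> (k \<cdot> pb_pair C f g x y) = x" "q \<cdot> (k \<cdot> pb_pair C f g x y) = y"
    unfolding k using comp_extend[OF t(4), of "t' \<cdot> pb_pair C f g x y"] comp_extend[OF t(5), of "t' \<cdot> pb_pair C f g x y"]
      tt T t pp C by simp_all
qed

end

section \<open>Slices\<close>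

lemma underlying_simp [simp]: "underlying (a, h, b) = h"
  by (simp add: underlying_def)

lemma Obj_slice [simp]: "a \<in> Obj (slice C z) \<longleftrightarrow> a \<in> Arr C \<and> Cod C a = z"
  by (simp add: slice_def)

lemma Arr_slice: "w \<in> Arr (slice C z) \<longleftrightarrow> (\<exists>a h b. w = (a, h, b) \<and> a \<in> Arr C \<and> Cod C a = z \<and>
    b \<in> Arr C \<and> Cod C b = z \<and> h \<in> hom C (Dom C a) (Dom C b) \<and> b \<cdot>\<^bsub>C\<^esub> h = a)"
  by (auto simp: slice_def)

lemma Dom_slice [simp]: "Dom (slice C z) (a, h, b) = a"
  and Cod_slice [simp]: "Cod (slice C z) (a, h, b) = b"
  and Id_slice [simp]: "Id (slice C z) a = (a, Id C (Dom C a), a)"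
  and Comp_slice [simp]: "(b, k, c) \<cdot>\<^bsub>slice C z\<^esub> (a, h, b') = (a, k \<cdot>\<^bsub>C\<^esub> h, c)"
  by (simp_all add: slice_def)

lemma hom_slice: "w \<in> hom (slice C z) a b \<longleftrightarrow> w = (a, underlying w, b) \<and> a \<in> Arr C \<and> Cod C a = z \<and>
    b \<in> Arr C \<and> Cod C b = z \<and> underlying w \<in> Arr C \<and> Dom C (underlying w) = Dom C a \<and>
    Cod C (underlying w) = Dom C b \<and> b \<cdot>\<^bsub>C\<^esub> underlying w = a"
  by (cases w) (auto simp: hom_def Arr_slice)

lemma FObj_pb_functor [simp]: "FObj (pb_functor C f) = pb1 C f"
  and FArr_pb_functor [simp]: "FArr (pb_functor C f) (a, h, b) =
    (pb1 C f a, pb_pair C f b (pb1 C f a) (h \<cdot>\<^bsub>C\<^esub> pb2 C f a), pb1 C f b)"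
  by (simp_all add: pb_functor_def)

context category
begin

lemma category_slice: "category (slice C z)"
proof
  fix w assume "w \<in> Arr (slice C z)"
  then show "Dom (slice C z) w \<in> Obj (slice C z)" "Cod (slice C z) w \<in> Obj (slice C z)"
    by (auto simp: Arr_slice)
next
  fix x assume "x \<in> Obj (slice C z)"
  then show "Id (slice C z) x \<in> hom (slice C z) x x" by (simp add: hom_slice)
next
  fix f x y g w assume *: "f \<in> hom (slice C z) x y" "g \<in> hom (slice C z) y w"
  obtain k where k: "f = (x, k, y)" "k \<in> Arr C" "Dom C k = Dom C x" "Cod C k = Dom C y" "y \<cdot> k = x" "x \<in> Arr C" "y \<in> Arr C" "Cod C x = z"
    using *(1) unfolding hom_slice by blast
  obtain m where m: "g = (y, m, w)" "m \<in> Arr C" "Dom C m = Dom C y" "Cod C m = Dom C w" "w \<cdot> m = y" "w \<in> Arr C" "Cod C w = z"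
    using *(2) unfolding hom_slice by blast
  show "g \<cdot>\<^bsub>slice C z\<^esub> f \<in> hom (slice C z) x w"
    using k(2-) m(2-) comp_extend[OF m(5), of k] unfolding k(1) m(1) by (simp add: hom_slice)
next
  fix f x y assume *: "f \<in> hom (slice C z) x y"
  obtain k where k: "f = (x, k, y)" "k \<in> Arr C" "Dom C k = Dom C x" "Cod C k = Dom C y"
    using *(1) unfolding hom_slice by blast
  show "Id (slice C z) y \<cdot>\<^bsub>slice C z\<^esub> f = f" "f \<cdot>\<^bsub>slice C z\<^esub> Id (slice C z) x = f"
    unfolding k(1) using k(2-) by simp_all
next
  fix f w x g y h v assume *: "f \<in> hom (slice C z) w x" "g \<in> hom (slice C z) x y" "h \<in> hom (slice C z) y v"
  obtain k where k: "f = (w, k, x)" "k \<in> Arr C" "Dom C k = Dom C w" "Cod C k = Dom C x"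
    using *(1) unfolding hom_slice by blast
  obtain m where m: "g = (x, m, y)" "m \<in> Arr C" "Dom C m = Dom C x" "Cod C m = Dom C y"
    using *(2) unfolding hom_slice by blast
  obtain n where n: "h = (y, n, v)" "n \<in> Arr C" "Dom C n = Dom C y" "Cod C n = Dom C v"
    using *(3) unfolding hom_slice by blast
  show "h \<cdot>\<^bsub>slice C z\<^esub> (g \<cdot>\<^bsub>slice C z\<^esub> f) = (h \<cdot>\<^bsub>slice C z\<^esub> g) \<cdot>\<^bsub>slice C z\<^esub> f"
    unfolding k(1) m(1) n(1) using k(2-) m(2-) n(2-) by simp
qed

lemma pb_map:
  assumes f: "f \<in> Arr C" "has_pullbacks_along C f" and a: "a \<in> Arr C" "Cod C a = Cod C f"
    and b: "b \<in> Arr C" "Cod C b = Cod C f" and h: "h \<in> Arr C" "Dom C h = Dom C a" "Cod C h = Dom C b" "b \<cdot> h = a"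
  shows "pb_pair C f b (pb1 C f a) (h \<cdot> pb2 C f a) \<in> Arr C"
    "Dom C (pb_pair C f b (pb1 C f a) (h \<cdot> pb2 C f a)) = Dom C (pb1 C f a)"
    "Cod C (pb_pair C f b (pb1 C f a) (h \<cdot> pb2 C f a)) = Dom C (pb1 C f b)"
    "pb1 C f b \<cdot> pb_pair C f b (pb1 C f a) (h \<cdot> pb2 C f a) = pb1 C f a"
    "pb2 C f b \<cdot> pb_pair C f b (pb1 C f a) (h \<cdot> pb2 C f a) = h \<cdot> pb2 C f a"
proof -
  have eq: "f \<cdot> pb1 C f a = b \<cdot> (h \<cdot> pb2 C f a)"
    using pb_comm[OF f(2) a] comp_extend[OF h(4), of "pb2 C f a"] f a b h by simp
  note pp = pb_pair[OF f(2) b _ _ _ _ _ eq]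
  show "pb_pair C f b (pb1 C f a) (h \<cdot> pb2 C f a) \<in> Arr C"
    "Dom C (pb_pair C f b (pb1 C f a) (h \<cdot> pb2 C f a)) = Dom C (pb1 C f a)"
    "Cod C (pb_pair C f b (pb1 C f a) (h \<cdot> pb2 C f a)) = Dom C (pb1 C f b)"
    "pb1 C f b \<cdot> pb_pair C f b (pb1 C f a) (h \<cdot> pb2 C f a) = pb1 C f a"
    "pb2 C f b \<cdot> pb_pair C f b (pb1 C f a) (h \<cdot> pb2 C f a) = h \<cdot> pb2 C f a"
    using pp f a b h by simp_all
qed

lemma is_functor_pb_functor:
  assumes f: "f \<in> Arr C" "has_pullbacks_along C f"
  shows "is_functor (slice C (Cod C f)) (slice C (Dom C f)) (pb_functor C f)"
  unfolding is_functor_def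
proof (intro conjI ballI impI)
  fix a assume a: "a \<in> Obj (slice C (Cod C f))"
  then show "FObj (pb_functor C f) a \<in> Obj (slice C (Dom C f))" using f by simp
  show "FArr (pb_functor C f) (Id (slice C (Cod C f)) a) = Id (slice C (Dom C f)) (FObj (pb_functor C f) a)"
    using a f pb_pair_eqI[OF f(2), of a "Id C (Dom C (pb1 C f a))" "pb1 C f a" "pb2 C f a"] by simp
next
  fix w assume w: "w \<in> Arr (slice C (Cod C f))"
  then obtain a h b where h: "w = (a, h, b)" "a \<in> Arr C" "Cod C a = Cod C f" "b \<in> Arr C" "Cod C b = Cod C f"
    "h \<in> Arr C" "Dom C h = Dom C a" "Cod C h = Dom C b" "b \<cdot> h = a"
    unfolding Arr_slice hom_def by blast
  show "FArr (pb_functor C f) w \<in> hom (slice C (Dom C f))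
      (FObj (pb_functor C f) (Dom (slice C (Cod C f)) w)) (FObj (pb_functor C f) (Cod (slice C (Cod C f)) w))"
    unfolding h(1) using pb_map[OF f h(2-)] f h(2-5) by (simp add: hom_slice)
  fix w' assume w': "w' \<in> Arr (slice C (Cod C f))" "Cod (slice C (Cod C f)) w = Dom (slice C (Cod C f)) w'"
  from w'(1) obtain b' h' c where h0: "w' = (b', h', c)" "b' \<in> Arr C" "Cod C b' = Cod C f" "c \<in> Arr C" "Cod C c = Cod C f"
    "h' \<in> Arr C" "Dom C h' = Dom C b'" "Cod C h' = Dom C c" "c \<cdot> h' = b'"
    unfolding Arr_slice hom_def by blast
  have "b' = b" using w'(2) unfolding h(1) h0(1) by simp
  note h' = h0(1,4-)[unfolded this]
  note m = pb_map[OF f h(2-)] and m' = pb_map[OF f h(4,5) h'(2-)]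
  have "pb_pair C f c (pb1 C f a) (h' \<cdot> h \<cdot> pb2 C f a) =
    pb_pair C f c (pb1 C f b) (h' \<cdot> pb2 C f b) \<cdot> pb_pair C f b (pb1 C f a) (h \<cdot> pb2 C f a)"
    by (rule pb_pair_eqI[OF f(2) h'(2,3)])
      (use m m' comp_extend[OF m'(4)] comp_extend[OF m'(5)] f h(2-) h'(2-) in simp_all)
  then show "FArr (pb_functor C f) (w' \<cdot>\<^bsub>slice C (Cod C f)\<^esub> w) =
     FArr (pb_functor C f) w' \<cdot>\<^bsub>slice C (Dom C f)\<^esub> FArr (pb_functor C f) w"
    unfolding h(1) h'(1) by simp
qed

end

section \<open>Dependent products in terms of generalised elements\<close>

text \<open>For \<open>p\<close> the dependent product of \<open>d\<close> along \<open>f\<close>, evaluation of a generalised element \<open>y\<close>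
  of \<open>Dom p\<close> at a generalised element \<open>b\<close> of \<open>Dom f\<close> lying over it.\<close>

definition dapp :: "('o, 'a) cat \<Rightarrow> 'a \<Rightarrow> 'a \<Rightarrow> 'a \<Rightarrow> 'a \<Rightarrow> 'a" where
  "dapp C f d y b = underlying (dprod_ev C f d) \<cdot>\<^bsub>C\<^esub> pb_pair C f (FObj (dprod C f) d) b y"

text \<open>Such a pair \<open>(t, b)\<close> is a generalised element of the pullback of
  \<open>x\<close> along \<open>f\<close>, described without mentioning the chosen pullback.\<close>

definition dspan :: "('o, 'a) cat \<Rightarrow> 'a \<Rightarrow> 'a \<Rightarrow> 'a \<Rightarrow> 'a \<Rightarrow> bool" where
  "dspan C f x t b \<longleftrightarrow> t \<in> Arr C \<and> b \<in> Arr C \<and> Cod C t = Dom C x \<and> Cod C b = Dom C f \<and>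
     Dom C b = Dom C t \<and> x \<cdot>\<^bsub>C\<^esub> t = f \<cdot>\<^bsub>C\<^esub> b"

context category
begin

lemma powerful_arr: "powerful C f \<Longrightarrow> f \<in> Arr C"
  and powerful_pullbacks: "powerful C f \<Longrightarrow> has_pullbacks_along C f"
  by (simp_all add: powerful_def)

lemma dprod_right_adjoint:
  assumes "powerful C f"
  shows "is_right_adjoint (slice C (Cod C f)) (slice C (Dom C f)) (pb_functor C f)
    (dprod C f) (dprod_ev C f)"
proof -
  obtain G e where "is_right_adjoint (slice C (Cod C f)) (slice C (Dom C f)) (pb_functor C f) G e"
    using assms by (auto simp: powerful_def)
  then have "is_right_adjoint (slice C (Cod C f)) (slice C (Dom C f)) (pb_functor C f)
    (fst (G, e)) (snd (G, e))" by simp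
  then show ?thesis
    unfolding dprod_def dprod_ev_def chosen_dprod_def by (rule someI)
qed

lemma dspan_comp:
  assumes "x \<in> Arr C" "f \<in> Arr C" "Cod C x = Cod C f" "dspan C f x t b" "r \<in> Arr C" "Cod C r = Dom C t"
  shows "dspan C f x (t \<cdot> r) (b \<cdot> r)"
  using assms comp_extend[of x t "f \<cdot> b" r] unfolding dspan_def by simp

section \<open>Evaluation, extensionality and transposition for dependent products along
  \<open>f\<close>\<close>

context
  fixes f d :: 'a
  assumes pow: "powerful C f" and dA: "d \<in> Arr C" and dC: "Cod C d = Dom C f"
begin

private abbreviation "p \<equiv> FObj (dprod C f) d"

lemma dprod_arr [simp]: "p \<in> Arr C" 
  and cod_dprod [simp]: "Cod C p = Cod C f"
  using dprod_right_adjoint[OF pow] dA dC 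
  by (auto simp: is_right_adjoint_def is_functor_def)

lemma dprod_ev_in: "dprod_ev C f d = (pb1 C f p, underlying (dprod_ev C f d), d)"
  and dprod_ev_arr [simp]: "underlying (dprod_ev C f d) \<in> Arr C"
  and dom_dprod_ev [simp]: "Dom C (underlying (dprod_ev C f d)) = Dom C (pb1 C f p)"
  and cod_dprod_ev [simp]: "Cod C (underlying (dprod_ev C f d)) = Dom C d"
  and dprod_ev_over: "d \<cdot> underlying (dprod_ev C f d) = pb1 C f p"
proof -
  have "d \<in> Obj (slice C (Dom C f))" using dA dC by simp
  then have "dprod_ev C f d \<in> hom (slice C (Dom C f)) (pb1 C f p) d"
    using dprod_right_adjoint[OF pow] by (simp add: is_right_adjoint_def)
  then show "dprod_ev C f d = (pb1 C f p, underlying (dprod_ev C f d), d)"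
   "underlying (dprod_ev C f d) \<in> Arr C"
   "Dom C (underlying (dprod_ev C f d)) = Dom C (pb1 C f p)"
   "Cod C (underlying (dprod_ev C f d)) = Dom C d"
   "d \<cdot> underlying (dprod_ev C f d) = pb1 C f p"
    unfolding hom_slice by blast+
qed

lemma dapp:
  assumes "dspan C f p y b"
  shows dapp_arr: "dapp C f d y b \<in> Arr C"
    and dom_dapp: "Dom C (dapp C f d y b) = Dom C y"
    and cod_dapp: "Cod C (dapp C f d y b) = Dom C d"
    and dapp_over: "d \<cdot> dapp C f d y b = b"
proof -
  note * = powerful_arr[OF pow] powerful_pullbacks[OF pow] 
  note pp = pb_pair[OF *(2) dprod_arr cod_dprod, of b y]
  show "dapp C f d y b \<in> Arr C" "Dom C (dapp C f d y b) = Dom C y" "Cod C (dapp C f d y b) = Dom C d"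
    using assms * pp unfolding dapp_def dspan_def by simp_all
  show "d \<cdot> dapp C f d y b = b"
    using assms * pp comp_extend[OF dprod_ev_over] dA unfolding dapp_def dspan_def by simp
qed

lemma dapp_comp:
  assumes "dspan C f p y b" "r \<in> Arr C" "Cod C r = Dom C y"
  shows "dapp C f d (y \<cdot> r) (b \<cdot> r) = dapp C f d y b \<cdot> r"
proof -
  note * = powerful_arr[OF pow] powerful_pullbacks[OF pow] 
  note pp = pb_pair[OF *(2) dprod_arr cod_dprod, of b y]
  show ?thesis
    using assms * pp pb_pair_comp[OF *(2) dprod_arr cod_dprod, of b y r]
    unfolding dapp_def dspan_def by simp
qed

text \<open>The adjunction bijection is thus evaluation at the generic pair, the two projections of
  the pullback of \<open>x\<close> along \<open>f\<close>. All rules for \<open>dapp\<close> below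
  come from this and from the fact that every pair factors through the generic one.\<close>

private lemma dapp_pb:
  assumes "x \<in> Arr C" "Cod C x = Cod C f" "h \<in> Arr C" "Dom C h = Dom C x" "Cod C h = Dom C p" "p \<cdot> h = x"
  shows "dprod_ev C f d \<cdot>\<^bsub>slice C (Dom C f)\<^esub> FArr (pb_functor C f) (x, h, p) =
    (pb1 C f x, dapp C f d (h \<cdot> pb2 C f x) (pb1 C f x), d)"
  by (subst dprod_ev_in) (simp add: dapp_def)

private lemma dspan_pb:
  assumes "x \<in> Arr C" "Cod C x = Cod C f"
  shows "dspan C f x (pb2 C f x) (pb1 C f x)"
  using assms pb_comm[OF powerful_pullbacks[OF pow] assms] powerful_pullbacks[OF pow] by (simp add: dspan_def)

private lemma dprod_bij:
  assumes "x \<in> Arr C" "Cod C x = Cod C f"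
  shows "bij_betw (\<lambda>h. dprod_ev C f d \<cdot>\<^bsub>slice C (Dom C f)\<^esub> FArr (pb_functor C f) h)
     (hom (slice C (Cod C f)) x p) (hom (slice C (Dom C f)) (pb1 C f x) d)"
  using dprod_right_adjoint[OF pow] dA dC assms unfolding is_right_adjoint_def by simp

lemma dspan_lift:
  assumes "y \<in> Arr C" "Cod C y = Dom C p" "dspan C f (p \<cdot> y) t b"
  shows "dspan C f p (y \<cdot> t) b"
proof -
  have "t \<in> Arr C" "Cod C t = Dom C y" using assms unfolding dspan_def by auto
  then show ?thesis using assms comp_assoc[of t y p] unfolding dspan_def by simp
qed

text \<open>Function extensionality over the base. Agreement on all pairs includes the generic one,
  where the value is the adjoint transpose, and the adjunction bijection is injective.\<close>

lemma dprod_ext: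
  assumes "y \<in> Arr C" "y' \<in> Arr C" "Cod C y = Dom C p" "Cod C y' = Dom C p" "Dom C y = Dom C y'" "p \<cdot> y = p \<cdot> y'"
    and eq: "\<And>t b. dspan C f (p \<cdot> y) t b \<Longrightarrow> dapp C f d (y \<cdot> t) b = dapp C f d (y' \<cdot> t) b"
  shows "y = y'"
proof -
  define x where "x = p \<cdot> y"
  have x: "x \<in> Arr C" "Cod C x = Cod C f" "Dom C y = Dom C x" using assms by (simp_all add: x_def)
  have "(x, y, p) = (x, y', p)"
  proof (rule inj_onD[OF bij_betw_imp_inj_on[OF dprod_bij[OF x(1,2)]]])
    show "dprod_ev C f d \<cdot>\<^bsub>slice C (Dom C f)\<^esub> FArr (pb_functor C f) (x, y, p) =
       dprod_ev C f d \<cdot>\<^bsub>slice C (Dom C f)\<^esub> FArr (pb_functor C f) (x, y', p)"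
      unfolding dapp_pb[OF x(1,2) assms(1) x(3) assms(3) x_def[symmetric]]
        dapp_pb[OF x(1,2) assms(2) x(3)[unfolded assms(5)] assms(4) assms(6)[symmetric, folded x_def]]
      using eq[OF dspan_pb[OF x(1,2), unfolded x_def]] unfolding x_def by simp
    show "(x, y, p) \<in> hom (slice C (Cod C f)) x p" "(x, y', p) \<in> hom (slice C (Cod C f)) x p"
      using assms x x_def by (simp_all add: hom_slice)
  qed
  then show ?thesis by simp
qed

text \<open>The last conclusion is the beta rule. It holds at the generic pair because
  \<open>dprod_transpose\<close> inverts the adjunction bijection; an arbitrary pair is the generic
  one precomposed with a pairing, so \<open>dapp_comp\<close> carries the rule over.\<close>

lemma dprod_transpose:
  assumes "x \<in> Arr C" "Cod C x = Cod C f" "k \<in> Arr C" "Dom C k = Dom C (pb1 C f x)" "Cod C k = Dom C d"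
    "d \<cdot> k = pb1 C f x"
  shows dprod_transpose_arr: "dprod_transpose C f x d k \<in> Arr C"
    and dom_dprod_transpose: "Dom C (dprod_transpose C f x d k) = Dom C x"
    and cod_dprod_transpose: "Cod C (dprod_transpose C f x d k) = Dom C p"
    and dprod_transpose_over: "p \<cdot> dprod_transpose C f x d k = x"
    and dapp_dprod_transpose:
      "dspan C f x t b \<Longrightarrow> dapp C f d (dprod_transpose C f x d k \<cdot> t) b = k \<cdot> pb_pair C f x b t"
proof -
  note P = powerful_arr[OF pow] powerful_pullbacks[OF pow] 
  let ?T = "\<lambda>h. dprod_ev C f d \<cdot>\<^bsub>slice C (Dom C f)\<^esub> FArr (pb_functor C f) h"
  define w where "w = inv_into (hom (slice C (Cod C f)) x p) ?T (pb1 C f x, k, d)"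
  have kin: "(pb1 C f x, k, d) \<in> ?T ` hom (slice C (Cod C f)) x p"
    using bij_betw_imp_surj_on[OF dprod_bij[OF assms(1,2)]] assms P dA dC by (simp add: hom_slice)
  have w: "w \<in> hom (slice C (Cod C f)) x p" "?T w = (pb1 C f x, k, d)"
    unfolding w_def using inv_into_into[OF kin] f_inv_into_f[OF kin] by auto
  have u: "dprod_transpose C f x d k = underlying w"
    by (simp add: dprod_transpose_def w_def)
  define h where "h = underlying w"
  have h: "w = (x, h, p)" "h \<in> Arr C" "Dom C h = Dom C x" "Cod C h = Dom C p" "p \<cdot> h = x"
    using w(1) unfolding hom_slice h_def by auto
  have k: "dapp C f d (h \<cdot> pb2 C f x) (pb1 C f x) = k"
    using w(2) unfolding h(1) dapp_pb[OF assms(1,2) h(2-5)] by simp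
  show "dprod_transpose C f x d k \<in> Arr C" "Dom C (dprod_transpose C f x d k) = Dom C x" 
    "Cod C (dprod_transpose C f x d k) = Dom C p" "p \<cdot> dprod_transpose C f x d k = x"
    using h unfolding u h_def by auto
  show "dapp C f d (dprod_transpose C f x d k \<cdot> t) b = k \<cdot> pb_pair C f x b t" if s: "dspan C f x t b"
  proof -
    note pp = pb_pair[OF P(2) assms(1,2), of b t]
    have "dspan C f (p \<cdot> h) (pb2 C f x) (pb1 C f x)" using dspan_pb[OF assms(1,2)] h by simp
    from dspan_lift[OF h(2,4) this]
    have sp: "dspan C f p (h \<cdot> pb2 C f x) (pb1 C f x)" .
    have "k \<cdot> pb_pair C f x b t =
      dapp C f d ((h \<cdot> pb2 C f x) \<cdot> pb_pair C f x b t) (pb1 C f x \<cdot> pb_pair C f x b t)"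
      unfolding k[symmetric] by (rule dapp_comp[OF sp, symmetric]) (use s pp assms h P in \<open>auto simp: dspan_def\<close>)
    also have "\<dots> = dapp C f d (h \<cdot> t) b"
      using s pp assms h P by (auto simp: dspan_def)
    finally show ?thesis using u h_def by simp
  qed
qed

text \<open>A Yoneda argument: the family \<open>s\<close> is determined by its value
  \<open>k\<close> at the generic pair, and stability under change of stage recovers every other
  value from \<open>k\<close>. The map itself is the transpose of \<open>k\<close>.\<close>

lemma dprod_lift:
  assumes x: "x \<in> Arr C" "Cod C x = Cod C f"
    and s: "\<And>t b. dspan C f x t b \<Longrightarrow> s t b \<in> Arr C \<and> Dom C (s t b) = Dom C t \<and> Cod C (s t b) = Dom C d \<and> d \<cdot> s t b = b"
    and nat: "\<And>t b r. dspan C f x t b \<Longrightarrow> r \<in> Arr C \<Longrightarrow> Cod C r = Dom C t \<Longrightarrow> s (t \<cdot> r) (b \<cdot> r) = s t b \<cdot> r"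
  obtains h where "h \<in> Arr C" "Dom C h = Dom C x" "Cod C h = Dom C p" "p \<cdot> h = x"
    "\<And>t b. dspan C f x t b \<Longrightarrow> dapp C f d (h \<cdot> t) b = s t b"
proof -
  note P = powerful_arr[OF pow] powerful_pullbacks[OF pow] 
  define k where "k = s (pb2 C f x) (pb1 C f x)"
  have k: "k \<in> Arr C" "Dom C k = Dom C (pb1 C f x)" "Cod C k = Dom C d" "d \<cdot> k = pb1 C f x"
    using s[OF dspan_pb[OF x]] P x unfolding k_def by auto
  have "dapp C f d (dprod_transpose C f x d k \<cdot> t) b = s t b" if sp: "dspan C f x t b" for t b
  proof -
    note pp = pb_pair[OF P(2) x, of b t]
    have "k \<cdot> pb_pair C f x b t = s (pb2 C f x \<cdot> pb_pair C f x b t) (pb1 C f x \<cdot> pb_pair C f x b t)"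
      unfolding k_def by (rule nat[OF dspan_pb[OF x], symmetric]) (use sp pp x P in \<open>auto simp: dspan_def\<close>)
    also have "\<dots> = s t b" using sp pp x by (simp add: dspan_def)
    finally show ?thesis using dapp_dprod_transpose[OF x k sp] by simp
  qed
  then show ?thesis using that dprod_transpose[OF x k] by blast
qed

end

text \<open>For transposes in the functor category only the value at the chosen projections is at
  hand. It suffices, since every pair factors through them.\<close>

lemma dprod_eqI_pb:
  assumes pow: "powerful C f" and d: "d \<in> Arr C" "Cod C d = Dom C f"
    and y: "y \<in> Arr C" "y' \<in> Arr C" "Cod C y = Dom C (FObj (dprod C f) d)" "Cod C y' = Dom C (FObj (dprod C f) d)"
      "Dom C y = Dom C y'"
    and x: "FObj (dprod C f) d \<cdot> y = x" "FObj (dprod C f) d \<cdot> y' = x"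
    and eq: "dapp C f d (y \<cdot> pb2 C f x) (pb1 C f x) = dapp C f d (y' \<cdot> pb2 C f x) (pb1 C f x)"
  shows "y = y'"
proof (rule dprod_ext[OF pow d y])
  note P = powerful_arr[OF pow] powerful_pullbacks[OF pow] 
  have X: "x \<in> Arr C" "Cod C x = Cod C f" "Dom C x = Dom C y" using x(1) y pow d by auto
  have pb: "dspan C f x (pb2 C f x) (pb1 C f x)"
    using pb_comm[OF P(2) X(1,2)] P X by (simp add: dspan_def)
  show "FObj (dprod C f) d \<cdot> y = FObj (dprod C f) d \<cdot> y'" using x by simp
  fix t b assume "dspan C f (FObj (dprod C f) d \<cdot> y) t b"
  then have s: "dspan C f x t b" unfolding x(1) .
  note m = pb_pair[OF P(2) X(1,2), of b t]
  have *: "dapp C f d (z \<cdot> t) b = dapp C f d (z \<cdot> pb2 C f x) (pb1 C f x) \<cdot> pb_pair C f x b t"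
    if z: "z \<in> Arr C" "Cod C z = Dom C (FObj (dprod C f) d)" "Dom C z = Dom C x" "FObj (dprod C f) d \<cdot> z = x" for z
  proof -
    have sp: "dspan C f (FObj (dprod C f) d) (z \<cdot> pb2 C f x) (pb1 C f x)"
      by (rule dspan_lift[OF pow d z(1,2)]) (use z(4) pb in simp)
    show ?thesis
      using dapp_comp[OF pow d sp, of "pb_pair C f x b t"] m s z(1-3) X P by (simp add: dspan_def)
  qed
  show "dapp C f d (y \<cdot> t) b = dapp C f d (y' \<cdot> t) b"
    using *[of y] *[of y'] y x X eq by simp
qed

text \<open>The last conclusion is naturality of the counit read on generalised elements: the
  dependent product acts on maps by postcomposing values.\<close>

lemma dprod_map:
  assumes pow: "powerful C f" and k: "k \<in> Arr C" "Dom C k = Dom C d" "Cod C k = Dom C d'" "d' \<cdot> k = d"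
    and d: "d \<in> Arr C" "Cod C d = Dom C f" "d' \<in> Arr C" "Cod C d' = Dom C f"
  shows dprod_map_arr: "underlying (FArr (dprod C f) (d, k, d')) \<in> Arr C" (is "?k \<in> _")
    and dom_dprod_map: "Dom C (underlying (FArr (dprod C f) (d, k, d'))) = Dom C (FObj (dprod C f) d)"
    and cod_dprod_map: "Cod C (underlying (FArr (dprod C f) (d, k, d'))) = Dom C (FObj (dprod C f) d')"
    and dprod_map_over: "FObj (dprod C f) d' \<cdot> underlying (FArr (dprod C f) (d, k, d')) = FObj (dprod C f) d"
    and dapp_dprod_map: "dspan C f (FObj (dprod C f) d) y b \<Longrightarrow>
       dapp C f d' (underlying (FArr (dprod C f) (d, k, d')) \<cdot> y) b = k \<cdot> dapp C f d y b"
proof -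
  note P = powerful_arr[OF pow] powerful_pullbacks[OF pow] 
  let ?p = "FObj (dprod C f) d" and ?p' = "FObj (dprod C f) d'"
  have w: "(d, k, d') \<in> Arr (slice C (Dom C f))"
    using k d by (simp add: Arr_slice hom_def)
  have "FArr (dprod C f) (d, k, d') \<in> hom (slice C (Cod C f)) ?p ?p'"
    using dprod_right_adjoint[OF pow] w unfolding is_right_adjoint_def is_functor_def by fastforce
  then have K: "FArr (dprod C f) (d, k, d') = (?p, ?k, ?p')" "?k \<in> Arr C" "Dom C ?k = Dom C ?p" "Cod C ?k = Dom C ?p'" "?p' \<cdot> ?k = ?p"
    unfolding hom_slice by blast+
  then show "?k \<in> Arr C" "Dom C ?k = Dom C ?p" "Cod C ?k = Dom C ?p'" "?p' \<cdot> ?k = ?p" by blast+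
  have "(d, k, d') \<cdot>\<^bsub>slice C (Dom C f)\<^esub> dprod_ev C f d =
     dprod_ev C f d' \<cdot>\<^bsub>slice C (Dom C f)\<^esub> FArr (pb_functor C f) (FArr (dprod C f) (d, k, d'))"
    using dprod_right_adjoint[OF pow] w unfolding is_right_adjoint_def by fastforce
  then have ev: "k \<cdot> underlying (dprod_ev C f d) = underlying (dprod_ev C f d') \<cdot>
      pb_pair C f ?p' (pb1 C f ?p) (?k \<cdot> pb2 C f ?p)"
    \<comment> \<open>The three slice arrows are first rewritten as explicit triples; only then does
      composition in the slice compute.\<close>
    apply (subst (asm) K(1)) 
    apply (subst (asm) dprod_ev_in[OF pow d(1,2)])
    apply (subst (asm) dprod_ev_in[OF pow d(3,4)])
    by simp
  show "dapp C f d' (?k \<cdot> y) b = k \<cdot> dapp C f d y b" if s: "dspan C f ?p y b"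
  proof -
    have p: "?p \<in> Arr C" "Cod C ?p = Cod C f" "?p' \<in> Arr C" "Cod C ?p' = Cod C f" using pow d by auto
    note pp = pb_pair[OF P(2) p(1,2), of b y]
    have c: "f \<cdot> pb1 C f ?p = ?p' \<cdot> (?k \<cdot> pb2 C f ?p)"
      using pb_comm[OF P(2) p(1,2)] comp_extend[OF K(5)] K p P by simp
    note pp' = pb_pair[OF P(2) p(3,4), of "pb1 C f ?p" "?k \<cdot> pb2 C f ?p"]
    have m: "pb_pair C f ?p' (pb1 C f ?p) (?k \<cdot> pb2 C f ?p) \<cdot> pb_pair C f ?p b y = pb_pair C f ?p' b (?k \<cdot> y)"
      by (subst pb_pair_comp[OF P(2) p(3,4)]) (use c K p P pp s in \<open>auto simp: dspan_def\<close>)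
    have "k \<cdot> dapp C f d y b = (k \<cdot> underlying (dprod_ev C f d)) \<cdot> pb_pair C f ?p b y"
      using k d pow pp s by (simp add: dapp_def dspan_def)
    also have "\<dots> = underlying (dprod_ev C f d') \<cdot> (pb_pair C f ?p' (pb1 C f ?p) (?k \<cdot> pb2 C f ?p) \<cdot> pb_pair C f ?p b y)"
      unfolding ev using k d pow pp pp' s K p P c by (simp add: dspan_def)
    finally show ?thesis unfolding m by (simp add: dapp_def)
  qed
qed

end

section \<open>Functor categories\<close>

locale diagrams = I: category I + E: category E
  for I :: "('i, 'u) cat" and E :: "('o, 'a) cat" +
  assumes pullbacks: "has_pullbacks E"
begin

abbreviation FC where "FC \<equiv> functor_cat I E"
abbreviation comp_E (infixl "\<bullet>" 70) where "h \<bullet> k \<equiv> h \<cdot>\<^bsub>E\<^esub> k"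
abbreviation comp_I (infixl "\<star>" 70) where "v \<star> u \<equiv> v \<cdot>\<^bsub>I\<^esub> u"

lemma pullbacks_along [simp]: "f \<in> Arr E \<Longrightarrow> has_pullbacks_along E f"
  using pullbacks by (simp add: has_pullbacks_def)

lemma functor_simps [simp]:
  assumes "is_functor I E X"
  shows "x \<in> Obj I \<Longrightarrow> FObj X x \<in> Obj E"
    "u \<in> Arr I \<Longrightarrow> FArr X u \<in> Arr E"
    "u \<in> Arr I \<Longrightarrow> Dom E (FArr X u) = FObj X (Dom I u)"
    "u \<in> Arr I \<Longrightarrow> Cod E (FArr X u) = FObj X (Cod I u)"
    "x \<in> Obj I \<Longrightarrow> FArr X (Id I x) = Id E (FObj X x)"
    "u \<in> Arr I \<Longrightarrow> v \<in> Arr I \<Longrightarrow> Cod I u = Dom I v \<Longrightarrow> FArr X (v \<star> u) = FArr X v \<bullet> FArr X u"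
  using assms unfolding is_functor_def by (auto simp: hom_def)

lemma Obj_FC: "X \<in> Obj FC \<longleftrightarrow> is_functor I E X \<and> ext_funct I X"
  by (simp add: functor_cat_def)

lemma Arr_FC: "t \<in> Arr FC \<longleftrightarrow> is_nat_trans I E t \<and> ext_funct I (Src t) \<and> ext_funct I (Tgt t)
    \<and> Cmp t \<in> extensional (Obj I)"
  by (simp add: functor_cat_def)

lemma Dom_FC [simp]: "Dom FC t = Src t"
  and Cod_FC [simp]: "Cod FC t = Tgt t"
  and Comp_FC: "s \<cdot>\<^bsub>FC\<^esub> t = \<lparr>Src = Src t, Tgt = Tgt s, Cmp = (\<lambda>x\<in>Obj I. Cmp s x \<bullet> Cmp t x)\<rparr>"
  and Id_FC: "Id FC X = \<lparr>Src = X, Tgt = X, Cmp = (\<lambda>x\<in>Obj I. Id E (FObj X x))\<rparr>"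
  by (simp_all add: functor_cat_def)

lemma Src_Comp [simp]: "Src (s \<cdot>\<^bsub>FC\<^esub> t) = Src t"
  and Tgt_Comp [simp]: "Tgt (s \<cdot>\<^bsub>FC\<^esub> t) = Tgt s"
  and Cmp_Comp [simp]: "x \<in> Obj I \<Longrightarrow> Cmp (s \<cdot>\<^bsub>FC\<^esub> t) x = Cmp s x \<bullet> Cmp t x"
  and Cmp_Id [simp]: "x \<in> Obj I \<Longrightarrow> Cmp (Id FC X) x = Id E (FObj X x)"
  by (simp_all add: Comp_FC Id_FC)

context
  fixes t assumes t: "t \<in> Arr FC"
begin

lemma Src_functor [simp]: "is_functor I E (Src t)"
  and Tgt_functor [simp]: "is_functor I E (Tgt t)"
  and Src_Obj [simp]: "Src t \<in> Obj FC"
  and Tgt_Obj [simp]: "Tgt t \<in> Obj FC"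
  and Cmp_arr [simp]: "x \<in> Obj I \<Longrightarrow> Cmp t x \<in> Arr E"
  and Dom_Cmp [simp]: "x \<in> Obj I \<Longrightarrow> Dom E (Cmp t x) = FObj (Src t) x"
  and Cod_Cmp [simp]: "x \<in> Obj I \<Longrightarrow> Cod E (Cmp t x) = FObj (Tgt t) x"
  and naturality: "u \<in> Arr I \<Longrightarrow>
    FArr (Tgt t) u \<bullet> Cmp t (Dom I u) = Cmp t (Cod I u) \<bullet> FArr (Src t) u"
  using t by (auto simp: Arr_FC is_nat_trans_def hom_def Obj_FC)

lemma naturality_extend:
  assumes "u \<in> Arr I" "y \<in> Arr E" "Cod E y = FObj (Src t) (Dom I u)"
  shows "FArr (Tgt t) u \<bullet> (Cmp t (Dom I u) \<bullet> y) = Cmp t (Cod I u) \<bullet> (FArr (Src t) u \<bullet> y)"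
  using E.comp_extend[OF naturality[OF assms(1)]] assms t by simp

end

lemma FC_eqI:
  assumes "s \<in> Arr FC" "t \<in> Arr FC" "Src s = Src t" "Tgt s = Tgt t"
    "\<And>x. x \<in> Obj I \<Longrightarrow> Cmp s x = Cmp t x"
  shows "s = t"
proof -
  have "Cmp s = Cmp t"
    using assms by (intro extensionalityI[of _ "Obj I"]) (auto simp: Arr_FC)
  with assms(3,4) show ?thesis by simp
qed

definition mk_nat :: "('i, 'u, 'o, 'a) funct \<Rightarrow> ('i, 'u, 'o, 'a) funct \<Rightarrow> ('i \<Rightarrow> 'a) \<Rightarrow> ('i, 'u, 'o, 'a) nat_trans"
  where "mk_nat X Y c = \<lparr>Src = X, Tgt = Y, Cmp = restrict c (Obj I)\<rparr>"

lemma mk_nat_simps [simp]: "Src (mk_nat X Y c) = X" "Tgt (mk_nat X Y c) = Y"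
  "x \<in> Obj I \<Longrightarrow> Cmp (mk_nat X Y c) x = c x"
  by (simp_all add: mk_nat_def)

lemma mk_nat_arr:
  assumes "X \<in> Obj FC" "Y \<in> Obj FC"
    "\<And>x. x \<in> Obj I \<Longrightarrow> c x \<in> Arr E" "\<And>x. x \<in> Obj I \<Longrightarrow> Dom E (c x) = FObj X x"
    "\<And>x. x \<in> Obj I \<Longrightarrow> Cod E (c x) = FObj Y x"
    "\<And>u. u \<in> Arr I \<Longrightarrow> FArr Y u \<bullet> c (Dom I u) = c (Cod I u) \<bullet> FArr X u"
  shows "mk_nat X Y c \<in> Arr FC"
  using assms by (simp add: Arr_FC Obj_FC is_nat_trans_def mk_nat_def hom_def)

definition mk_funct :: "('i \<Rightarrow> 'o) \<Rightarrow> ('u \<Rightarrow> 'a) \<Rightarrow> ('i, 'u, 'o, 'a) funct"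
  where "mk_funct X h = \<lparr>FObj = restrict X (Obj I), FArr = restrict h (Arr I)\<rparr>"

lemma mk_funct_simps [simp]: "x \<in> Obj I \<Longrightarrow> FObj (mk_funct X h) x = X x"
  "u \<in> Arr I \<Longrightarrow> FArr (mk_funct X h) u = h u"
  by (simp_all add: mk_funct_def)

lemma mk_funct_Obj:
  assumes "\<And>x. x \<in> Obj I \<Longrightarrow> X x \<in> Obj E" "\<And>u. u \<in> Arr I \<Longrightarrow> h u \<in> Arr E"
    "\<And>u. u \<in> Arr I \<Longrightarrow> Dom E (h u) = X (Dom I u)" "\<And>u. u \<in> Arr I \<Longrightarrow> Cod E (h u) = X (Cod I u)"
    "\<And>x. x \<in> Obj I \<Longrightarrow> h (Id I x) = Id E (X x)"
    "\<And>u v. u \<in> Arr I \<Longrightarrow> v \<in> Arr I \<Longrightarrow> Cod I u = Dom I v \<Longrightarrow> h (v \<star> u) = h v \<bullet> h u"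
  shows "mk_funct X h \<in> Obj FC"
  using assms by (simp add: Obj_FC is_functor_def ext_funct_def mk_funct_def hom_def)

lemma Comp_FC_mk_nat: "s \<cdot>\<^bsub>FC\<^esub> t = mk_nat (Src t) (Tgt s) (\<lambda>x. Cmp s x \<bullet> Cmp t x)"
  and Id_FC_mk_nat: "Id FC X = mk_nat X X (\<lambda>x. Id E (FObj X x))"
  by (simp_all add: Comp_FC Id_FC mk_nat_def)

lemma Comp_FC_arr:
  assumes "s \<in> Arr FC" "t \<in> Arr FC" "Tgt t = Src s"
  shows "s \<cdot>\<^bsub>FC\<^esub> t \<in> Arr FC"
  unfolding Comp_FC_mk_nat
proof (rule mk_nat_arr)
  fix u assume "u \<in> Arr I"
  then show "FArr (Tgt s) u \<bullet> (Cmp s (Dom I u) \<bullet> Cmp t (Dom I u)) =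
      Cmp s (Cod I u) \<bullet> Cmp t (Cod I u) \<bullet> FArr (Src t) u"
    using assms naturality[OF assms(2), of u] naturality_extend[OF assms(1), of u] by simp
qed (use assms in simp_all)

lemma Id_FC_arr: "X \<in> Obj FC \<Longrightarrow> Id FC X \<in> Arr FC"
  unfolding Id_FC_mk_nat by (rule mk_nat_arr) (simp_all add: Obj_FC)

sublocale FC: category FC
proof
  fix f assume "f \<in> Arr FC"
  then show "Dom FC f \<in> Obj FC" "Cod FC f \<in> Obj FC" by simp_all
next
  fix x assume "x \<in> Obj FC"
  then show "Id FC x \<in> hom FC x x" using Id_FC_arr by (simp add: hom_def Id_FC)
next
  fix f x y g z assume "f \<in> hom FC x y" "g \<in> hom FC y z"
  then show "g \<cdot>\<^bsub>FC\<^esub> f \<in> hom FC x z" using Comp_FC_arr by (auto simp: hom_def)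
next
  fix f x y assume "f \<in> hom FC x y"
  then have f: "f \<in> Arr FC" "Src f = x" "Tgt f = y" by (auto simp: hom_def)
  have 1: "Id FC y \<in> Arr FC" "Id FC x \<in> Arr FC" "Src (Id FC y) = y" "Tgt (Id FC y) = y" "Tgt (Id FC x) = x" "Src (Id FC x) = x"
    using f Id_FC_arr by (auto simp: Id_FC)
  show "Id FC y \<cdot>\<^bsub>FC\<^esub> f = f"
    by (rule FC_eqI[OF Comp_FC_arr]) (use f 1 in auto)
  show "f \<cdot>\<^bsub>FC\<^esub> Id FC x = f"
    by (rule FC_eqI[OF Comp_FC_arr]) (use f 1 in auto)
next
  fix f w x g y h z assume "f \<in> hom FC w x" "g \<in> hom FC x y" "h \<in> hom FC y z"
  then have f: "f \<in> Arr FC" "g \<in> Arr FC" "h \<in> Arr FC" "Tgt f = Src g" "Tgt g = Src h" by (auto simp: hom_def)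
  show "h \<cdot>\<^bsub>FC\<^esub> (g \<cdot>\<^bsub>FC\<^esub> f) = (h \<cdot>\<^bsub>FC\<^esub> g) \<cdot>\<^bsub>FC\<^esub> f"
    by (rule FC_eqI) (use f in \<open>auto intro!: Comp_FC_arr\<close>)
qed

lemma Cmp_inverse:
  assumes "are_inverse FC t t'" "i \<in> Obj I"
  shows "are_inverse E (Cmp t i) (Cmp t' i)"
proof -
  have t: "t \<in> Arr FC" "t' \<in> Arr FC" "Src t' = Tgt t" "Tgt t' = Src t"
    and c: "t' \<cdot>\<^bsub>FC\<^esub> t = Id FC (Src t)" "t \<cdot>\<^bsub>FC\<^esub> t' = Id FC (Tgt t)"
    using assms(1) by (auto simp: are_inverse_def hom_def)
  have "Cmp t' i \<bullet> Cmp t i = Id E (FObj (Src t) i)" "Cmp t i \<bullet> Cmp t' i = Id E (FObj (Tgt t) i)"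
    using arg_cong[OF c(1), of "\<lambda>s. Cmp s i"] arg_cong[OF c(2), of "\<lambda>s. Cmp s i"] assms(2) by simp_all
  then show ?thesis using t assms(2) by (simp add: are_inverse_def hom_def)
qed

text \<open>Pullbacks are chosen componentwise, arrows act by the induced maps between them, and the
  functor laws hold by uniqueness. Only existence is claimed, because the pullback that
  \<open>pb1\<close> and \<open>pb2\<close> choose in the functor category need not be this
  one.\<close>

lemma pointwise_pullback_ex:
  assumes f: "f \<in> Arr FC" and t: "t \<in> Arr FC" and ft: "Tgt t = Tgt f"
  obtains p q where "is_pullback FC f t p q"
    "\<And>i. i \<in> Obj I \<Longrightarrow> is_pullback E (Cmp f i) (Cmp t i) (Cmp p i) (Cmp q i)"
proof -
  define p1 where "p1 i = pb1 E (Cmp f i) (Cmp t i)" for i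
  define p2 where "p2 i = pb2 E (Cmp f i) (Cmp t i)" for i
  define P where "P u = pb_pair E (Cmp f (Cod I u)) (Cmp t (Cod I u))
     (FArr (Src f) u \<bullet> p1 (Dom I u)) (FArr (Src t) u \<bullet> p2 (Dom I u))" for u
  have pb: "is_pullback E (Cmp f i) (Cmp t i) (p1 i) (p2 i)" if "i \<in> Obj I" for i
    unfolding p1_def p2_def by (rule E.chosen_pullback) (use f t ft that in simp_all)
  have p [simp]: "p1 i \<in> Arr E" "p2 i \<in> Arr E" "Cod E (p1 i) = FObj (Src f) i"
     "Cod E (p2 i) = FObj (Src t) i" "Dom E (p2 i) = Dom E (p1 i)" if "i \<in> Obj I" for i
    using E.is_pullbackD[OF pb[OF that]] f t that by simp_all
  have comm: "Cmp f i \<bullet> p1 i = Cmp t i \<bullet> p2 i" if "i \<in> Obj I" for i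
    using E.is_pullbackD[OF pb[OF that]] by simp
  note ext = E.pullback_eqI[OF pb]
  have P [simp]: "P u \<in> Arr E" "Dom E (P u) = Dom E (p1 (Dom I u))" "Cod E (P u) = Dom E (p1 (Cod I u))"
     and P1: "p1 (Cod I u) \<bullet> P u = FArr (Src f) u \<bullet> p1 (Dom I u)"
     and P2: "p2 (Cod I u) \<bullet> P u = FArr (Src t) u \<bullet> p2 (Dom I u)" if u: "u \<in> Arr I" for u
  proof -
    have eq: "Cmp f (Cod I u) \<bullet> (FArr (Src f) u \<bullet> p1 (Dom I u)) = Cmp t (Cod I u) \<bullet> (FArr (Src t) u \<bullet> p2 (Dom I u))"
      using naturality_extend[OF f u, of "p1 (Dom I u)"] naturality_extend[OF t u, of "p2 (Dom I u)"]
        comm[of "Dom I u"] u f t ft by simp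
    note pp = E.pb_pair[of "Cmp f (Cod I u)" "Cmp t (Cod I u)", OF _ _ _ _ _ _ _ _ eq, folded P_def p1_def p2_def]
    show "P u \<in> Arr E" "Dom E (P u) = Dom E (p1 (Dom I u))" "Cod E (P u) = Dom E (p1 (Cod I u))"
      "p1 (Cod I u) \<bullet> P u = FArr (Src f) u \<bullet> p1 (Dom I u)"
      "p2 (Cod I u) \<bullet> P u = FArr (Src t) u \<bullet> p2 (Dom I u)"
      using pp u f t ft by simp_all
  qed
  have P1x: "p1 (Cod I u) \<bullet> (P u \<bullet> y) = FArr (Src f) u \<bullet> (p1 (Dom I u) \<bullet> y)"
     and P2x: "p2 (Cod I u) \<bullet> (P u \<bullet> y) = FArr (Src t) u \<bullet> (p2 (Dom I u) \<bullet> y)"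
    if "u \<in> Arr I" "y \<in> Arr E" "Cod E y = Dom E (p1 (Dom I u))" for u y
    using E.comp_extend[OF P1[OF that(1)], of y] E.comp_extend[OF P2[OF that(1)], of y] that f t by simp_all
  define Q where "Q = mk_funct (\<lambda>i. Dom E (p1 i)) P"
  have Q: "Q \<in> Obj FC"
    unfolding Q_def
  proof (rule mk_funct_Obj)
    fix x assume x: "x \<in> Obj I"
    show "P (Id I x) = Id E (Dom E (p1 x))"
      by (rule ext[OF x]) (use x f t P1[of "Id I x"] P2[of "Id I x"] in simp_all)
  next
    fix u v assume uv: "u \<in> Arr I" "v \<in> Arr I" "Cod I u = Dom I v"
    show "P (v \<star> u) = P v \<bullet> P u"
      by (rule ext[of "Cod I v"]) (use uv f t P1[of "v \<star> u"] P2[of "v \<star> u"] P1[of u] P2[of u] P1x[of v] P2x[of v] in simp_all)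
  qed simp_all
  have QF: "FObj Q i = Dom E (p1 i)" if "i \<in> Obj I" for i
    using that by (simp add: Q_def)
  define p where "p = mk_nat Q (Src f) p1"
  define q where "q = mk_nat Q (Src t) p2"
  have pq: "p \<in> Arr FC" "q \<in> Arr FC"
    unfolding p_def q_def by (rule mk_nat_arr; use Q f t in \<open>simp add: Q_def P1 P2\<close>)+
  have c: "Cmp p i = p1 i" "Cmp q i = p2 i" if "i \<in> Obj I" for i
    using that by (simp_all add: p_def q_def)
  have st: "Src p = Q" "Src q = Q" "Tgt p = Src f" "Tgt q = Src t" by (simp_all add: p_def q_def)
  have "is_pullback FC f t p q"
  proof (rule FC.is_pullbackI)
    show "f \<cdot>\<^bsub>FC\<^esub> p = t \<cdot>\<^bsub>FC\<^esub> q"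
      by (rule FC_eqI) (use pq st c comm f t ft in simp_all)
  next
    fix x y assume xy: "x \<in> Arr FC" "y \<in> Arr FC" "Dom FC x = Dom FC y" "Cod FC x = Dom FC f"
      "Cod FC y = Dom FC t" "f \<cdot>\<^bsub>FC\<^esub> x = t \<cdot>\<^bsub>FC\<^esub> y"
    then have xy': "Src x = Src y" "Tgt x = Src f" "Tgt y = Src t" by simp_all
    have e: "Cmp f i \<bullet> Cmp x i = Cmp t i \<bullet> Cmp y i" if "i \<in> Obj I" for i
      using arg_cong[OF xy(6), of "\<lambda>s. Cmp s i"] that by simp
    have "\<exists>h. h \<in> Arr E \<and> Dom E h = FObj (Src y) i \<and> Cod E h = Dom E (p1 i) \<and> p1 i \<bullet> h = Cmp x i \<and> p2 i \<bullet> h = Cmp y i"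
      if i: "i \<in> Obj I" for i
      by (rule E.pullback_lift[OF pb[OF i], of "Cmp x i" "Cmp y i"]) (use xy xy' e[OF i] i f t in auto)
    then obtain h where h: "h i \<in> Arr E" "Dom E (h i) = FObj (Src y) i" "Cod E (h i) = Dom E (p1 i)" 
        "p1 i \<bullet> h i = Cmp x i" "p2 i \<bullet> h i = Cmp y i"
      if "i \<in> Obj I" for i by metis
    have hn: "P u \<bullet> h (Dom I u) = h (Cod I u) \<bullet> FArr (Src y) u" if u: "u \<in> Arr I" for u
    proof (rule ext[of "Cod I u"])
      show "p1 (Cod I u) \<bullet> (P u \<bullet> h (Dom I u)) = p1 (Cod I u) \<bullet> (h (Cod I u) \<bullet> FArr (Src y) u)"
        "p2 (Cod I u) \<bullet> (P u \<bullet> h (Dom I u)) = p2 (Cod I u) \<bullet> (h (Cod I u) \<bullet> FArr (Src y) u)"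
        using P1x[OF u] P2x[OF u] u h[of "Dom I u"] h(1-3)[of "Cod I u"] xy xy' f t
          E.comp_extend[OF h(4)[of "Cod I u"]] E.comp_extend[OF h(5)[of "Cod I u"]] 
          naturality[OF xy(1) u] naturality[OF xy(2) u] by simp_all
    qed (use u h xy in simp_all)
    show "\<exists>h. h \<in> Arr FC \<and> Dom FC h = Dom FC y \<and> Cod FC h = Dom FC p \<and> p \<cdot>\<^bsub>FC\<^esub> h = x \<and> q \<cdot>\<^bsub>FC\<^esub> h = y"
    proof (rule exI[of _ "mk_nat (Src y) Q h"], intro conjI)
      show 1: "mk_nat (Src y) Q h \<in> Arr FC"
        by (rule mk_nat_arr) (use xy Q h hn in \<open>simp_all add: Q_def\<close>)
      show "p \<cdot>\<^bsub>FC\<^esub> mk_nat (Src y) Q h = x" "q \<cdot>\<^bsub>FC\<^esub> mk_nat (Src y) Q h = y"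
        by (rule FC_eqI; use 1 pq st c h xy xy' in simp)+
    qed (use st in simp_all)
  next
    fix h h' assume h: "h \<in> Arr FC" "h' \<in> Arr FC" "Dom FC h = Dom FC h'" "Cod FC h = Dom FC p" "Cod FC h' = Dom FC p"
      and e: "p \<cdot>\<^bsub>FC\<^esub> h = p \<cdot>\<^bsub>FC\<^esub> h'" "q \<cdot>\<^bsub>FC\<^esub> h = q \<cdot>\<^bsub>FC\<^esub> h'"
    then have h': "Src h = Src h'" "Tgt h = Q" "Tgt h' = Q" using st by simp_all
    show "h = h'"
    proof (rule FC_eqI)
      fix i assume i: "i \<in> Obj I"
      show "Cmp h i = Cmp h' i"
        by (rule ext[OF i])
          (use i h(1,2) h' c QF arg_cong[OF e(1), of "\<lambda>s. Cmp s i"] arg_cong[OF e(2), of "\<lambda>s. Cmp s i"] in simp_all)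
    qed (use h h' in simp_all)
  qed (use f t ft pq st in simp_all)
  then show ?thesis using that pb c by simp
qed

lemma has_pullbacks_along_FC: "f \<in> Arr FC \<Longrightarrow> has_pullbacks_along FC f"
  unfolding has_pullbacks_along_def using pointwise_pullback_ex by (metis Cod_FC)

text \<open>An arbitrary pullback is isomorphic to a componentwise one, and evaluating that
  isomorphism at \<open>i\<close> gives an isomorphism. In particular this covers the chosen
  pullbacks.\<close>

lemma Cmp_pullback:
  assumes pb: "is_pullback FC f t p q" and i: "i \<in> Obj I"
  shows "is_pullback E (Cmp f i) (Cmp t i) (Cmp p i) (Cmp q i)"
proof -
  note F = FC.is_pullbackD[OF pb]
  obtain p' q' where pb': "is_pullback FC f t p' q'"
    and pw: "is_pullback E (Cmp f i) (Cmp t i) (Cmp p' i) (Cmp q' i)"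
    using pointwise_pullback_ex[of f t] F i by (metis Cod_FC)
  obtain s s' where s: "are_inverse FC s s'" "Dom FC s = Dom FC p" "Cod FC s = Dom FC p'"
     "p' \<cdot>\<^bsub>FC\<^esub> s = p" "q' \<cdot>\<^bsub>FC\<^esub> s = q"
    using FC.is_pullback_comparison[OF pb' pb] by blast
  have "is_pullback E (Cmp f i) (Cmp t i) (Cmp p' i \<bullet> Cmp s i) (Cmp q' i \<bullet> Cmp s i)"
    by (rule E.is_pullback_iso[OF pw Cmp_inverse[OF s(1) i]])
      (use s i FC.is_pullbackD[OF pb'] in \<open>simp add: are_inverse_def\<close>)
  then show ?thesis using s(4,5) i by auto
qed

end

section \<open>Matching objects\<close>

locale matching = diagrams I E for I :: "('i, 'u) cat" and E :: "('o, 'a) cat" +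
  fixes deg :: "'i \<Rightarrow> nat"
  assumes inverse_cat: "generalised_inverse_category I deg"
    and limits: "\<And>i. i \<in> Obj I \<Longrightarrow> has_limits_of_shape (lower_coslice I deg i) E"
begin

definition low :: "'i \<Rightarrow> 'u \<Rightarrow> bool" where
  "low i u \<longleftrightarrow> u \<in> Arr I \<and> Dom I u = i \<and> deg (Cod I u) < deg i"

lemma lowD [dest]: "low i u \<Longrightarrow> u \<in> Arr I" "low i u \<Longrightarrow> Dom I u = i" "low i u \<Longrightarrow> deg (Cod I u) < deg i"
  by (simp_all add: low_def)

lemma deg_le: "u \<in> Arr I \<Longrightarrow> deg (Cod I u) \<le> deg (Dom I u)"
  using inverse_cat unfolding generalised_inverse_category_def by (metis less_imp_le order_refl)

lemma not_low_iso: "u \<in> Arr I \<Longrightarrow> \<not> low (Dom I u) u \<Longrightarrow> is_iso I u"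
  using inverse_cat unfolding generalised_inverse_category_def low_def by blast

lemma low_comp: "low i u \<Longrightarrow> h \<in> Arr I \<Longrightarrow> Dom I h = Cod I u \<Longrightarrow> low i (h \<star> u)"
  using deg_le[of h] by (simp add: low_def)

text \<open>A functor only as far as the matching object at \<open>i\<close> can see. During the
  induction the diagram of local dependent products is available below \<open>deg i\<close> only, so
  \<open>is_functor\<close> cannot be asked for. It is enough to bound the degrees of sources, since
  arrows never raise the degree.\<close>

definition low_functor :: "'i \<Rightarrow> ('i, 'u, 'o, 'a) funct \<Rightarrow> bool" where
  "low_functor i X \<longleftrightarrow>
     (\<forall>j\<in>Obj I. deg j < deg i \<longrightarrow> FObj X j \<in> Obj E \<and> FArr X (Id I j) = Id E (FObj X j)) \<and>
     (\<forall>u\<in>Arr I. deg (Dom I u) < deg i \<longrightarrow> FArr X u \<in> Arr E \<and>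
        Dom E (FArr X u) = FObj X (Dom I u) \<and> Cod E (FArr X u) = FObj X (Cod I u)) \<and>
     (\<forall>u\<in>Arr I. \<forall>v\<in>Arr I. deg (Dom I u) < deg i \<longrightarrow> Cod I u = Dom I v \<longrightarrow>
        FArr X (v \<star> u) = FArr X v \<bullet> FArr X u)"

lemma functor_low [simp]: "is_functor I E X \<Longrightarrow> low_functor i X"
  by (simp add: low_functor_def)

abbreviation low_cat where "low_cat i \<equiv> lower_coslice I deg i"

lemma Obj_low_cat: "u \<in> Obj (low_cat i) \<longleftrightarrow> low i u"
  by (auto simp: lower_coslice_def full_subcat_def coslice_def low_def)

lemma Arr_low_cat: "w \<in> Arr (low_cat i) \<longleftrightarrow> (\<exists>a h. w = (a, h, h \<star> a) \<and> low i a \<and> h \<in> Arr I \<and> Dom I h = Cod I a)"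
proof
  assume "w \<in> Arr (low_cat i)"
  then show "\<exists>a h. w = (a, h, h \<star> a) \<and> low i a \<and> h \<in> Arr I \<and> Dom I h = Cod I a"
    by (auto simp: lower_coslice_def full_subcat_def coslice_def low_def hom_def)
next
  assume "\<exists>a h. w = (a, h, h \<star> a) \<and> low i a \<and> h \<in> Arr I \<and> Dom I h = Cod I a"
  then show "w \<in> Arr (low_cat i)"
    using low_comp by (auto simp: lower_coslice_def full_subcat_def coslice_def low_def hom_def)
qed

lemma low_cat_simps [simp]: "Dom (low_cat i) (a, h, b) = a" "Cod (low_cat i) (a, h, b) = b"
  "Id (low_cat i) a = (a, Id I (Cod I a), a)"
  "(b, k, c) \<cdot>\<^bsub>low_cat i\<^esub> (a, h, b') = (a, k \<star> h, c)"
  by (simp_all add: lower_coslice_def full_subcat_def coslice_def)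

lemma is_functor_lower_diagram:
  assumes "low_functor i X"
  shows "is_functor (low_cat i) E (lower_diagram I X)"
  using assms unfolding is_functor_def Ball_def Obj_low_cat Arr_low_cat lower_diagram_def low_functor_def low_def
  by (auto simp: hom_def)

abbreviation "Lim i X \<equiv> lim_obj (low_cat i) E (lower_diagram I X)"
abbreviation "prj i X \<equiv> lim_proj (low_cat i) E (lower_diagram I X)"
abbreviation "lift i X \<equiv> lim_lift (low_cat i) E (lower_diagram I X)"

definition low_cone :: "'i \<Rightarrow> ('i, 'u, 'o, 'a) funct \<Rightarrow> 'o \<Rightarrow> ('u \<Rightarrow> 'a) \<Rightarrow> bool" where
  "low_cone i X x c \<longleftrightarrow> x \<in> Obj E \<and>
     (\<forall>u. low i u \<longrightarrow> c u \<in> Arr E \<and> Dom E (c u) = x \<and> Cod E (c u) = FObj X (Cod I u)) \<and>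
     (\<forall>u h. low i u \<longrightarrow> h \<in> Arr I \<longrightarrow> Dom I h = Cod I u \<longrightarrow> FArr X h \<bullet> c u = c (h \<star> u))"

lemma is_cone_iff: "is_cone (low_cat i) E (lower_diagram I X) x c \<longleftrightarrow> low_cone i X x c"
  unfolding is_cone_def Ball_def Obj_low_cat Arr_low_cat low_cone_def lower_diagram_def
  by (auto simp: hom_def)

context
  fixes i X assumes i: "i \<in> Obj I" and X: "low_functor i X"
begin

lemma chosen_limit: "is_limit (low_cat i) E (lower_diagram I X) (Lim i X) (prj i X)"
proof -
  obtain l p where "is_limit (low_cat i) E (lower_diagram I X) l p"
    using limits[OF i] is_functor_lower_diagram[OF X] unfolding has_limits_of_shape_def by blast
  then have "is_limit (low_cat i) E (lower_diagram I X) (fst (l, p)) (snd (l, p))" by simp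
  then show ?thesis unfolding lim_obj_def lim_proj_def chosen_limit_def by (rule someI)
qed

lemma prj_cone: "low_cone i X (Lim i X) (prj i X)"
  using chosen_limit unfolding is_limit_def is_cone_iff by blast

lemma Lim_Obj [simp]: "Lim i X \<in> Obj E"
  and prj_arr [simp]: "low i u \<Longrightarrow> prj i X u \<in> Arr E"
  and Dom_prj [simp]: "low i u \<Longrightarrow> Dom E (prj i X u) = Lim i X"
  and Cod_prj [simp]: "low i u \<Longrightarrow> Cod E (prj i X u) = FObj X (Cod I u)"
  and prj_comp: "low i u \<Longrightarrow> h \<in> Arr I \<Longrightarrow> Dom I h = Cod I u \<Longrightarrow> FArr X h \<bullet> prj i X u = prj i X (h \<star> u)"
  using prj_cone unfolding low_cone_def by blast+

lemma lift:
  assumes "low_cone i X x c"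
  shows lift_arr: "lift i X x c \<in> Arr E"
    and Dom_lift: "Dom E (lift i X x c) = x"
    and Cod_lift: "Cod E (lift i X x c) = Lim i X"
    and prj_lift: "low i u \<Longrightarrow> prj i X u \<bullet> lift i X x c = c u"
proof -
  have "\<exists>!h. h \<in> hom E x (Lim i X) \<and> (\<forall>j\<in>Obj (low_cat i). prj i X j \<bullet> h = c j)"
    using chosen_limit assms unfolding is_limit_def is_cone_iff by blast
  from theI'[OF this, folded lim_lift_def]
  show "lift i X x c \<in> Arr E" "Dom E (lift i X x c) = x" "Cod E (lift i X x c) = Lim i X"
    "low i u \<Longrightarrow> prj i X u \<bullet> lift i X x c = c u"
    by (simp_all add: hom_def Obj_low_cat)
qed

lemma lim_eqI:
  assumes "h \<in> Arr E" "h' \<in> Arr E" "Dom E h = Dom E h'" "Cod E h = Lim i X" "Cod E h' = Lim i X"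
    "\<And>u. low i u \<Longrightarrow> prj i X u \<bullet> h = prj i X u \<bullet> h'"
  shows "h = h'"
proof -
  have "low_cone i X (Dom E h) (\<lambda>u. prj i X u \<bullet> h)"
    unfolding low_cone_def
  proof (intro conjI allI impI)
    fix u k assume u: "low i u" "k \<in> Arr I" "Dom I k = Cod I u"
    have k: "FArr X k \<in> Arr E" "Dom E (FArr X k) = FObj X (Cod I u)"
      using X u unfolding low_functor_def low_def by auto
    show "FArr X k \<bullet> (prj i X u \<bullet> h) = prj i X (k \<star> u) \<bullet> h"
      using E.comp_extend[OF prj_comp[OF u], of h] u assms k by simp
  qed (use assms in simp_all)
  then have "\<exists>!k. k \<in> hom E (Dom E h) (Lim i X) \<and> (\<forall>j\<in>Obj (low_cat i). prj i X j \<bullet> k = prj i X j \<bullet> h)"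
    using chosen_limit unfolding is_limit_def is_cone_iff by blast
  moreover have "h \<in> hom E (Dom E h) (Lim i X)" "h' \<in> hom E (Dom E h) (Lim i X)"
    using assms by (simp_all add: hom_def)
  ultimately show ?thesis using assms(6) Obj_low_cat by metis
qed

end

lemma match_obj_eq [simp]: "match_obj I deg E i X = Lim i X"
  by (simp add: match_obj_def)

lemma match_map:
  assumes i: "i \<in> Obj I" and X: "is_functor I E X"
  shows match_map_arr [simp]: "match_map I deg E i X \<in> Arr E"
    and Dom_match_map [simp]: "Dom E (match_map I deg E i X) = FObj X i"
    and Cod_match_map [simp]: "Cod E (match_map I deg E i X) = Lim i X"
    and prj_match_map: "low i u \<Longrightarrow> prj i X u \<bullet> match_map I deg E i X = FArr X u"
proof -
  have c: "low_cone i X (FObj X i) (FArr X)"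
    using X i by (auto simp: low_cone_def low_def)
  show "match_map I deg E i X \<in> Arr E" "Dom E (match_map I deg E i X) = FObj X i"
    "Cod E (match_map I deg E i X) = Lim i X"
    "low i u \<Longrightarrow> prj i X u \<bullet> match_map I deg E i X = FArr X u"
    unfolding match_map_def using lift[OF i functor_low[OF X] c] by auto
qed

lemma match_arr:
  assumes i: "i \<in> Obj I" and t: "t \<in> Arr FC"
  shows match_arr_arr [simp]: "match_arr I deg E i t \<in> Arr E"
    and Dom_match_arr [simp]: "Dom E (match_arr I deg E i t) = Lim i (Src t)"
    and Cod_match_arr [simp]: "Cod E (match_arr I deg E i t) = Lim i (Tgt t)"
    and prj_match_arr: "low i u \<Longrightarrow>
      prj i (Tgt t) u \<bullet> match_arr I deg E i t = Cmp t (Cod I u) \<bullet> prj i (Src t) u"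
proof -
  have c: "low_cone i (Tgt t) (Lim i (Src t)) (\<lambda>u. Cmp t (Cod I u) \<bullet> prj i (Src t) u)"
    unfolding low_cone_def
  proof (intro conjI allI impI)
    fix u k assume u: "low i u" "k \<in> Arr I" "Dom I k = Cod I u"
    show "FArr (Tgt t) k \<bullet> (Cmp t (Cod I u) \<bullet> prj i (Src t) u) =
       Cmp t (Cod I (k \<star> u)) \<bullet> prj i (Src t) (k \<star> u)"
      using naturality_extend[OF t u(2), of "prj i (Src t) u"] prj_comp[OF i _ u, of "Src t"] u i t lowD(1)[OF u(1)] by simp
  next
    fix u assume u: "low i u"
    then have "u \<in> Arr I" by auto
    with u show "Cmp t (Cod I u) \<bullet> prj i (Src t) u \<in> Arr E"
      "Dom E (Cmp t (Cod I u) \<bullet> prj i (Src t) u) = Lim i (Src t)"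
      "Cod E (Cmp t (Cod I u) \<bullet> prj i (Src t) u) = FObj (Tgt t) (Cod I u)"
      using i t by simp_all
  qed (use i t in simp)
  show "match_arr I deg E i t \<in> Arr E" "Dom E (match_arr I deg E i t) = Lim i (Src t)"
    "Cod E (match_arr I deg E i t) = Lim i (Tgt t)"
    "low i u \<Longrightarrow> prj i (Tgt t) u \<bullet> match_arr I deg E i t = Cmp t (Cod I u) \<bullet> prj i (Src t) u"
    unfolding match_arr_def match_obj_eq using lift[OF i _ c] t by auto
qed

lemma match_naturality:
  assumes i: "i \<in> Obj I" and t: "t \<in> Arr FC"
  shows "match_map I deg E i (Tgt t) \<bullet> Cmp t i = match_arr I deg E i t \<bullet> match_map I deg E i (Src t)"
proof (rule lim_eqI[OF i functor_low[OF Tgt_functor[OF t]]])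
  fix u assume u: "low i u"
  then have u': "u \<in> Arr I" "Dom I u = i" by auto
  show "prj i (Tgt t) u \<bullet> (match_map I deg E i (Tgt t) \<bullet> Cmp t i) =
     prj i (Tgt t) u \<bullet> (match_arr I deg E i t \<bullet> match_map I deg E i (Src t))"
    using E.comp_extend[OF prj_match_map[OF i _ u]] E.comp_extend[OF prj_match_arr[OF i t u]]
      prj_match_map[OF i _ u] naturality[OF t u'(1)] i t u u' by simp
qed (use i t in simp_all)

text \<open>Limits commute with limits. An arrow into M_i of the pullback is a cone of arrows into
  its values below \<open>i\<close>, and each of these values is a pullback by
  \<open>Cmp_pullback\<close>.\<close>

lemma match_arr_pullback:
  assumes pb: "is_pullback FC f t p q" and i: "i \<in> Obj I"
  shows "is_pullback E (match_arr I deg E i f) (match_arr I deg E i t) (match_arr I deg E i p) (match_arr I deg E i q)"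
proof -
  note F = FC.is_pullbackD[OF pb]
  note F' = F[unfolded Dom_FC Cod_FC]
  let ?M = "match_arr I deg E i"
  have Cu: "Cod I u \<in> Obj I" if "low i u" for u using that by auto
  have comm: "Cmp f j \<bullet> Cmp p j = Cmp t j \<bullet> Cmp q j" if "j \<in> Obj I" for j
    using arg_cong[OF F(8), of "\<lambda>s. Cmp s j"] that by simp
  note pm = prj_match_arr[OF i]
  have pmx: "prj i (Tgt s) u \<bullet> (?M s \<bullet> y) = Cmp s (Cod I u) \<bullet> (prj i (Src s) u \<bullet> y)"
    if "s \<in> Arr FC" "low i u" "y \<in> Arr E" "Cod E y = Lim i (Src s)" for s u y
    using E.comp_extend[OF pm[OF that(1,2)]] that i Cu by simp
  show ?thesis
  proof (rule E.is_pullbackI)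
    show "?M f \<bullet> ?M p = ?M t \<bullet> ?M q"
    proof (rule lim_eqI[OF i, of "Tgt f"])
      fix u assume u: "low i u"
      show "prj i (Tgt f) u \<bullet> (?M f \<bullet> ?M p) = prj i (Tgt f) u \<bullet> (?M t \<bullet> ?M q)"
        using pmx[OF F(1) u, of "?M p"] pmx[OF F(2) u, of "?M q"] pm[OF F(3) u] pm[OF F(4) u] F F' u i
          E.comp_extend[OF comm[OF Cu[OF u]], of "prj i (Src p) u"] Cu[OF u] by simp
    qed (use F F' i in simp_all)
  next
    fix x y assume xy: "x \<in> Arr E" "y \<in> Arr E" "Dom E x = Dom E y" "Cod E x = Dom E (?M f)"
      "Cod E y = Dom E (?M t)" "?M f \<bullet> x = ?M t \<bullet> y"
    then have xy': "Cod E x = Lim i (Src f)" "Cod E y = Lim i (Src t)" using F i by simp_all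
    have eq: "Cmp f (Cod I u) \<bullet> (prj i (Src f) u \<bullet> x) = Cmp t (Cod I u) \<bullet> (prj i (Src t) u \<bullet> y)" if u: "low i u" for u
      using pmx[OF F(1) u xy(1) xy'(1)] pmx[OF F(2) u xy(2) xy'(2)] xy(6) F' by simp
    note pw = Cmp_pullback[OF pb Cu]
    have "\<exists>h. h \<in> Arr E \<and> Dom E h = Dom E y \<and> Cod E h = FObj (Src p) (Cod I u) \<and>
      Cmp p (Cod I u) \<bullet> h = prj i (Src f) u \<bullet> x \<and> Cmp q (Cod I u) \<bullet> h = prj i (Src t) u \<bullet> y" if u: "low i u" for u
      by (rule E.pullback_lift[OF pw[OF u], of "prj i (Src f) u \<bullet> x" "prj i (Src t) u \<bullet> y"])
        (use xy xy' eq[OF u] F F' u Cu[OF u] i in auto)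
    then obtain c where c: "c u \<in> Arr E" "Dom E (c u) = Dom E y" "Cod E (c u) = FObj (Src p) (Cod I u)"
      "Cmp p (Cod I u) \<bullet> c u = prj i (Src f) u \<bullet> x" "Cmp q (Cod I u) \<bullet> c u = prj i (Src t) u \<bullet> y"
      if "low i u" for u by metis
    \<comment> \<open>The arrows \<open>c u\<close> were induced separately. They are compatible
      because both sides of the cone equation land in the pullback at
      \<open>Cod I (k \<star> u)\<close> and agree under its two projections.\<close>
    have cone: "low_cone i (Src p) (Dom E y) c"
      unfolding low_cone_def
    proof (intro conjI allI impI)
      fix u k assume u: "low i u" "k \<in> Arr I" "Dom I k = Cod I u"
      note ku = low_comp[OF u]
      have Ck: "Cod I (k \<star> u) = Cod I k" using u by auto
      show "FArr (Src p) k \<bullet> c u = c (k \<star> u)"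
      proof (rule E.pullback_eqI[OF pw[OF ku]])
        show "Cmp p (Cod I (k \<star> u)) \<bullet> (FArr (Src p) k \<bullet> c u) = Cmp p (Cod I (k \<star> u)) \<bullet> c (k \<star> u)"
          unfolding c(4)[OF ku] unfolding Ck
          using naturality_extend[OF F(3) u(2), of "c u"] c[OF u(1)] u F F' i E.comp_extend[OF prj_comp[OF i _ u, of "Src f"], of x] xy xy' by simp
        show "Cmp q (Cod I (k \<star> u)) \<bullet> (FArr (Src p) k \<bullet> c u) = Cmp q (Cod I (k \<star> u)) \<bullet> c (k \<star> u)"
          unfolding c(5)[OF ku] unfolding Ck
          using naturality_extend[OF F(4) u(2), of "c u"] c[OF u(1)] u F F' i E.comp_extend[OF prj_comp[OF i _ u, of "Src t"], of y] xy xy' by simp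
      qed (use c[OF u(1)] c(1-3)[OF ku] u F F' Ck in simp_all)
    qed (use c xy in simp_all)
    note l = lift[OF i functor_low[OF Src_functor[OF F(3)]] cone]
    show "\<exists>h. h \<in> Arr E \<and> Dom E h = Dom E y \<and> Cod E h = Dom E (?M p) \<and> ?M p \<bullet> h = x \<and> ?M q \<bullet> h = y"
    proof (intro exI[of _ "lift i (Src p) (Dom E y) c"] conjI)
      show "?M p \<bullet> lift i (Src p) (Dom E y) c = x"
        by (rule lim_eqI[OF i, of "Src f"])
          (use l F F' i xy xy' c(4) pmx[OF F(3)] in simp_all)
      show "?M q \<bullet> lift i (Src p) (Dom E y) c = y"
        by (rule lim_eqI[OF i, of "Src t"])
          (use l F F' i xy xy' c(5) pmx[OF F(4)] in simp_all)
    qed (use l F F' i in simp_all)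
  next
    fix h h' assume h: "h \<in> Arr E" "h' \<in> Arr E" "Dom E h = Dom E h'" "Cod E h = Dom E (?M p)"
      "Cod E h' = Dom E (?M p)" and e: "?M p \<bullet> h = ?M p \<bullet> h'" "?M q \<bullet> h = ?M q \<bullet> h'"
    then have h': "Cod E h = Lim i (Src p)" "Cod E h' = Lim i (Src p)" using F i by simp_all
    show "h = h'"
    proof (rule lim_eqI[OF i, of "Src p"])
      fix u assume u: "low i u"
      show "prj i (Src p) u \<bullet> h = prj i (Src p) u \<bullet> h'"
      proof (rule E.pullback_eqI[OF Cmp_pullback[OF pb Cu[OF u]]])
        show "Cmp p (Cod I u) \<bullet> (prj i (Src p) u \<bullet> h) = Cmp p (Cod I u) \<bullet> (prj i (Src p) u \<bullet> h')"
          using pmx[OF F(3) u h(1) h'(1)] pmx[OF F(3) u h(2) h'(2)] e by simp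
        show "Cmp q (Cod I u) \<bullet> (prj i (Src p) u \<bullet> h) = Cmp q (Cod I u) \<bullet> (prj i (Src p) u \<bullet> h')"
          using pmx[OF F(4) u h(1)] pmx[OF F(4) u h(2)] h' e F' by simp
      qed (use u h h' F F' i Cu[OF u] in simp_all)
    qed (use h h' F F' i in simp_all)
  qed (use F F' i in simp_all)
qed

end

section \<open>Local dependent products\<close>

locale dep_prod = matching I E deg
  for I :: "('i, 'u) cat" and E :: "('o, 'a) cat" and deg :: "'i \<Rightarrow> nat" +
  fixes f g :: "('i, 'u, 'o, 'a) nat_trans"
  assumes f [simp]: "f \<in> Arr FC" and g [simp]: "g \<in> Arr FC" and Tgt_g [simp]: "Tgt g = Src f"
    and pow [simp]: "\<And>i. i \<in> Obj I \<Longrightarrow> powerful E (Cmp f i)"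
begin

abbreviation "A \<equiv> Tgt f"
abbreviation "B \<equiv> Src f"
abbreviation "C \<equiv> Src g"

text \<open>Sections over \<open>x : X \<rightarrow> Ai\<close> are the natural families of maps \<open>X \<times> Bj \<rightarrow> Cj\<close> over \<open>Bj\<close>,
  indexed by \<open>u : i \<rightarrow> j\<close>; a map out of the pullback \<open>X \<times> Bj\<close> is encoded by its natural action on
  generalised elements \<open>(t, b)\<close>, so that no canonical isomorphisms between pullbacks intervene.
  A local dependent product is a universal section: it has the universal property which
  \<open>(\<Pi>\<^sub>B C)i\<close> must have.\<close>

definition span :: "'i \<Rightarrow> 'a \<Rightarrow> 'u \<Rightarrow> 'a \<Rightarrow> 'a \<Rightarrow> bool" where
  "span i x u t b \<longleftrightarrow> u \<in> Arr I \<and> Dom I u = i \<and> t \<in> Arr E \<and> b \<in> Arr E \<and> Cod E t = Dom E x \<and>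
     Dom E b = Dom E t \<and> Cod E b = FObj B (Cod I u) \<and>
     FArr A u \<bullet> (x \<bullet> t) = Cmp f (Cod I u) \<bullet> b"

definition sec :: "'i \<Rightarrow> 'a \<Rightarrow> ('u \<Rightarrow> 'a \<Rightarrow> 'a \<Rightarrow> 'a) \<Rightarrow> bool" where
  "sec i x s \<longleftrightarrow> x \<in> Arr E \<and> Cod E x = FObj A i \<and>
     (\<forall>u t b. span i x u t b \<longrightarrow> s u t b \<in> Arr E \<and> Dom E (s u t b) = Dom E t \<and>
        Cod E (s u t b) = FObj C (Cod I u) \<and> Cmp g (Cod I u) \<bullet> s u t b = b \<and>
        (\<forall>r\<in>Arr E. Cod E r = Dom E t \<longrightarrow> s u (t \<bullet> r) (b \<bullet> r) = s u t b \<bullet> r) \<and>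
        (\<forall>v\<in>Arr I. Dom I v = Cod I u \<longrightarrow>
           FArr C v \<bullet> s u t b = s (v \<star> u) t (FArr B v \<bullet> b)))"

definition ldp :: "'i \<Rightarrow> 'a \<Rightarrow> ('u \<Rightarrow> 'a \<Rightarrow> 'a \<Rightarrow> 'a) \<Rightarrow> bool" where
  "ldp i p app \<longleftrightarrow> sec i p app \<and> (\<forall>x s. sec i x s \<longrightarrow>
     (\<exists>!h. h \<in> Arr E \<and> Dom E h = Dom E x \<and> Cod E h = Dom E p \<and> p \<bullet> h = x \<and>
        (\<forall>u t b. span i x u t b \<longrightarrow> app u (h \<bullet> t) b = s u t b)))"

lemma natural_f:
  assumes "u \<in> Arr I" "y \<in> Arr E" "Cod E y = FObj B (Dom I u)"
  shows "Cmp f (Cod I u) \<bullet> (FArr B u \<bullet> y) = FArr A u \<bullet> (Cmp f (Dom I u) \<bullet> y)"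
  using naturality_extend[OF f assms] by simp

lemma natural_g:
  assumes "u \<in> Arr I" "y \<in> Arr E" "Cod E y = FObj C (Dom I u)"
  shows "Cmp g (Cod I u) \<bullet> (FArr C u \<bullet> y) = FArr B u \<bullet> (Cmp g (Dom I u) \<bullet> y)"
  using naturality_extend[OF g assms] by simp

lemma functor_comp_extend:
  assumes "is_functor I E X" "u \<in> Arr I" "v \<in> Arr I" "Cod I u = Dom I v" "y \<in> Arr E" "Cod E y = FObj X (Dom I u)"
  shows "FArr X (v \<star> u) \<bullet> y = FArr X v \<bullet> (FArr X u \<bullet> y)"
  using assms by simp

lemma spanD:
  assumes "span i x u t b"
  shows "u \<in> Arr I" "Dom I u = i" "t \<in> Arr E" "b \<in> Arr E" "Cod E t = Dom E x" "Dom E b = Dom E t"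
    "Cod E b = FObj B (Cod I u)" "FArr A u \<bullet> (x \<bullet> t) = Cmp f (Cod I u) \<bullet> b"
  using assms by (simp_all add: span_def)

lemma secD:
  assumes "sec i x s"
  shows sec_arr: "x \<in> Arr E" and sec_cod: "Cod E x = FObj A i"
    and sec_val: "span i x u t b \<Longrightarrow> s u t b \<in> Arr E" "span i x u t b \<Longrightarrow> Dom E (s u t b) = Dom E t"
      "span i x u t b \<Longrightarrow> Cod E (s u t b) = FObj C (Cod I u)"
      "span i x u t b \<Longrightarrow> Cmp g (Cod I u) \<bullet> s u t b = b"
    and sec_stage: "span i x u t b \<Longrightarrow> r \<in> Arr E \<Longrightarrow> Cod E r = Dom E t \<Longrightarrow>
        s u (t \<bullet> r) (b \<bullet> r) = s u t b \<bullet> r"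
    and sec_natural: "span i x u t b \<Longrightarrow> v \<in> Arr I \<Longrightarrow> Dom I v = Cod I u \<Longrightarrow>
           FArr C v \<bullet> s u t b = s (v \<star> u) t (FArr B v \<bullet> b)"
  using assms unfolding sec_def by blast+

lemma secI:
  assumes "x \<in> Arr E" "Cod E x = FObj A i"
    "\<And>u t b. span i x u t b \<Longrightarrow> s u t b \<in> Arr E"
    "\<And>u t b. span i x u t b \<Longrightarrow> Dom E (s u t b) = Dom E t"
    "\<And>u t b. span i x u t b \<Longrightarrow> Cod E (s u t b) = FObj C (Cod I u)"
    "\<And>u t b. span i x u t b \<Longrightarrow> Cmp g (Cod I u) \<bullet> s u t b = b"
    "\<And>u t b r. span i x u t b \<Longrightarrow> r \<in> Arr E \<Longrightarrow> Cod E r = Dom E t \<Longrightarrow>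
        s u (t \<bullet> r) (b \<bullet> r) = s u t b \<bullet> r"
    "\<And>u t b v. span i x u t b \<Longrightarrow> v \<in> Arr I \<Longrightarrow> Dom I v = Cod I u \<Longrightarrow>
           FArr C v \<bullet> s u t b = s (v \<star> u) t (FArr B v \<bullet> b)"
  shows "sec i x s"
  unfolding sec_def using assms by blast

section \<open>Reindexing of spans and sections\<close>

lemma span_comp:
  assumes "x \<in> Arr E" "Cod E x = FObj A i" "h \<in> Arr E" "Cod E h = Dom E x"
  shows "span i (x \<bullet> h) u t b \<longleftrightarrow> t \<in> Arr E \<and> Cod E t = Dom E h \<and> span i x u (h \<bullet> t) b"
proof (cases "t \<in> Arr E \<and> Cod E t = Dom E h")
  case True
  then show ?thesis using assms by (auto simp: span_def)
next
  case False
  then show ?thesis using assms by (auto simp: span_def)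
qed

text \<open>The key reindexing: a span over the image of \<open>x\<close> along \<open>w\<close> is
  a span over \<open>x\<close> itself whose arrow factors through \<open>w\<close>. The action of
  arrows on sections rests on it.\<close>

lemma span_shift:
  assumes "x \<in> Arr E" "Cod E x = FObj A (Dom I w)" "w \<in> Arr I"
  shows "span (Cod I w) (FArr A w \<bullet> x) v t b \<longleftrightarrow>
     v \<in> Arr I \<and> Dom I v = Cod I w \<and> span (Dom I w) x (v \<star> w) t b"
proof (cases "v \<in> Arr I \<and> Dom I v = Cod I w \<and> t \<in> Arr E \<and> Cod E t = Dom E x")
  case True
  then show ?thesis using assms by (auto simp: span_def)
next
  case False
  then show ?thesis using assms by (auto simp: span_def)
qed

lemma span_natural:
  assumes "x \<in> Arr E" "Cod E x = FObj A i" "span i x u t b" "v \<in> Arr I" "Dom I v = Cod I u"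
  shows "span i x (v \<star> u) t (FArr B v \<bullet> b)"
  using assms spanD[OF assms(3)] natural_f[of v b] by (simp add: span_def)

lemma span_Id:
  assumes "x \<in> Arr E" "Cod E x = FObj A i" "i \<in> Obj I"
  shows "span i x (Id I i) t b \<longleftrightarrow> dspan E (Cmp f i) x t b"
proof (cases "t \<in> Arr E \<and> Cod E t = Dom E x")
  case True
  then show ?thesis using assms by (auto simp: span_def dspan_def)
next
  case False
  then show ?thesis using assms by (auto simp: span_def dspan_def)
qed

lemma span_dspan:
  assumes x: "x \<in> Arr E" "Cod E x = FObj A i" "i \<in> Obj I"
    and d: "dspan E (Cmp f i) x t b" and u: "u \<in> Arr I" "Dom I u = i"
  shows "span i x u t (FArr B u \<bullet> b)"
proof -
  have "span i x (Id I i) t b" using span_Id[OF x] d by simp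
  from span_natural[OF x(1,2) this u(1)] x u show ?thesis by simp
qed

lemma sec_comp:
  assumes s: "sec i x s" and h: "h \<in> Arr E" "Cod E h = Dom E x"
  shows "sec i (x \<bullet> h) (\<lambda>u t b. s u (h \<bullet> t) b)"
proof (rule secI)
  note S = secD[OF s] note x = S(1,2)
  note sp = span_comp[OF x h]
  show "x \<bullet> h \<in> Arr E" "Cod E (x \<bullet> h) = FObj A i" using x h by simp_all
  fix u t b assume "span i (x \<bullet> h) u t b"
  then have t: "t \<in> Arr E" "Cod E t = Dom E h" and s': "span i x u (h \<bullet> t) b"
    unfolding sp by auto
  show "s u (h \<bullet> t) b \<in> Arr E" "Dom E (s u (h \<bullet> t) b) = Dom E t"
    "Cod E (s u (h \<bullet> t) b) = FObj C (Cod I u)" "Cmp g (Cod I u) \<bullet> s u (h \<bullet> t) b = b"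
    using S(3-6)[OF s'] h t by simp_all
  show "FArr C v \<bullet> s u (h \<bullet> t) b = s (v \<star> u) (h \<bullet> t) (FArr B v \<bullet> b)"
    if "v \<in> Arr I" "Dom I v = Cod I u" for v
    using sec_natural[OF s s' that] .
  show "s u (h \<bullet> (t \<bullet> r)) (b \<bullet> r) = s u (h \<bullet> t) b \<bullet> r"
    if "r \<in> Arr E" "Cod E r = Dom E t" for r
    using sec_stage[OF s s', of r] that t h by simp
qed

text \<open>This is the action of \<open>w\<close> on the functor of sections. Applied to the
  universal section at \<open>Dom I w\<close>, it gives the section that the transition map along
  \<open>w\<close> represents.\<close>

lemma sec_shift:
  assumes s: "sec (Dom I w) x s" and w: "w \<in> Arr I"
  shows "sec (Cod I w) (FArr A w \<bullet> x) (\<lambda>v t b. s (v \<star> w) t b)"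
proof (rule secI)
  note S = secD[OF s] note x = S(1,2)
  note sp = span_shift[OF x w]
  show "FArr A w \<bullet> x \<in> Arr E" "Cod E (FArr A w \<bullet> x) = FObj A (Cod I w)" using x w by simp_all
  fix u t b assume "span (Cod I w) (FArr A w \<bullet> x) u t b"
  then have u: "u \<in> Arr I" "Dom I u = Cod I w" and s': "span (Dom I w) x (u \<star> w) t b"
    unfolding sp by auto
  show "s (u \<star> w) t b \<in> Arr E" "Dom E (s (u \<star> w) t b) = Dom E t"
    "Cod E (s (u \<star> w) t b) = FObj C (Cod I u)" "Cmp g (Cod I u) \<bullet> s (u \<star> w) t b = b"
    using S(3-6)[OF s'] u w by simp_all
  show "FArr C v \<bullet> s (u \<star> w) t b = s (v \<star> u \<star> w) t (FArr B v \<bullet> b)"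
    if "v \<in> Arr I" "Dom I v = Cod I u" for v
    using sec_natural[OF s s', of v] that u w by simp
  show "s (u \<star> w) (t \<bullet> r) (b \<bullet> r) = s (u \<star> w) t b \<bullet> r"
    if "r \<in> Arr E" "Cod E r = Dom E t" for r
    using sec_stage[OF s s', of r] that by simp
qed

section \<open>The universal property of a local dependent product\<close>

lemma ldp_sec: "ldp i p app \<Longrightarrow> sec i p app"
  by (simp add: ldp_def)

lemma ldp_lift:
  assumes "ldp i p app" "sec i x s"
  obtains h where "h \<in> Arr E" "Dom E h = Dom E x" "Cod E h = Dom E p" "p \<bullet> h = x"
    "\<And>u t b. span i x u t b \<Longrightarrow> app u (h \<bullet> t) b = s u t b"
  using assms unfolding ldp_def by blast

text \<open>Both arrows induce the same section over the same structure map, and universality leaves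
  room for only one arrow inducing it.\<close>

lemma ldp_eqI:
  assumes p: "ldp i p app" and h: "h \<in> Arr E" "h' \<in> Arr E" "Dom E h = Dom E h'"
    "Cod E h = Dom E p" "Cod E h' = Dom E p" "p \<bullet> h = p \<bullet> h'"
    and eq: "\<And>u t b. span i (p \<bullet> h) u t b \<Longrightarrow> app u (h \<bullet> t) b = app u (h' \<bullet> t) b"
  shows "h = h'"
proof -
  note s = ldp_sec[OF p]
  have "sec i (p \<bullet> h) (\<lambda>u t b. app u (h \<bullet> t) b)" by (rule sec_comp[OF s h(1,4)])
  then have ex1: "\<exists>!k. k \<in> Arr E \<and> Dom E k = Dom E (p \<bullet> h) \<and> Cod E k = Dom E p \<and> p \<bullet> k = p \<bullet> h \<and>
        (\<forall>u t b. span i (p \<bullet> h) u t b \<longrightarrow> app u (k \<bullet> t) b = app u (h \<bullet> t) b)"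
    using p unfolding ldp_def by blast
  have d: "Dom E (p \<bullet> h) = Dom E h" using sec_arr[OF s] h by simp
  show ?thesis
    by (rule ex1E[OF ex1]) (metis d h eq)
qed

lemma ldpI:
  assumes s: "sec i p app"
    and ex: "\<And>x s. sec i x s \<Longrightarrow> \<exists>h. h \<in> Arr E \<and> Dom E h = Dom E x \<and> Cod E h = Dom E p \<and> p \<bullet> h = x \<and>
        (\<forall>u t b. span i x u t b \<longrightarrow> app u (h \<bullet> t) b = s u t b)"
    and uni: "\<And>h h'. h \<in> Arr E \<Longrightarrow> h' \<in> Arr E \<Longrightarrow> Dom E h = Dom E h' \<Longrightarrow> Cod E h = Dom E p \<Longrightarrow>
      Cod E h' = Dom E p \<Longrightarrow> p \<bullet> h = p \<bullet> h' \<Longrightarrow>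
      (\<And>u t b. span i (p \<bullet> h) u t b \<Longrightarrow> app u (h \<bullet> t) b = app u (h' \<bullet> t) b) \<Longrightarrow> h = h'"
  shows "ldp i p app"
  unfolding ldp_def
proof (intro conjI allI impI s)
  fix x s assume x: "sec i x s"
  obtain h where h: "h \<in> Arr E" "Dom E h = Dom E x" "Cod E h = Dom E p" "p \<bullet> h = x"
    "\<forall>u t b. span i x u t b \<longrightarrow> app u (h \<bullet> t) b = s u t b" using ex[OF x] by blast
  show "\<exists>!h. h \<in> Arr E \<and> Dom E h = Dom E x \<and> Cod E h = Dom E p \<and> p \<bullet> h = x \<and>
        (\<forall>u t b. span i x u t b \<longrightarrow> app u (h \<bullet> t) b = s u t b)"
    by (rule ex1I[of _ h]) (use h in \<open>auto intro: uni\<close>)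
qed

lemma ldp_iso:
  assumes p: "ldp i p app" and p': "ldp i p' app'"
  obtains h h' where "are_inverse E h h'" "Dom E h = Dom E p'" "Cod E h = Dom E p" "p \<bullet> h = p'"
    "\<And>u t b. span i p' u t b \<Longrightarrow> app u (h \<bullet> t) b = app' u t b"
proof -
  note s = ldp_sec[OF p] and s' = ldp_sec[OF p']
  note x = sec_arr[OF s] sec_cod[OF s] and x' = sec_arr[OF s'] sec_cod[OF s']
  obtain h where h: "h \<in> Arr E" "Dom E h = Dom E p'" "Cod E h = Dom E p" "p \<bullet> h = p'"
    and ah: "\<And>u t b. span i p' u t b \<Longrightarrow> app u (h \<bullet> t) b = app' u t b"
    using ldp_lift[OF p s'] by blast
  obtain h' where h': "h' \<in> Arr E" "Dom E h' = Dom E p" "Cod E h' = Dom E p'" "p' \<bullet> h' = p"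
    and ah': "\<And>u t b. span i p u t b \<Longrightarrow> app' u (h' \<bullet> t) b = app u t b"
    using ldp_lift[OF p' s] by blast
  have pid: "p \<bullet> Id E (Dom E p) = p" "p' \<bullet> Id E (Dom E p') = p'" using x x' by simp_all
  have "h' \<bullet> h = Id E (Dom E p')"
  proof (rule ldp_eqI[OF p'])
    show 1: "p' \<bullet> (h' \<bullet> h) = p' \<bullet> Id E (Dom E p')"
      using E.comp_extend[OF h'(4)] h h' x x' by simp
    fix u t b assume "span i (p' \<bullet> (h' \<bullet> h)) u t b"
    then have sp: "span i p' u t b" unfolding 1 pid .
    then have t: "t \<in> Arr E" "Cod E t = Dom E p'" by (auto dest: spanD)
    have "span i p u (h \<bullet> t) b" using sp span_comp[OF x h(1,3)] h(4) by simp
    from ah'[OF this] ah[OF sp] show "app' u (h' \<bullet> h \<bullet> t) b = app' u (Id E (Dom E p') \<bullet> t) b"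
      using t h h' by simp
  qed (use h h' x x' in simp_all)
  moreover have "h \<bullet> h' = Id E (Dom E p)"
  proof (rule ldp_eqI[OF p])
    show 1: "p \<bullet> (h \<bullet> h') = p \<bullet> Id E (Dom E p)"
      using E.comp_extend[OF h(4)] h h' x x' by simp
    fix u t b assume "span i (p \<bullet> (h \<bullet> h')) u t b"
    then have sp: "span i p u t b" unfolding 1 pid .
    then have t: "t \<in> Arr E" "Cod E t = Dom E p" by (auto dest: spanD)
    have "span i p' u (h' \<bullet> t) b" using sp span_comp[OF x' h'(1,3)] h'(4) by simp
    from ah[OF this] ah'[OF sp] show "app u (h \<bullet> h' \<bullet> t) b = app u (Id E (Dom E p) \<bullet> t) b"
      using t h h' by simp
  qed (use h h' x x' in simp_all)
  ultimately have "are_inverse E h h'" using h h' by (simp add: are_inverse_def hom_def)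
  then show ?thesis using that h ah by blast
qed

text \<open>\<open>h : P\<^sub>i \<rightarrow> P\<^sub>j\<close> is the map between local dependent products induced by \<open>u : i \<rightarrow> j\<close>.\<close>

definition transition :: "('i \<Rightarrow> 'a) \<Rightarrow> ('i \<Rightarrow> 'u \<Rightarrow> 'a \<Rightarrow> 'a \<Rightarrow> 'a) \<Rightarrow> 'u \<Rightarrow> 'a \<Rightarrow> bool" where
  "transition p app u h \<longleftrightarrow> h \<in> Arr E \<and> Dom E h = Dom E (p (Dom I u)) \<and> Cod E h = Dom E (p (Cod I u)) \<and>
     p (Cod I u) \<bullet> h = FArr A u \<bullet> p (Dom I u) \<and>
     (\<forall>v y b. v \<in> Arr I \<longrightarrow> Dom I v = Cod I u \<longrightarrow> span (Dom I u) (p (Dom I u)) (v \<star> u) y b \<longrightarrow>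
        app (Cod I u) v (h \<bullet> y) b = app (Dom I u) (v \<star> u) y b)"

lemma transitionD:
  assumes "transition p app u h"
  shows "h \<in> Arr E" "Dom E h = Dom E (p (Dom I u))" "Cod E h = Dom E (p (Cod I u))"
    "p (Cod I u) \<bullet> h = FArr A u \<bullet> p (Dom I u)"
    "v \<in> Arr I \<Longrightarrow> Dom I v = Cod I u \<Longrightarrow> span (Dom I u) (p (Dom I u)) (v \<star> u) y b \<Longrightarrow>
        app (Cod I u) v (h \<bullet> y) b = app (Dom I u) (v \<star> u) y b"
  using assms unfolding transition_def by blast+

lemma transition_ex:
  assumes u: "u \<in> Arr I" and "ldp (Dom I u) (p (Dom I u)) (app (Dom I u))" "ldp (Cod I u) (p (Cod I u)) (app (Cod I u))"
  shows "\<exists>h. transition p app u h"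
proof -
  note s = ldp_sec[OF assms(2)] note x = sec_arr[OF s] sec_cod[OF s]
  from ldp_lift[OF assms(3) sec_shift[OF s u]] obtain h where h: "h \<in> Arr E"
    "Dom E h = Dom E (FArr A u \<bullet> p (Dom I u))" "Cod E h = Dom E (p (Cod I u))" 
    "p (Cod I u) \<bullet> h = FArr A u \<bullet> p (Dom I u)"
    "\<And>v t b. span (Cod I u) (FArr A u \<bullet> p (Dom I u)) v t b \<Longrightarrow>
      app (Cod I u) v (h \<bullet> t) b = app (Dom I u) (v \<star> u) t b" by blast
  have "transition p app u h"
    unfolding transition_def using h u x span_shift[OF x u] by simp
  then show ?thesis ..
qed

text \<open>Uniqueness is what turns transition maps into a functor: identities and composites are
  transition maps, hence equal to the ones that were chosen.\<close>

lemma transition_unique: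
  assumes u: "u \<in> Arr I" and d: "sec (Dom I u) (p (Dom I u)) (app (Dom I u))" 
    and c: "ldp (Cod I u) (p (Cod I u)) (app (Cod I u))"
    and h: "transition p app u h" and h': "transition p app u h'"
  shows "h = h'"
proof -
  note x = sec_arr[OF d] sec_cod[OF d]
  note H = transitionD[OF h] and H' = transitionD[OF h']
  show ?thesis
  proof (rule ldp_eqI[OF c])
    fix v t b assume "span (Cod I u) (p (Cod I u) \<bullet> h) v t b"
    then have "v \<in> Arr I" "Dom I v = Cod I u" "span (Dom I u) (p (Dom I u)) (v \<star> u) t b"
      unfolding H(4) span_shift[OF x u] by auto
    then show "app (Cod I u) v (h \<bullet> t) b = app (Cod I u) v (h' \<bullet> t) b"
      using H(5) H'(5) by simp
  qed (use H H' in simp_all)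
qed

lemma transition_Id:
  assumes i: "i \<in> Obj I" and s: "sec i (p i) (app i)"
  shows "transition p app (Id I i) (Id E (Dom E (p i)))"
proof -
  note x = sec_arr[OF s] sec_cod[OF s]
  show ?thesis
    unfolding transition_def
  proof (intro conjI allI impI)
    fix v y b assume v: "v \<in> Arr I" "Dom I v = Cod I (Id I i)"
      "span (Dom I (Id I i)) (p (Dom I (Id I i))) (v \<star> Id I i) y b"
    then show "app (Cod I (Id I i)) v (Id E (Dom E (p i)) \<bullet> y) b = app (Dom I (Id I i)) (v \<star> Id I i) y b"
      using spanD[OF v(3)] i by simp
  qed (use i x in simp_all)
qed

lemma transition_comp:
  assumes uv: "u \<in> Arr I" "v \<in> Arr I" "Cod I u = Dom I v"
    and d: "sec (Dom I u) (p (Dom I u)) (app (Dom I u))"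
    and c: "sec (Cod I u) (p (Cod I u)) (app (Cod I u))"
    and e: "sec (Cod I v) (p (Cod I v)) (app (Cod I v))"
    and h: "transition p app u h" and k: "transition p app v k"
  shows "transition p app (v \<star> u) (k \<bullet> h)"
proof -
  note x = sec_arr[OF d] sec_cod[OF d] and y = sec_arr[OF c] sec_cod[OF c] and z = sec_arr[OF e] sec_cod[OF e]
  note H = transitionD[OF h] and K = transitionD[OF k]
  have app: "app (Cod I v) w (k \<bullet> h \<bullet> t) b = app (Dom I u) (w \<star> v \<star> u) t b"
    if w: "w \<in> Arr I" "Dom I w = Cod I v" and s: "span (Dom I u) (p (Dom I u)) (w \<star> v \<star> u) t b" for w t b
  proof -
    have t: "t \<in> Arr E" "Cod E t = Dom E (p (Dom I u))" using spanD[OF s] by auto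
    have s': "span (Dom I u) (p (Dom I u)) ((w \<star> v) \<star> u) t b" using s w uv by simp
    then have "span (Cod I u) (FArr A u \<bullet> p (Dom I u)) (w \<star> v) t b"
      using span_shift[OF x uv(1)] w uv by simp
    then have "span (Cod I u) (p (Cod I u)) (w \<star> v) (h \<bullet> t) b"
      unfolding H(4)[symmetric] using span_comp[OF y H(1,3)] by simp
    then have "app (Cod I v) w (k \<bullet> (h \<bullet> t)) b = app (Cod I u) (w \<star> v) (h \<bullet> t) b"
      using K(5)[OF w] uv by simp
    also have "\<dots> = app (Dom I u) ((w \<star> v) \<star> u) t b"
      using H(5)[OF _ _ s'] w uv by simp
    finally show ?thesis using t H K uv w by simp
  qed
  show ?thesis
    unfolding transition_def
    using uv x y z H(1-4) K(1-4) app E.comp_extend[OF K(4)] by simp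
qed

end

text \<open>The inductive step at \<open>i\<close>, with the diagram below \<open>i\<close> kept
  abstract: \<open>X\<close> consists of the domains of the universal sections \<open>p j\<close>
  and of the transition maps. It is instantiated first with chosen universal sections, to obtain one
  at \<open>i\<close>, and later with the dependent product in the functor category, to recognise
  its value at \<open>i\<close>.\<close>

locale dep_prod_step = dep_prod I E deg f g
  for I :: "('i, 'u) cat" and E :: "('o, 'a) cat" and deg :: "'i \<Rightarrow> nat"
    and f g :: "('i, 'u, 'o, 'a) nat_trans" +
  fixes i :: 'i and X :: "('i, 'u, 'o, 'a) funct" and p :: "'i \<Rightarrow> 'a" and app :: "'i \<Rightarrow> 'u \<Rightarrow> 'a \<Rightarrow> 'a \<Rightarrow> 'a"
  assumes i [simp]: "i \<in> Obj I"
    and X [simp]: "low_functor i X"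
    and ldp: "\<And>j. j \<in> Obj I \<Longrightarrow> deg j < deg i \<Longrightarrow> ldp j (p j) (app j)"
    and Dom_p: "\<And>j. j \<in> Obj I \<Longrightarrow> deg j < deg i \<Longrightarrow> Dom E (p j) = FObj X j"
    and trans: "\<And>u. u \<in> Arr I \<Longrightarrow> deg (Dom I u) < deg i \<Longrightarrow> transition p app u (FArr X u)"
begin

lemma low_Cod [simp]: "low i u \<Longrightarrow> Cod I u \<in> Obj I"
  by auto

lemma p_arr [simp]: "low i u \<Longrightarrow> p (Cod I u) \<in> Arr E"
  and Dom_p_low [simp]: "low i u \<Longrightarrow> Dom E (p (Cod I u)) = FObj X (Cod I u)"
  and Cod_p_low [simp]: "low i u \<Longrightarrow> Cod E (p (Cod I u)) = FObj A (Cod I u)"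
  using sec_arr[OF ldp_sec[OF ldp]] sec_cod[OF ldp_sec[OF ldp]] Dom_p by (auto simp: low_def)

lemma ldp_low: "low i u \<Longrightarrow> ldp (Cod I u) (p (Cod I u)) (app (Cod I u))"
  by (rule ldp) auto

lemma X_arr:
  assumes "low i u" "v \<in> Arr I" "Dom I v = Cod I u"
  shows "FArr X v \<in> Arr E" "Dom E (FArr X v) = FObj X (Cod I u)" "Cod E (FArr X v) = FObj X (Cod I v)"
    "p (Cod I v) \<bullet> FArr X v = FArr A v \<bullet> p (Cod I u)"
    "w \<in> Arr I \<Longrightarrow> Dom I w = Cod I v \<Longrightarrow> span (Cod I u) (p (Cod I u)) (w \<star> v) y b \<Longrightarrow>
        app (Cod I v) w (FArr X v \<bullet> y) b = app (Cod I u) (w \<star> v) y b"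
proof -
  have d: "deg (Dom I v) < deg i" using assms by (auto simp: low_def)
  note t = transitionD[OF trans[OF assms(2) d]]
  show "FArr X v \<in> Arr E" "Dom E (FArr X v) = FObj X (Cod I u)" "Cod E (FArr X v) = FObj X (Cod I v)"
    using X assms d unfolding low_functor_def by auto
  show "p (Cod I v) \<bullet> FArr X v = FArr A v \<bullet> p (Cod I u)"
    "w \<in> Arr I \<Longrightarrow> Dom I w = Cod I v \<Longrightarrow> span (Cod I u) (p (Cod I u)) (w \<star> v) y b \<Longrightarrow>
        app (Cod I v) w (FArr X v \<bullet> y) b = app (Cod I u) (w \<star> v) y b"
    using t(4) t(5)[of w y b] assms(3) by simp_all
qed

text \<open>Here \<open>X\<close> is the diagram of the local dependent products at the objects below \<open>i\<close>, and \<open>q1\<close>, \<open>q2\<close>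
  are the projections of \<open>Ai \<times> L\<close> over \<open>M\<^sub>i A\<close>. In the notation of the paper, \<open>r\<close> and \<open>rho\<close> are the
  projections of \<open>Bi \<times> M\<^sub>i C\<close> to \<open>Bi\<close> and to the \<open>Cj\<close>, while \<open>V\<close> and \<open>W\<close> are the structure maps to
  \<open>Ai\<close> of the dependent products of \<open>Ci\<close> and of \<open>Bi \<times> M\<^sub>i C\<close> along \<open>f\<^sub>i\<close>.\<close>

definition "L = Lim i X"
definition "pr = prj i X"
definition "l = lift i A L (\<lambda>u. p (Cod I u) \<bullet> pr u)"
abbreviation "mA \<equiv> match_map I deg E i A"
abbreviation "mB \<equiv> match_map I deg E i B"
abbreviation "fi \<equiv> Cmp f i"
abbreviation "Mg \<equiv> match_arr I deg E i g"
definition "q1 = pb1 E mA l"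
definition "q2 = pb2 E mA l"
definition "r = pb1 E mB Mg"
definition "rho u = prj i C u \<bullet> pb2 E mB Mg"
definition "V = FObj (dprod E fi) (Cmp g i)"
definition "W = FObj (dprod E fi) r"
abbreviation "appV \<equiv> dapp E fi (Cmp g i)"
abbreviation "appW \<equiv> dapp E fi r"

lemma pr_simps [simp]: "low i u \<Longrightarrow> pr u \<in> Arr E" "low i u \<Longrightarrow> Dom E (pr u) = L"
  "low i u \<Longrightarrow> Cod E (pr u) = FObj X (Cod I u)"
  by (simp_all add: pr_def L_def)

lemma pr_comp: "low i u \<Longrightarrow> v \<in> Arr I \<Longrightarrow> Dom I v = Cod I u \<Longrightarrow> FArr X v \<bullet> pr u = pr (v \<star> u)"
  unfolding pr_def by (rule prj_comp) simp_all

text \<open>The structure maps commute with the transition maps, so they induce \<open>l\<close>.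
  When \<open>X\<close> is the dependent product itself, \<open>l\<close> is M_i of its structure
  map.\<close>

lemma l_cone: "low_cone i A L (\<lambda>u. p (Cod I u) \<bullet> pr u)"
  unfolding low_cone_def
proof (intro conjI allI impI)
  fix u h assume u: "low i u" "h \<in> Arr I" "Dom I h = Cod I u"
  note hu = low_comp[OF u]
  have Ch: "Cod I (h \<star> u) = Cod I h" using u by auto
  note x = X_arr[OF u]
  have "FArr A h \<bullet> (p (Cod I u) \<bullet> pr u) = p (Cod I h) \<bullet> (FArr X h \<bullet> pr u)"
    using E.comp_extend[OF x(4), of "pr u"] u hu x(1-3) p_arr[OF hu] Dom_p_low[OF hu] unfolding Ch by simp
  then show "FArr A h \<bullet> (p (Cod I u) \<bullet> pr u) = p (Cod I (h \<star> u)) \<bullet> pr (h \<star> u)"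
    unfolding pr_comp[OF u] Ch .
qed (simp_all add: L_def)

lemma l_simps [simp]: "l \<in> Arr E" "Dom E l = L" "Cod E l = Lim i A"
  unfolding l_def using lift[OF i functor_low[OF Tgt_functor[OF f]] l_cone] by simp_all

lemma prj_l: "low i u \<Longrightarrow> prj i A u \<bullet> l = p (Cod I u) \<bullet> pr u"
  unfolding l_def using lift[OF i functor_low[OF Tgt_functor[OF f]] l_cone] by simp

lemma q_simps [simp]: "q1 \<in> Arr E" "q2 \<in> Arr E" "Cod E q1 = FObj A i" "Cod E q2 = L" "Dom E q2 = Dom E q1"
  by (simp_all add: q1_def q2_def)

lemma q_comm: "mA \<bullet> q1 = l \<bullet> q2"
  unfolding q1_def q2_def by (rule E.pb_comm) simp_all

lemma r_simps [simp]: "r \<in> Arr E" "Cod E r = FObj B i" "low i u \<Longrightarrow> rho u \<in> Arr E" "low i u \<Longrightarrow> Dom E (rho u) = Dom E r"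
   "low i u \<Longrightarrow> Cod E (rho u) = FObj C (Cod I u)"
  by (simp_all add: r_def rho_def)

text \<open>The single equation \<open>mA \<bullet> q1 = l \<bullet> q2\<close> between maps into
  M_i A, read off at the projection indexed by \<open>u\<close>: the component at \<open>u\<close>
  of an element of Ai x L lies over the image of its component in Ai.\<close>

lemma p_pr:
  assumes u: "low i u" and z: "z \<in> Arr E" "Cod E z = Dom E q1"
  shows "p (Cod I u) \<bullet> (pr u \<bullet> (q2 \<bullet> z)) = FArr A u \<bullet> (q1 \<bullet> z)"
proof -
  have u': "u \<in> Arr I" "Dom I u = i" using u by auto
  have "FArr A u \<bullet> (q1 \<bullet> z) = prj i A u \<bullet> (mA \<bullet> (q1 \<bullet> z))"
    using E.comp_extend[OF prj_match_map[OF i Tgt_functor[OF f] u], of "q1 \<bullet> z"] u z by simp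
  also have "\<dots> = prj i A u \<bullet> (l \<bullet> (q2 \<bullet> z))"
    using E.comp_extend[OF q_comm, of z] u z by simp
  also have "\<dots> = p (Cod I u) \<bullet> (pr u \<bullet> (q2 \<bullet> z))"
    using E.comp_extend[OF prj_l[OF u], of "q2 \<bullet> z"] u z by simp
  finally show ?thesis ..
qed

text \<open>Together with \<open>r_lift\<close> this presents Bi x M_i C, a pullback involving a
  limit, as one limit with projections \<open>r\<close> and \<open>rho u\<close>, so that its
  elements can be handled through these alone.\<close>

lemma r_eqI:
  assumes "c \<in> Arr E" "c' \<in> Arr E" "Dom E c = Dom E c'" "Cod E c = Dom E r" "Cod E c' = Dom E r" "r \<bullet> c = r \<bullet> c'"
    "\<And>u. low i u \<Longrightarrow> rho u \<bullet> c = rho u \<bullet> c'"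
  shows "c = c'"
proof (rule E.pb_eqI[of mB Mg])
  have [simp]: "Dom E (pb1 E mB Mg) = Dom E r" unfolding r_def by simp
  show "pb2 E mB Mg \<bullet> c = pb2 E mB Mg \<bullet> c'"
  proof (rule lim_eqI[OF i, of C])
    fix u assume u: "low i u"
    show "prj i C u \<bullet> (pb2 E mB Mg \<bullet> c) = prj i C u \<bullet> (pb2 E mB Mg \<bullet> c')"
      using assms(7)[OF u] u assms(1-5) by (simp add: rho_def)
  qed (use assms in simp_all)
qed (use assms in \<open>simp_all add: r_def\<close>)

lemma r_lift:
  assumes b: "b \<in> Arr E" "Cod E b = FObj B i"
    and c: "\<And>u. low i u \<Longrightarrow> c u \<in> Arr E \<and> Dom E (c u) = Dom E b \<and> Cod E (c u) = FObj C (Cod I u)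
      \<and> Cmp g (Cod I u) \<bullet> c u = FArr B u \<bullet> b"
    and nat: "\<And>u h. low i u \<Longrightarrow> h \<in> Arr I \<Longrightarrow> Dom I h = Cod I u \<Longrightarrow> FArr C h \<bullet> c u = c (h \<star> u)"
  shows "pb_pair E mB Mg b (lift i C (Dom E b) c) \<in> Arr E" (is "?k \<in> _")
    "Dom E (pb_pair E mB Mg b (lift i C (Dom E b) c)) = Dom E b"
    "Cod E (pb_pair E mB Mg b (lift i C (Dom E b) c)) = Dom E r"
    "r \<bullet> pb_pair E mB Mg b (lift i C (Dom E b) c) = b"
    "low i u \<Longrightarrow> rho u \<bullet> pb_pair E mB Mg b (lift i C (Dom E b) c) = c u"
proof -
  have "low_cone i C (Dom E b) c" using b c nat by (simp add: low_cone_def)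
  note k = lift[OF i functor_low[OF Src_functor[OF g]] this]
  have eq: "mB \<bullet> b = Mg \<bullet> lift i C (Dom E b) c"
  proof (rule lim_eqI[OF i, of B])
    fix u assume u: "low i u"
    show "prj i B u \<bullet> (mB \<bullet> b) = prj i B u \<bullet> (Mg \<bullet> lift i C (Dom E b) c)"
      using E.comp_extend[OF prj_match_map[OF i Src_functor[OF f] u], of b]
        E.comp_extend[OF prj_match_arr[OF i g u], of "lift i C (Dom E b) c"] k c[OF u] u b by simp
  qed (use b k in simp_all)
  note pp = E.pb_pair[of mB Mg, OF _ _ _ _ _ _ _ _ eq]
  show 1: "?k \<in> Arr E" "Dom E ?k = Dom E b" "Cod E ?k = Dom E r" "r \<bullet> ?k = b"
    using pp k b by (simp_all add: r_def)
  show "rho u \<bullet> ?k = c u" if "low i u"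
    using that pp k b 1 unfolding rho_def by (simp add: r_def)
qed

lemma q_eqI:
  assumes "c \<in> Arr E" "c' \<in> Arr E" "Dom E c = Dom E c'" "Cod E c = Dom E q1" "Cod E c' = Dom E q1" "q1 \<bullet> c = q1 \<bullet> c'"
    "\<And>u. low i u \<Longrightarrow> pr u \<bullet> (q2 \<bullet> c) = pr u \<bullet> (q2 \<bullet> c')"
  shows "c = c'"
proof (rule E.pb_eqI[of mA l])
  have [simp]: "Dom E (pb1 E mA l) = Dom E q1" unfolding q1_def by simp
  show "pb2 E mA l \<bullet> c = pb2 E mA l \<bullet> c'"
    unfolding q2_def[symmetric]
    by (rule lim_eqI[OF i, of X]) (use assms in \<open>simp_all add: L_def pr_def\<close>)
qed (use assms in \<open>simp_all add: q1_def\<close>)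

text \<open>The two maps into \<open>Dom W\<close> whose pullback is to be the local dependent product at \<open>i\<close>,
  characterised by their values on generalised elements.\<close>

definition is_w1 :: "'a \<Rightarrow> bool" where
  "is_w1 w \<longleftrightarrow> w \<in> Arr E \<and> Dom E w = Dom E V \<and> Cod E w = Dom E W \<and> W \<bullet> w = V \<and>
     (\<forall>y b u. dspan E fi V y b \<longrightarrow> low i u \<longrightarrow> rho u \<bullet> appW (w \<bullet> y) b = FArr C u \<bullet> appV y b)"

definition is_w2 :: "'a \<Rightarrow> bool" where
  "is_w2 w \<longleftrightarrow> w \<in> Arr E \<and> Dom E w = Dom E q1 \<and> Cod E w = Dom E W \<and> W \<bullet> w = q1 \<and>
     (\<forall>y b u. dspan E fi q1 y b \<longrightarrow> low i u \<longrightarrow> rho u \<bullet> appW (w \<bullet> y) b =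
        app (Cod I u) (Id I (Cod I u)) (pr u \<bullet> (q2 \<bullet> y)) (FArr B u \<bullet> b))"

lemma V_simps [simp]: "V \<in> Arr E" "Cod E V = FObj A i"
  and W_simps [simp]: "W \<in> Arr E" "Cod E W = FObj A i"
  unfolding V_def W_def by simp_all

lemmas appV = E.dapp[OF pow[OF i], of "Cmp g i", folded V_def, simplified]
lemmas appW = E.dapp[OF pow[OF i] r_simps(1), folded W_def, simplified]

section \<open>Restricting elements of Ai x L to the objects below \<open>i\<close>\<close>

lemma span_low:
  assumes u: "low i u" and z: "z \<in> Arr E" "Cod E z = Dom E q1" and t: "t \<in> Arr E" "Cod E t = Dom E z"
    and v: "v \<in> Arr I" "Dom I v = Cod I u"
  shows "span (Cod I u) (p (Cod I u)) v (pr u \<bullet> (q2 \<bullet> (z \<bullet> t))) b \<longleftrightarrow> span i (q1 \<bullet> z) (v \<star> u) t b"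
  using u z t v lowD[OF u] p_pr[OF u, of "z \<bullet> t"] by (auto simp: span_def)

text \<open>Moving the element along \<open>X v\<close> turns the index \<open>v\<close> at
  \<open>Cod I u\<close> into the identity at \<open>Cod I v\<close>. Hence the sections below
  \<open>i\<close> are determined by their values at identities, which is why \<open>glue\<close>
  and \<open>is_w2\<close> mention no others.\<close>

lemma app_shift:
  assumes u: "low i u" and z: "z \<in> Arr E" "Cod E z = Dom E q1" and t: "t \<in> Arr E" "Cod E t = Dom E z"
    and v: "v \<in> Arr I" "Dom I v = Cod I u" and s: "span i (q1 \<bullet> z) (v \<star> u) t b"
  shows "app (Cod I u) v (pr u \<bullet> (q2 \<bullet> (z \<bullet> t))) b =
    app (Cod I v) (Id I (Cod I v)) (pr (v \<star> u) \<bullet> (q2 \<bullet> (z \<bullet> t))) b"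
proof -
  have "span (Cod I u) (p (Cod I u)) (Id I (Cod I v) \<star> v) (pr u \<bullet> (q2 \<bullet> (z \<bullet> t))) b"
    using span_low[OF u z t v] s v by simp
  from X_arr(5)[OF u v _ _ this]
  have "app (Cod I v) (Id I (Cod I v)) (FArr X v \<bullet> (pr u \<bullet> (q2 \<bullet> (z \<bullet> t)))) b =
     app (Cod I u) v (pr u \<bullet> (q2 \<bullet> (z \<bullet> t))) b"
    using v by simp
  then show ?thesis
    using E.comp_extend[OF pr_comp[OF u v], of "q2 \<bullet> (z \<bullet> t)"] u z t X_arr[OF u v] by simp
qed

text \<open>An equation between elements of the domain of \<open>W\<close> unpacks into values in Bi
  x M_i C, and these into their projections. The \<open>r\<close> projections agree automatically.
  The \<open>rho u\<close> projections say exactly that the section is natural along the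
  degree-lowering \<open>u\<close>, from the identity component given by \<open>a\<close> to the
  lower components given by \<open>c\<close>.\<close>

lemma w_eq:
  assumes w: "is_w1 w1" "is_w2 w2" and a: "a \<in> Arr E" "Cod E a = Dom E V" and c: "c \<in> Arr E" "Cod E c = Dom E q1" "Dom E a = Dom E c"
  shows "w1 \<bullet> a = w2 \<bullet> c \<longleftrightarrow> V \<bullet> a = q1 \<bullet> c \<and>
    (\<forall>t b u. dspan E fi (V \<bullet> a) t b \<longrightarrow> low i u \<longrightarrow> FArr C u \<bullet> appV (a \<bullet> t) b =
      app (Cod I u) (Id I (Cod I u)) (pr u \<bullet> (q2 \<bullet> (c \<bullet> t))) (FArr B u \<bullet> b))" (is "?l \<longleftrightarrow> ?x \<and> ?r")
proof -
  have w1: "w1 \<in> Arr E" "Dom E w1 = Dom E V" "Cod E w1 = Dom E W" "W \<bullet> w1 = V" 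
    and e1: "\<And>y b u. dspan E fi V y b \<Longrightarrow> low i u \<Longrightarrow> rho u \<bullet> appW (w1 \<bullet> y) b = FArr C u \<bullet> appV y b"
    using w(1) unfolding is_w1_def by blast+
  have w2: "w2 \<in> Arr E" "Dom E w2 = Dom E q1" "Cod E w2 = Dom E W" "W \<bullet> w2 = q1" 
    and e2: "\<And>y b u. dspan E fi q1 y b \<Longrightarrow> low i u \<Longrightarrow> rho u \<bullet> appW (w2 \<bullet> y) b = 
      app (Cod I u) (Id I (Cod I u)) (pr u \<bullet> (q2 \<bullet> y)) (FArr B u \<bullet> b)"
    using w(2) unfolding is_w2_def by blast+
  have over: "W \<bullet> (w1 \<bullet> a) = V \<bullet> a" "W \<bullet> (w2 \<bullet> c) = q1 \<bullet> c"
    using E.comp_extend[OF w1(4), of a] E.comp_extend[OF w2(4), of c] w1(1-3) w2(1-3) a c by simp_all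
  have sp: "dspan E fi V (a \<bullet> t) b" "t \<in> Arr E" "Cod E t = Dom E a" if "dspan E fi (V \<bullet> a) t b" for t b
  proof -
    show t: "t \<in> Arr E" "Cod E t = Dom E a" using that a by (simp_all add: dspan_def)
    show "dspan E fi V (a \<bullet> t) b" using that t a unfolding dspan_def by simp
  qed
  have sp2: "dspan E fi q1 (c \<bullet> t) b" if d: "dspan E fi (V \<bullet> a) t b" and x: ?x for t b
    using d[unfolded x] sp(2,3)[OF d] c unfolding dspan_def by simp
  have spW: "dspan E fi W (w1 \<bullet> a \<bullet> t) b" if d: "dspan E fi (V \<bullet> a) t b" for t b
    using d[folded over(1)] sp(2,3)[OF d] w1(1-3) a unfolding dspan_def by simp
  have spW2: "dspan E fi W (w2 \<bullet> c \<bullet> t) b" if d: "dspan E fi (V \<bullet> a) t b" and x: ?x for t b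
    using d[unfolded x, folded over(2)] sp(2,3)[OF d] w2(1-3) c unfolding dspan_def by simp
  have asc: "w1 \<bullet> a \<bullet> t = w1 \<bullet> (a \<bullet> t)" "w2 \<bullet> c \<bullet> t = w2 \<bullet> (c \<bullet> t)"
    if d: "dspan E fi (V \<bullet> a) t b" for t b
    using sp(2,3)[OF d] w1(1-3) w2(1-3) a c by simp_all
  show ?thesis
  proof
    assume eq: ?l
    then have x: ?x using over by simp
    moreover have ?r
    proof (intro allI impI)
      fix t b u assume d: "dspan E fi (V \<bullet> a) t b" and u: "low i u"
      show "FArr C u \<bullet> appV (a \<bullet> t) b = app (Cod I u) (Id I (Cod I u)) (pr u \<bullet> (q2 \<bullet> (c \<bullet> t))) (FArr B u \<bullet> b)"
        using e1[OF sp(1)[OF d] u] e2[OF sp2[OF d x] u] asc[OF d] eq by simp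
    qed
    ultimately show "?x \<and> ?r" by blast
  next
    assume "?x \<and> ?r"
    then have x: ?x and rr: ?r by blast+
    show ?l
    proof (rule E.dprod_ext[OF pow[OF i] r_simps(1), folded W_def])
      fix t b assume "dspan E fi (W \<bullet> (w1 \<bullet> a)) t b"
      then have d: "dspan E fi (V \<bullet> a) t b" unfolding over .
      note W1 = appW[OF spW[OF d]] and W2 = appW[OF spW2[OF d x]]
      show "appW (w1 \<bullet> a \<bullet> t) b = appW (w2 \<bullet> c \<bullet> t) b"
      proof (rule r_eqI)
        show "Dom E (appW (w1 \<bullet> a \<bullet> t) b) = Dom E (appW (w2 \<bullet> c \<bullet> t) b)"
          unfolding W1 W2 using sp(2,3)[OF d] w1(1-3) w2(1-3) a c by simp
        fix u assume u: "low i u"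
        show "rho u \<bullet> appW (w1 \<bullet> a \<bullet> t) b = rho u \<bullet> appW (w2 \<bullet> c \<bullet> t) b"
          unfolding asc[OF d] using e1[OF sp(1)[OF d] u] e2[OF sp2[OF d x] u] rr d u by simp
      qed (use W1 W2 in simp_all)
    qed (use w1(1-3) w2(1-3) a c x over in simp_all)
  qed
qed

text \<open>A map \<open>u\<close> out of \<open>i\<close> which does not lower the degree is invertible, so by naturality the component
  of a section at \<open>u\<close> is determined by its component \<open>s\<close> at the identity.\<close>

definition glue :: "('a \<Rightarrow> 'a \<Rightarrow> 'a) \<Rightarrow> 'a \<Rightarrow> 'u \<Rightarrow> 'a \<Rightarrow> 'a \<Rightarrow> 'a" where
  "glue s c u t b = (if low i u then app (Cod I u) (Id I (Cod I u)) (pr u \<bullet> (q2 \<bullet> (c \<bullet> t))) b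
     else FArr C u \<bullet> s t (FArr B (inv_arr I u) \<bullet> b))"

lemma inverse_facts:
  assumes "u \<in> Arr I" "Dom I u = i" "\<not> low i u"
  shows "inv_arr I u \<in> Arr I" "Dom I (inv_arr I u) = Cod I u" "Cod I (inv_arr I u) = i"
    "inv_arr I u \<star> u = Id I i" "u \<star> inv_arr I u = Id I (Cod I u)"
  using I.is_iso_inv_arr[OF not_low_iso[OF assms(1)]] assms by (auto simp: are_inverse_def hom_def)

text \<open>Naturality along \<open>v\<close> splits by whether \<open>u\<close> and
  \<open>v \<star> u\<close> lower the degree. If \<open>u\<close> does, so does
  \<open>v \<star> u\<close>, and the sections below \<open>i\<close> are already compatible; if
  only \<open>v \<star> u\<close> does, \<open>eq\<close> is the required equation; if neither does,
  both values transport the same value of \<open>s\<close> along isomorphisms.\<close>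

lemma glue_sec:
  assumes c: "c \<in> Arr E" "Cod E c = Dom E q1"
    and s: "\<And>t b. dspan E fi (q1 \<bullet> c) t b \<Longrightarrow> s t b \<in> Arr E \<and> Dom E (s t b) = Dom E t \<and>
       Cod E (s t b) = FObj C i \<and> Cmp g i \<bullet> s t b = b"
    and nat: "\<And>t b k. dspan E fi (q1 \<bullet> c) t b \<Longrightarrow> k \<in> Arr E \<Longrightarrow> Cod E k = Dom E t \<Longrightarrow> s (t \<bullet> k) (b \<bullet> k) = s t b \<bullet> k"
    and eq: "\<And>t b u. dspan E fi (q1 \<bullet> c) t b \<Longrightarrow> low i u \<Longrightarrow> FArr C u \<bullet> s t b =
      app (Cod I u) (Id I (Cod I u)) (pr u \<bullet> (q2 \<bullet> (c \<bullet> t))) (FArr B u \<bullet> b)"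
  shows "sec i (q1 \<bullet> c) (glue s c)"
proof (rule secI)
  let ?x = "q1 \<bullet> c"
  show x: "?x \<in> Arr E" "Cod E ?x = FObj A i" using c by simp_all
  have Dx: "Dom E ?x = Dom E c" using c by simp
  fix u t b assume sp: "span i ?x u t b"
  note S = spanD[OF sp]
  have t: "t \<in> Arr E" "Cod E t = Dom E c" using S Dx by simp_all
  let ?e = "pr u \<bullet> (q2 \<bullet> (c \<bullet> t))"
  have lowsp: "span (Cod I u) (p (Cod I u)) (Id I (Cod I u)) ?e b" if u: "low i u"
    using span_low[OF u c t, of "Id I (Cod I u)" b] sp u S(1,2) by simp
  note lowsec = secD[OF ldp_sec[OF ldp_low]]
  let ?b = "FArr B (inv_arr I u) \<bullet> b"
  have isosp: "dspan E fi ?x t ?b" "FArr B u \<bullet> ?b = b" if u: "\<not> low i u"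
  proof -
    note iu = inverse_facts[OF S(1,2) u]
    have "span i ?x (inv_arr I u \<star> u) t ?b"
      by (rule span_natural[OF x sp]) (use iu in simp_all)
    then show "dspan E fi ?x t ?b" using span_Id[OF x i] iu by simp
    show "FArr B u \<bullet> ?b = b"
      using functor_comp_extend[OF Src_functor[OF f] iu(1) S(1), of b] iu S by simp
  qed
  show "glue s c u t b \<in> Arr E" "Dom E (glue s c u t b) = Dom E t" "Cod E (glue s c u t b) = FObj C (Cod I u)"
    "Cmp g (Cod I u) \<bullet> glue s c u t b = b"
  proof -
    have "glue s c u t b \<in> Arr E \<and> Dom E (glue s c u t b) = Dom E t \<and> Cod E (glue s c u t b) = FObj C (Cod I u)
       \<and> Cmp g (Cod I u) \<bullet> glue s c u t b = b"
    proof (cases "low i u")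
      case True
      then show ?thesis using lowsec(3-6)[OF True lowsp[OF True]] c t by (simp add: glue_def)
    next
      case False
      then show ?thesis using s[OF isosp(1)[OF False]] isosp(2)[OF False] natural_g[OF S(1), of "s t ?b"] S
        by (simp add: glue_def)
    qed
    then show "glue s c u t b \<in> Arr E" "Dom E (glue s c u t b) = Dom E t" "Cod E (glue s c u t b) = FObj C (Cod I u)"
      "Cmp g (Cod I u) \<bullet> glue s c u t b = b" by blast+
  qed
  show "glue s c u (t \<bullet> k) (b \<bullet> k) = glue s c u t b \<bullet> k" if k: "k \<in> Arr E" "Cod E k = Dom E t" for k
  proof (cases "low i u")
    case True
    then show ?thesis using sec_stage[OF ldp_sec[OF ldp_low[OF True]] lowsp[OF True] k(1)] k c t by (simp add: glue_def)
  next
    case False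
    note iu = inverse_facts[OF S(1,2) False]
    show ?thesis using nat[OF isosp(1)[OF False] k] s[OF isosp(1)[OF False]] False k c t S iu by (simp add: glue_def)
  qed
  show "FArr C v \<bullet> glue s c u t b = glue s c (v \<star> u) t (FArr B v \<bullet> b)" if v: "v \<in> Arr I" "Dom I v = Cod I u" for v
  proof (cases "low i u")
    case True
    note vu = low_comp[OF True v]
    have "FArr C v \<bullet> glue s c u t b = app (Cod I u) v ?e (FArr B v \<bullet> b)"
      using sec_natural[OF ldp_sec[OF ldp_low[OF True]] lowsp[OF True] v(1)] v True by (simp add: glue_def)
    also have "\<dots> = glue s c (v \<star> u) t (FArr B v \<bullet> b)"
      using app_shift[OF True c t v span_natural[OF x sp v]] vu S(1) v by (simp add: glue_def)
    finally show ?thesis .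
  next
    case False
    note iu = inverse_facts[OF S(1,2) False]
    note d = isosp(1)[OF False] and bb = isosp(2)[OF False]
    have l: "FArr C v \<bullet> glue s c u t b = FArr C (v \<star> u) \<bullet> s t ?b"
      using functor_comp_extend[OF Src_functor[OF g] S(1) v(1), of "s t ?b"] s[OF d] S v False by (simp add: glue_def)
    have vb: "FArr B (v \<star> u) \<bullet> ?b = FArr B v \<bullet> b"
      using functor_comp_extend[OF Src_functor[OF f] S(1) v(1), of ?b] bb S v iu by simp
    have vu: "v \<star> u \<in> Arr I" "Dom I (v \<star> u) = i" "Cod I (v \<star> u) = Cod I v" using S v by simp_all
    show ?thesis
    proof (cases "low i (v \<star> u)")
      case True
      then show ?thesis using eq[OF d True] l vb vu by (simp add: glue_def)
    next
      case nl: False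
      note ivu = inverse_facts[OF vu(1,2) nl]
      \<comment> \<open>Cancelling \<open>v\<close> against the inverse of
        \<open>v \<star> u\<close> leaves the inverse of \<open>u\<close>, so both sides evaluate
        \<open>s\<close> at the same element \<open>?b\<close>.\<close>
      have "inv_arr I (v \<star> u) \<star> v = (inv_arr I (v \<star> u) \<star> v) \<star> (u \<star> inv_arr I u)"
        using iu ivu vu v S by simp
      also have "\<dots> = (inv_arr I (v \<star> u) \<star> (v \<star> u)) \<star> inv_arr I u"
        using iu(1-3) ivu(1-3) vu v S by simp
      also have "\<dots> = inv_arr I u" unfolding ivu(4) using iu by simp
      finally have "FArr B (inv_arr I (v \<star> u)) \<bullet> (FArr B v \<bullet> b) = ?b"
        using functor_comp_extend[OF Src_functor[OF f] v(1) ivu(1), of b] ivu(2) vu v S by simp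
      then show ?thesis using l nl by (simp add: glue_def)
    qed
  qed
qed

section \<open>The two maps into the dependent product of Bi x M_i C\<close>

lemma gap_map:
  shows "pb_pair E mB Mg (Cmp g i) (match_map I deg E i C) \<in> Arr E" (is "?k \<in> _")
    "Dom E (pb_pair E mB Mg (Cmp g i) (match_map I deg E i C)) = FObj C i"
    "Cod E (pb_pair E mB Mg (Cmp g i) (match_map I deg E i C)) = Dom E r"
    "r \<bullet> pb_pair E mB Mg (Cmp g i) (match_map I deg E i C) = Cmp g i"
    "low i u \<Longrightarrow> rho u \<bullet> pb_pair E mB Mg (Cmp g i) (match_map I deg E i C) = FArr C u"
proof -
  have eq: "mB \<bullet> Cmp g i = Mg \<bullet> match_map I deg E i C"
    using match_naturality[OF i g] by simp
  note pp = E.pb_pair[of mB Mg, OF _ _ _ _ _ _ _ _ eq]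
  show 1: "?k \<in> Arr E" "Dom E ?k = FObj C i" "Cod E ?k = Dom E r" "r \<bullet> ?k = Cmp g i"
    using pp by (simp_all add: r_def)
  show "rho u \<bullet> ?k = FArr C u" if u: "low i u"
    using u pp 1 prj_match_map[OF i Src_functor[OF g] u] unfolding rho_def by (simp add: r_def)
qed

text \<open>By \<open>dprod_map\<close> the dependent product postcomposes values with the gap map,
  whose projections are \<open>Cmp g i\<close> and the arrows \<open>FArr C u\<close>.\<close>

lemma is_w1_gap: "is_w1 (Pi_gap_map I deg E i f g)"
proof -
  let ?k = "pb_pair E mB Mg (Cmp g i) (match_map I deg E i C)"
  note k = gap_map
  have d: "Dom E ?k = Dom E (Cmp g i)" "Cod E (Cmp g i) = Dom E fi" "Cod E r = Dom E fi" using k by simp_all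
  have w: "Pi_gap_map I deg E i f g = underlying (FArr (dprod E fi) (Cmp g i, ?k, r))"
    by (simp add: Pi_gap_map_def r_def)
  note m = E.dprod_map[OF pow[OF i] k(1) d(1) k(3,4) Cmp_arr[OF g i] d(2) r_simps(1) d(3), folded w V_def W_def]
  show ?thesis
    unfolding is_w1_def
  proof (intro conjI allI impI)
    fix y b u assume s: "dspan E fi V y b" and u: "low i u"
    show "rho u \<bullet> appW (Pi_gap_map I deg E i f g \<bullet> y) b = FArr C u \<bullet> appV y b"
      unfolding m(5)[OF s] using E.comp_extend[OF k(5)[OF u], of "appV y b"] k(1-3) u appV[OF s] by simp
  qed (use m in simp_all)
qed

lemma span_low_q:
  assumes "low i u" "t \<in> Arr E" "Cod E t = Dom E q1" "v \<in> Arr I" "Dom I v = Cod I u"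
  shows "span (Cod I u) (p (Cod I u)) v (pr u \<bullet> (q2 \<bullet> t)) b \<longleftrightarrow> span i q1 (v \<star> u) t b"
  using span_low[of u "Id E (Dom E q1)" t v b] assms by simp

lemma app_shift_q:
  assumes "low i u" "t \<in> Arr E" "Cod E t = Dom E q1" "v \<in> Arr I" "Dom I v = Cod I u" "span i q1 (v \<star> u) t b"
  shows "app (Cod I u) v (pr u \<bullet> (q2 \<bullet> t)) b =
    app (Cod I v) (Id I (Cod I v)) (pr (v \<star> u) \<bullet> (q2 \<bullet> t)) b"
  using app_shift[of u "Id E (Dom E q1)" t v b] assms by simp

text \<open>The values of the lower components at an element \<open>(t, b)\<close> form a matching
  family over \<open>b\<close>, that is, an element of Bi x M_i C. The third conclusion makes this
  element natural in the stage, so that it defines a map into the domain of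
  \<open>W\<close>.\<close>

lemma q1_cone:
  assumes d: "dspan E fi q1 t b"
  defines "c u \<equiv> app (Cod I u) (Id I (Cod I u)) (pr u \<bullet> (q2 \<bullet> t)) (FArr B u \<bullet> b)"
  shows "low i u \<Longrightarrow> c u \<in> Arr E \<and> Dom E (c u) = Dom E b \<and> Cod E (c u) = FObj C (Cod I u)
      \<and> Cmp g (Cod I u) \<bullet> c u = FArr B u \<bullet> b"
    and "low i u \<Longrightarrow> h \<in> Arr I \<Longrightarrow> Dom I h = Cod I u \<Longrightarrow> FArr C h \<bullet> c u = c (h \<star> u)"
    and "low i u \<Longrightarrow> k \<in> Arr E \<Longrightarrow> Cod E k = Dom E t \<Longrightarrow>
      app (Cod I u) (Id I (Cod I u)) (pr u \<bullet> (q2 \<bullet> (t \<bullet> k))) (FArr B u \<bullet> (b \<bullet> k)) = c u \<bullet> k"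
proof -
  have t: "t \<in> Arr E" "b \<in> Arr E" "Cod E t = Dom E q1" "Cod E b = FObj B i" "Dom E b = Dom E t"
    using d by (simp_all add: dspan_def)
  have sp0: "span i q1 u t (FArr B u \<bullet> b)" if "low i u" for u
    using span_dspan[OF _ _ i d, of u] that by auto
  have sp: "span (Cod I u) (p (Cod I u)) (Id I (Cod I u)) (pr u \<bullet> (q2 \<bullet> t)) (FArr B u \<bullet> b)" if u: "low i u" for u
    using span_low_q[OF u t(1,3), of "Id I (Cod I u)"] sp0[OF u] u lowD(1)[OF u] by simp
  note S = secD[OF ldp_sec[OF ldp_low] ]
  show "c u \<in> Arr E \<and> Dom E (c u) = Dom E b \<and> Cod E (c u) = FObj C (Cod I u)
      \<and> Cmp g (Cod I u) \<bullet> c u = FArr B u \<bullet> b" if u: "low i u"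
    unfolding c_def using S(3-6)[OF u sp[OF u]] t u by simp
  show "FArr C h \<bullet> c u = c (h \<star> u)" if u: "low i u" and h: "h \<in> Arr I" "Dom I h = Cod I u"
  proof -
    have u': "u \<in> Arr I" "Dom I u = i" using u by auto
    have "FArr C h \<bullet> c u = app (Cod I u) h (pr u \<bullet> (q2 \<bullet> t)) (FArr B h \<bullet> (FArr B u \<bullet> b))"
      unfolding c_def using sec_natural[OF ldp_sec[OF ldp_low[OF u]] sp[OF u] h(1)] h u by simp
    also have "\<dots> = c (h \<star> u)"
      unfolding c_def using app_shift_q[OF u t(1,3) h span_natural[OF _ _ sp0[OF u] h]] u' h t by simp
    finally show ?thesis .
  qed
  show "app (Cod I u) (Id I (Cod I u)) (pr u \<bullet> (q2 \<bullet> (t \<bullet> k))) (FArr B u \<bullet> (b \<bullet> k)) = c u \<bullet> k"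
    if u: "low i u" and k: "k \<in> Arr E" "Cod E k = Dom E t"
    unfolding c_def using sec_stage[OF ldp_sec[OF ldp_low[OF u]] sp[OF u] k(1)] k u t lowD(1,2)[OF u] by simp
qed

text \<open>The second map is obtained directly from the universal property of \<open>W\<close>. The
  composite of transposes in the statement is shown later to meet the same specification once the
  lower diagram is the dependent product itself, so construction and formula need not share a
  definition.\<close>

lemma w2_ex: "\<exists>w. is_w2 w"
proof -
  define c where "c t b u = app (Cod I u) (Id I (Cod I u)) (pr u \<bullet> (q2 \<bullet> t)) (FArr B u \<bullet> b)" for t b u
  define s where "s t b = pb_pair E mB Mg b (lift i C (Dom E b) (c t b))" for t b
  have s: "s t b \<in> Arr E" "Dom E (s t b) = Dom E b" "Cod E (s t b) = Dom E r" "r \<bullet> s t b = b"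
    "\<And>u. low i u \<Longrightarrow> rho u \<bullet> s t b = c t b u" if d: "dspan E fi q1 t b" for t b
  proof -
    have b: "b \<in> Arr E" "Cod E b = FObj B i" using d by (simp_all add: dspan_def)
    note R = r_lift[OF b q1_cone(1,2)[OF d], folded c_def s_def]
    show "s t b \<in> Arr E" "Dom E (s t b) = Dom E b" "Cod E (s t b) = Dom E r" "r \<bullet> s t b = b"
      "\<And>u. low i u \<Longrightarrow> rho u \<bullet> s t b = c t b u"
      using R unfolding c_def s_def by blast+
  qed
  have nat: "s (t \<bullet> k) (b \<bullet> k) = s t b \<bullet> k" if d: "dspan E fi q1 t b" and k: "k \<in> Arr E" "Cod E k = Dom E t" for t b k
  proof -
    have t: "t \<in> Arr E" "b \<in> Arr E" "Cod E t = Dom E q1" "Cod E b = FObj B i" "Dom E b = Dom E t"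
      using d by (simp_all add: dspan_def)
    have d': "dspan E fi q1 (t \<bullet> k) (b \<bullet> k)"
      by (rule E.dspan_comp[OF _ _ _ d k]) simp_all
    note S = s[OF d] and S' = s[OF d']
    show ?thesis
    proof (rule r_eqI)
      fix u assume u: "low i u"
      show "rho u \<bullet> s (t \<bullet> k) (b \<bullet> k) = rho u \<bullet> (s t b \<bullet> k)"
        using S'(5)[OF u] E.comp_extend[OF S(5)[OF u], of k] q1_cone(3)[OF d u k] S(1-3) u k t unfolding c_def by simp
    qed (use S S' k t E.comp_extend[OF S(4), of k] in simp_all)
  qed
  obtain h where h: "h \<in> Arr E" "Dom E h = Dom E q1" "Cod E h = Dom E W" "W \<bullet> h = q1"
    "\<And>t b. dspan E fi q1 t b \<Longrightarrow> appW (h \<bullet> t) b = s t b"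
    unfolding W_def by (rule E.dprod_lift[OF pow[OF i] r_simps(1), of q1 s]) (use s nat in \<open>auto simp: dspan_def\<close>)
  have "is_w2 h"
    unfolding is_w2_def
  proof (intro conjI allI impI)
    fix y b u assume d: "dspan E fi q1 y b" and u: "low i u"
    show "rho u \<bullet> appW (h \<bullet> y) b = app (Cod I u) (Id I (Cod I u)) (pr u \<bullet> (q2 \<bullet> y)) (FArr B u \<bullet> b)"
      unfolding h(5)[OF d] s(5)[OF d u] c_def ..
  qed (use h in simp_all)
  then show ?thesis ..
qed

text \<open>A section \<open>s\<close> over \<open>x\<close> splits into its value at the identity,
  transposed to a map \<open>\<alpha>\<close> into the domain of \<open>V\<close>, and its lower
  components, collected into a map \<open>\<gamma>\<close> into Ai x L. By \<open>w_eq\<close> these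
  agree in the domain of \<open>W\<close> exactly when they fit together into a section, so a
  section is a map into the pullback.\<close>

theorem pullback_ldp:
  assumes w1: "is_w1 w1" and w2: "is_w2 w2" and pb: "is_pullback E w1 w2 a c"
  defines "app' \<equiv> glue (\<lambda>t b. appV (a \<bullet> t) b) c"
  shows "ldp i (q1 \<bullet> c) app'"
    and "V \<bullet> a = q1 \<bullet> c"
    and "dspan E fi (q1 \<bullet> c) t b \<Longrightarrow> app' (Id I i) t b = appV (a \<bullet> t) b"
    and "low i u \<Longrightarrow> v \<in> Arr I \<Longrightarrow> Dom I v = Cod I u \<Longrightarrow> span i (q1 \<bullet> c) (v \<star> u) t b \<Longrightarrow>
      app' (v \<star> u) t b = app (Cod I u) v (pr u \<bullet> (q2 \<bullet> (c \<bullet> t))) b"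
proof -
  note PB = E.is_pullbackD[OF pb]
  have W1: "w1 \<in> Arr E" "Dom E w1 = Dom E V" and W2: "w2 \<in> Arr E" "Dom E w2 = Dom E q1"
    using w1 w2 unfolding is_w1_def is_w2_def by blast+
  have a: "a \<in> Arr E" "Cod E a = Dom E V" and c: "c \<in> Arr E" "Cod E c = Dom E q1" and ac: "Dom E a = Dom E c"
    using PB W1 W2 by simp_all
  let ?P = "q1 \<bullet> c"
  have x: "?P \<in> Arr E" "Cod E ?P = FObj A i" "Dom E ?P = Dom E c" using c by simp_all
  have Va: "V \<bullet> a = ?P"
    using w_eq[OF w1 w2 a c ac] PB(8) by blast
  then show "V \<bullet> a = ?P" .
  have comp: "FArr C u \<bullet> appV (a \<bullet> t) b =
      app (Cod I u) (Id I (Cod I u)) (pr u \<bullet> (q2 \<bullet> (c \<bullet> t))) (FArr B u \<bullet> b)"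
    if "dspan E fi ?P t b" "low i u" for t b u
    using w_eq[OF w1 w2 a c ac] PB(8) that unfolding Va by blast
  have sV: "dspan E fi V (a \<bullet> t) b" if "dspan E fi ?P t b" for t b
    by (rule E.dspan_lift[OF pow[OF i] Cmp_arr[OF g i], folded V_def]) (use a that Va in simp_all)
  have aV: "appV (a \<bullet> t) b \<in> Arr E" "Dom E (appV (a \<bullet> t) b) = Dom E t"
    "Cod E (appV (a \<bullet> t) b) = FObj C i" "Cmp g i \<bullet> appV (a \<bullet> t) b = b" if "dspan E fi ?P t b" for t b
    using appV[OF sV[OF that]] a ac that x by (simp_all add: dspan_def)
  have sec': "sec i ?P app'"
    unfolding app'_def
  proof (rule glue_sec[OF c])
    fix t b k assume d: "dspan E fi ?P t b" and k: "k \<in> Arr E" "Cod E k = Dom E t"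
    have t: "t \<in> Arr E" "Cod E t = Dom E c" using d x by (simp_all add: dspan_def)
    show "appV (a \<bullet> (t \<bullet> k)) (b \<bullet> k) = appV (a \<bullet> t) b \<bullet> k"
      using E.dapp_comp[OF pow[OF i] Cmp_arr[OF g i] _ sV[OF d, unfolded V_def] k(1)] k a ac t by simp
  qed (use aV comp in simp_all)
  show appId: "app' (Id I i) t b = appV (a \<bullet> t) b" if d: "dspan E fi ?P t b" for t b
  proof -
    \<comment> \<open>The identity falls into the second branch of \<open>glue\<close> and is its
      own inverse, so nothing is transported.\<close>
    have n: "\<not> low i (Id I i)" by (simp add: low_def)
    have "are_inverse I (Id I i) (Id I i)" by (simp add: are_inverse_def hom_def)
    then have "inv_arr I (Id I i) = Id I i" by (rule I.inv_arr_eq)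
    then show ?thesis using n aV[OF d] d unfolding app'_def glue_def by (simp add: dspan_def)
  qed
  show appLow: "app' (v \<star> u) t b = app (Cod I u) v (pr u \<bullet> (q2 \<bullet> (c \<bullet> t))) b"
    if u: "low i u" and v: "v \<in> Arr I" "Dom I v = Cod I u" and s: "span i ?P (v \<star> u) t b" for u v t b
  proof -
    have t: "t \<in> Arr E" "Cod E t = Dom E c" using spanD[OF s] x by simp_all
    show ?thesis
      unfolding app_shift[OF u c t v s] app'_def glue_def using low_comp[OF u v] u v lowD(1)[OF u] by simp
  qed
  show "ldp i ?P app'"
  proof (rule ldpI[OF sec'])
    fix x s assume sec: "sec i x s"
    note S = secD[OF sec] note x = S(1,2)
    have id: "span i x (Id I i) t b \<longleftrightarrow> dspan E fi x t b" for t b by (rule span_Id[OF x i])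
    obtain \<alpha> where \<alpha>: "\<alpha> \<in> Arr E" "Dom E \<alpha> = Dom E x" "Cod E \<alpha> = Dom E V" "V \<bullet> \<alpha> = x"
      and app\<alpha>: "\<And>t b. dspan E fi x t b \<Longrightarrow> appV (\<alpha> \<bullet> t) b = s (Id I i) t b"
      unfolding V_def
      by (rule E.dprod_lift[OF pow[OF i] Cmp_arr[OF g i], of x "s (Id I i)"])
        (use x S(3-6)[of "Id I i"] sec_stage[OF sec, of "Id I i"] id in auto)
    \<comment> \<open>\<open>Q u h\<close> says that \<open>h\<close> represents, at
      \<open>Cod I u\<close>, the restriction of the section \<open>s\<close> along
      \<open>u\<close>. Collecting these properties in one predicate allows a representing map
      \<open>\<beta> u\<close> to be chosen for all \<open>u\<close> at once.\<close>
    define Q where "Q u h \<longleftrightarrow> h \<in> Arr E \<and> Dom E h = Dom E x \<and> Cod E h = FObj X (Cod I u) \<and> p (Cod I u) \<bullet> h = FArr A u \<bullet> x \<and>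
      (\<forall>v t b. v \<in> Arr I \<longrightarrow> Dom I v = Cod I u \<longrightarrow> span i x (v \<star> u) t b \<longrightarrow> app (Cod I u) v (h \<bullet> t) b = s (v \<star> u) t b)" for u h
    have exQ: "\<exists>h. Q u h" if u: "low i u" for u
    proof -
      have u': "u \<in> Arr I" "Dom I u = i" using u by auto
      have sx: "sec (Dom I u) x s" using sec u' by simp
      obtain h where h: "h \<in> Arr E" "Dom E h = Dom E (FArr A u \<bullet> x)" "Cod E h = Dom E (p (Cod I u))"
        "p (Cod I u) \<bullet> h = FArr A u \<bullet> x"
        "\<And>v t b. span (Cod I u) (FArr A u \<bullet> x) v t b \<Longrightarrow> app (Cod I u) v (h \<bullet> t) b = s (v \<star> u) t b"
        using ldp_lift[OF ldp_low[OF u] sec_shift[OF sx u'(1)]] by blast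
      have h': "Dom E h = Dom E x" "Cod E h = FObj X (Cod I u)" using h(2,3) x u u' by simp_all
      have "app (Cod I u) v (h \<bullet> t) b = s (v \<star> u) t b"
        if "v \<in> Arr I" "Dom I v = Cod I u" "span i x (v \<star> u) t b" for v t b
        by (rule h(5)) (use span_shift[of x u v t b] that x u' in simp)
      then have "Q u h" using h(1,4) h' unfolding Q_def by auto
      then show ?thesis ..
    qed
    have ex: "Q u (SOME h. Q u h)" if "low i u" for u
      by (rule someI_ex[OF exQ[OF that]])
    define \<beta> where "\<beta> u = (SOME h. Q u h)" for u
    have \<beta>: "\<beta> u \<in> Arr E" "Dom E (\<beta> u) = Dom E x" "Cod E (\<beta> u) = FObj X (Cod I u)"
        "p (Cod I u) \<bullet> \<beta> u = FArr A u \<bullet> x"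
      and app\<beta>: "\<And>v t b. v \<in> Arr I \<Longrightarrow> Dom I v = Cod I u \<Longrightarrow> span i x (v \<star> u) t b \<Longrightarrow>
         app (Cod I u) v (\<beta> u \<bullet> t) b = s (v \<star> u) t b"
      if "low i u" for u
      using ex[OF that] unfolding Q_def \<beta>_def by blast+
    \<comment> \<open>Both sides of the cone equation represent the restriction of \<open>s\<close>
      along \<open>h \<star> u\<close>, so the universal property at its codomain identifies
      them.\<close>
    have cone: "low_cone i X (Dom E x) \<beta>"
      unfolding low_cone_def
    proof (intro conjI allI impI)
      fix u h assume u: "low i u" and h: "h \<in> Arr I" "Dom I h = Cod I u"
      note hu = low_comp[OF u h]
      have u': "u \<in> Arr I" "Dom I u = i" using u by auto
      have Ch: "Cod I (h \<star> u) = Cod I h" using u' h by simp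
      note xh = X_arr[OF u h]
      have over: "p (Cod I (h \<star> u)) \<bullet> (FArr X h \<bullet> \<beta> u) = FArr A (h \<star> u) \<bullet> x"
        using E.comp_extend[OF xh(4), of "\<beta> u"] \<beta>[OF u] xh(1-3) u u' h x p_arr[OF hu] Dom_p_low[OF hu] unfolding Ch by simp
      show "FArr X h \<bullet> \<beta> u = \<beta> (h \<star> u)"
      proof (rule ldp_eqI[OF ldp_low[OF hu]])
        fix v t b assume "span (Cod I (h \<star> u)) (p (Cod I (h \<star> u)) \<bullet> (FArr X h \<bullet> \<beta> u)) v t b"
        then have v: "v \<in> Arr I" "Dom I v = Cod I h" and sp: "span i x (v \<star> (h \<star> u)) t b"
          unfolding over using span_shift[of x "h \<star> u" v t b] x u' h by auto
        have t: "t \<in> Arr E" "Cod E t = Dom E x" using spanD[OF sp] by simp_all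
        have sp2: "span (Cod I u) (p (Cod I u)) (v \<star> h) (\<beta> u \<bullet> t) b"
        proof -
          have "span (Cod I u) (FArr A u \<bullet> x) (v \<star> h) t b"
            using span_shift[of x u "v \<star> h" t b] sp x u' h v by simp
          then show ?thesis
            unfolding \<beta>(4)[OF u, symmetric] using span_comp[of "p (Cod I u)" "Cod I u" "\<beta> u"] \<beta>(1-3)[OF u] u by simp
        qed
        have "app (Cod I h) v (FArr X h \<bullet> (\<beta> u \<bullet> t)) b = app (Cod I u) (v \<star> h) (\<beta> u \<bullet> t) b"
          by (rule xh(5)[OF v sp2])
        also have "\<dots> = s ((v \<star> h) \<star> u) t b"
          by (rule app\<beta>[OF u]) (use sp v h u' in simp_all)
        also have "\<dots> = s (v \<star> (h \<star> u)) t b" using v h u' by simp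
        also have "\<dots> = app (Cod I h) v (\<beta> (h \<star> u) \<bullet> t) b"
          using app\<beta>[OF hu _ _ sp] v unfolding Ch by simp
        finally show "app (Cod I (h \<star> u)) v (FArr X h \<bullet> \<beta> u \<bullet> t) b = app (Cod I (h \<star> u)) v (\<beta> (h \<star> u) \<bullet> t) b"
          unfolding Ch using t xh(1-3) \<beta>[OF u] by simp
      next
        show "p (Cod I (h \<star> u)) \<bullet> (FArr X h \<bullet> \<beta> u) = p (Cod I (h \<star> u)) \<bullet> \<beta> (h \<star> u)"
          unfolding over \<beta>(4)[OF hu] ..
      qed (use xh(1-3) \<beta>(1-3)[OF u] \<beta>(1-3)[OF hu] Ch Dom_p_low[OF hu] in simp_all)
    qed (use \<beta> x in simp_all)
    define \<beta>' where "\<beta>' = lift i X (Dom E x) \<beta>"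
    have \<beta>': "\<beta>' \<in> Arr E" "Dom E \<beta>' = Dom E x" "Cod E \<beta>' = L" "\<And>u. low i u \<Longrightarrow> pr u \<bullet> \<beta>' = \<beta> u"
      unfolding \<beta>'_def L_def pr_def using lift[OF i X cone] by simp_all
    have m: "mA \<bullet> x = l \<bullet> \<beta>'"
    proof (rule lim_eqI[OF i, of A])
      fix u assume u: "low i u"
      show "prj i A u \<bullet> (mA \<bullet> x) = prj i A u \<bullet> (l \<bullet> \<beta>')"
        using E.comp_extend[OF prj_match_map[OF i Tgt_functor[OF f] u], of x]
          E.comp_extend[OF prj_l[OF u], of \<beta>'] \<beta>[OF u] \<beta>'(1-3) \<beta>'(4)[OF u] x u by simp
    qed (use x \<beta>' in simp_all)
    define \<gamma> where "\<gamma> = pb_pair E mA l x \<beta>'"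
    have \<gamma>: "\<gamma> \<in> Arr E" "Dom E \<gamma> = Dom E x" "Cod E \<gamma> = Dom E q1" "q1 \<bullet> \<gamma> = x" "q2 \<bullet> \<gamma> = \<beta>'"
      unfolding \<gamma>_def q1_def q2_def using E.pb_pair[of mA l, OF _ _ _ _ _ _ _ _ m] \<beta>' x by simp_all
    have \<gamma>\<beta>: "pr u \<bullet> (q2 \<bullet> (\<gamma> \<bullet> t)) = \<beta> u \<bullet> t" if "low i u" "t \<in> Arr E" "Cod E t = Dom E x" for u t
      using E.comp_extend[OF \<gamma>(5), of t] E.comp_extend[OF \<beta>'(4)[OF that(1)], of t] that \<gamma>(1-3) \<beta>'(1-3) by simp
    have \<beta>Id: "app (Cod I u) (Id I (Cod I u)) (\<beta> u \<bullet> t) b = s u t b" if u: "low i u" and sp: "span i x u t b" for u t b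
      using app\<beta>[OF u, of "Id I (Cod I u)" t b] sp u lowD(1)[OF u] by simp
    \<comment> \<open>The condition that \<open>w_eq\<close> asks for is naturality of
      \<open>s\<close> along \<open>u\<close>, starting from its value at the identity.\<close>
    have "w1 \<bullet> \<alpha> = w2 \<bullet> \<gamma>"
    proof (rule w_eq[OF w1 w2 \<alpha>(1,3) \<gamma>(1,3), THEN iffD2])
      show "V \<bullet> \<alpha> = q1 \<bullet> \<gamma> \<and>
        (\<forall>t b u. dspan E fi (V \<bullet> \<alpha>) t b \<longrightarrow> low i u \<longrightarrow> FArr C u \<bullet> appV (\<alpha> \<bullet> t) b =
          app (Cod I u) (Id I (Cod I u)) (pr u \<bullet> (q2 \<bullet> (\<gamma> \<bullet> t))) (FArr B u \<bullet> b))"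
        unfolding \<alpha>(4) \<gamma>(4)
      proof (intro conjI refl allI impI)
        fix t b u assume d: "dspan E fi x t b" and u: "low i u"
        have u': "u \<in> Arr I" "Dom I u = i" using u by auto
        have t: "t \<in> Arr E" "Cod E t = Dom E x" using d by (simp_all add: dspan_def)
        have "FArr C u \<bullet> s (Id I i) t b = s u t (FArr B u \<bullet> b)"
          using sec_natural[OF sec, of "Id I i" t b u] id d u' by simp
        then show "FArr C u \<bullet> appV (\<alpha> \<bullet> t) b = 
          app (Cod I u) (Id I (Cod I u)) (pr u \<bullet> (q2 \<bullet> (\<gamma> \<bullet> t))) (FArr B u \<bullet> b)"
          unfolding app\<alpha>[OF d] \<gamma>\<beta>[OF u t] \<beta>Id[OF u span_dspan[OF x i d u']] .
      qed
    qed (use \<alpha> \<gamma> in simp)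
    then obtain h where h: "h \<in> Arr E" "Dom E h = Dom E x" "Cod E h = Dom E c" "a \<bullet> h = \<alpha>" "c \<bullet> h = \<gamma>"
      using E.pullback_lift[OF pb, of \<alpha> \<gamma>] \<alpha> \<gamma> W1 W2 ac by auto
    have Ph: "?P \<bullet> h = x" using h \<gamma> c by simp
    have "app' u (h \<bullet> t) b = s u t b" if sp: "span i x u t b" for u t b
    proof -
      note SS = spanD[OF sp]
      have ch: "c \<bullet> (h \<bullet> t) = \<gamma> \<bullet> t" "a \<bullet> (h \<bullet> t) = \<alpha> \<bullet> t"
        using E.comp_extend[OF h(5), of t] E.comp_extend[OF h(4), of t] h SS a ac c by simp_all
      show ?thesis
      proof (cases "low i u")
        case True
        then show ?thesis
          unfolding app'_def glue_def ch using \<gamma>\<beta>[OF True SS(3,5)] \<beta>Id[OF True sp] by simp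
      next
        case False
        note iu = inverse_facts[OF SS(1,2) False]
        \<comment> \<open>For invertible \<open>u\<close> the section \<open>s\<close> obeys the
          formula in \<open>glue\<close>: transport \<open>b\<close> back to the identity, evaluate
          there, and apply naturality along \<open>u\<close>.\<close>
        let ?b = "FArr B (inv_arr I u) \<bullet> b"
        have sp': "span i x (Id I i) t ?b"
          using span_natural[OF x sp iu(1)] iu by simp
        have "FArr B u \<bullet> ?b = b"
          using functor_comp_extend[OF Src_functor[OF f] iu(1) SS(1), of b] iu SS by simp
        then have "FArr C u \<bullet> s (Id I i) t ?b = s u t b"
          using sec_natural[OF sec sp' SS(1)] SS by simp
        then show ?thesis
          unfolding app'_def glue_def ch using False app\<alpha>[of t ?b] sp' id by simp
      qed
    qed
    then show "\<exists>h. h \<in> Arr E \<and> Dom E h = Dom E x \<and> Cod E h = Dom E ?P \<and> ?P \<bullet> h = x \<and>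
        (\<forall>u t b. span i x u t b \<longrightarrow> app' u (h \<bullet> t) b = s u t b)"
      using h Ph c by (intro exI[of _ h]) simp
  next
    fix h h' assume h: "h \<in> Arr E" "h' \<in> Arr E" "Dom E h = Dom E h'" "Cod E h = Dom E ?P" "Cod E h' = Dom E ?P"
      and over: "?P \<bullet> h = ?P \<bullet> h'"
      and eq: "\<And>u t b. span i (?P \<bullet> h) u t b \<Longrightarrow> app' u (h \<bullet> t) b = app' u (h' \<bullet> t) b"
    have hc: "Cod E h = Dom E c" "Cod E h' = Dom E c" using h x by simp_all
    have Ph: "?P \<bullet> h \<in> Arr E" "Cod E (?P \<bullet> h) = FObj A i" "Dom E (?P \<bullet> h) = Dom E h" using h(1) hc c by simp_all
    have Va2: "V \<bullet> (a \<bullet> h) = ?P \<bullet> h" "V \<bullet> (a \<bullet> h') = ?P \<bullet> h'"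
      using E.comp_extend[OF Va, of h] E.comp_extend[OF Va, of h'] a ac hc h(1,2) by simp_all
    have q1c: "q1 \<bullet> (c \<bullet> h) = ?P \<bullet> h" "q1 \<bullet> (c \<bullet> h') = ?P \<bullet> h'"
      using c hc h(1,2) by simp_all
    \<comment> \<open>Uniqueness is tested on the two legs of the pullback: on \<open>a\<close>
      through the identity component, on \<open>c\<close> through the components at degree-lowering
      arrows.\<close>
    have "a \<bullet> h = a \<bullet> h'"
    proof (rule E.dprod_ext[OF pow[OF i] Cmp_arr[OF g i], folded V_def])
      fix t b assume "dspan E fi (V \<bullet> (a \<bullet> h)) t b"
      then have d: "dspan E fi (?P \<bullet> h) t b" unfolding Va2 .
      have t: "t \<in> Arr E" "Cod E t = Dom E h" using d Ph by (simp_all add: dspan_def)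
      have d': "dspan E fi ?P (h \<bullet> t) b" "dspan E fi ?P (h' \<bullet> t) b"
        using d d[unfolded over] t h(1-3) hc c by (simp_all add: dspan_def)
      have "app' (Id I i) (h \<bullet> t) b = app' (Id I i) (h' \<bullet> t) b"
        by (rule eq) (use span_Id[OF Ph(1,2) i] d in simp)
      then show "appV (a \<bullet> h \<bullet> t) b = appV (a \<bullet> h' \<bullet> t) b"
        unfolding appId[OF d'(1)] appId[OF d'(2)] using t h(1-3) hc a ac by simp
    next
      show "V \<bullet> (a \<bullet> h) = V \<bullet> (a \<bullet> h')" unfolding Va2 over ..
    qed (use a ac hc h(1-3) in simp_all)
    moreover have "c \<bullet> h = c \<bullet> h'"
    proof (rule q_eqI)
      fix u assume u: "low i u"
      have u': "u \<in> Arr I" "Dom I u = i" using u by auto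
      have pp: "p (Cod I u) \<bullet> (pr u \<bullet> (q2 \<bullet> (c \<bullet> h))) = FArr A u \<bullet> (?P \<bullet> h)"
        "p (Cod I u) \<bullet> (pr u \<bullet> (q2 \<bullet> (c \<bullet> h'))) = FArr A u \<bullet> (?P \<bullet> h')"
        unfolding q1c[symmetric] by (rule p_pr[OF u]; use c hc h(1,2) in simp)+
      show "pr u \<bullet> (q2 \<bullet> (c \<bullet> h)) = pr u \<bullet> (q2 \<bullet> (c \<bullet> h'))"
      proof (rule ldp_eqI[OF ldp_low[OF u]])
        fix v t b assume "span (Cod I u) (p (Cod I u) \<bullet> (pr u \<bullet> (q2 \<bullet> (c \<bullet> h)))) v t b"
        then have v: "v \<in> Arr I" "Dom I v = Cod I u" and sp: "span i (?P \<bullet> h) (v \<star> u) t b"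
          unfolding pp using span_shift[OF Ph(1) _ u'(1), of v t b] Ph u' by auto
        have t: "t \<in> Arr E" "Cod E t = Dom E h" using spanD[OF sp] Ph by simp_all
        have sp': "span i ?P (v \<star> u) (h \<bullet> t) b" using sp span_comp[OF x(1,2) h(1)] hc x by simp
        have sp'': "span i ?P (v \<star> u) (h' \<bullet> t) b" using sp[unfolded over] span_comp[OF x(1,2) h(2)] hc x by simp
        show "app (Cod I u) v (pr u \<bullet> (q2 \<bullet> (c \<bullet> h)) \<bullet> t) b = app (Cod I u) v (pr u \<bullet> (q2 \<bullet> (c \<bullet> h')) \<bullet> t) b"
          using eq[OF sp] appLow[OF u v sp'] appLow[OF u v sp''] t h(1-3) hc c u by simp
      next
        show "p (Cod I u) \<bullet> (pr u \<bullet> (q2 \<bullet> (c \<bullet> h))) = p (Cod I u) \<bullet> (pr u \<bullet> (q2 \<bullet> (c \<bullet> h')))"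
          unfolding pp over ..
      qed (use u c hc h(1-3) in simp_all)
    next
      show "q1 \<bullet> (c \<bullet> h) = q1 \<bullet> (c \<bullet> h')" unfolding q1c over ..
    qed (use c hc h(1-3) in simp_all)
    ultimately show "h = h'"
      using E.pullback_eqI[OF pb h(1-3)] hc ac by simp
  qed
qed

text \<open>The converse reduces to \<open>pullback_ldp\<close>: the chosen pullback is a universal
  section as well, hence isomorphic to \<open>P\<close>, and the isomorphism carries its projections
  to \<open>a\<close> and \<open>c\<close> because maps into \<open>Dom E V\<close> and
  \<open>Dom E q1\<close> are determined by their values.\<close>

theorem ldp_pullback:
  assumes w1: "is_w1 w1" and w2: "is_w2 w2" and P: "ldp i P appP"
    and a: "a \<in> Arr E" "Dom E a = Dom E P" "Cod E a = Dom E V" "V \<bullet> a = P"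
      "\<And>t b. dspan E fi P t b \<Longrightarrow> appV (a \<bullet> t) b = appP (Id I i) t b"
    and c: "c \<in> Arr E" "Dom E c = Dom E P" "Cod E c = Dom E q1" "q1 \<bullet> c = P"
      "\<And>u v t b. low i u \<Longrightarrow> v \<in> Arr I \<Longrightarrow> Dom I v = Cod I u \<Longrightarrow> span i P (v \<star> u) t b \<Longrightarrow>
         app (Cod I u) v (pr u \<bullet> (q2 \<bullet> (c \<bullet> t))) b = appP (v \<star> u) t b"
  shows "is_pullback E w1 w2 a c"
proof -
  have W1: "w1 \<in> Arr E" "Dom E w1 = Dom E V" "Cod E w1 = Dom E W" and W2: "w2 \<in> Arr E" "Dom E w2 = Dom E q1" "Cod E w2 = Dom E W"
    using w1 w2 unfolding is_w1_def is_w2_def by blast+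
  define a' where "a' = pb1 E w1 w2"
  define c' where "c' = pb2 E w1 w2"
  have pb: "is_pullback E w1 w2 a' c'"
    unfolding a'_def c'_def by (rule E.chosen_pullback) (use W1 W2 in simp_all)
  note L = pullback_ldp[OF w1 w2 pb]
  note PB = E.is_pullbackD[OF pb]
  have x: "P \<in> Arr E" "Cod E P = FObj A i" using sec_arr[OF ldp_sec[OF P]] sec_cod[OF ldp_sec[OF P]] .
  have a': "a' \<in> Arr E" "Cod E a' = Dom E V" and c': "c' \<in> Arr E" "Cod E c' = Dom E q1" and ac: "Dom E a' = Dom E c'"
    using PB W1 W2 by simp_all
  define P' where "P' = q1 \<bullet> c'"
  have P': "P' \<in> Arr E" "Cod E P' = FObj A i" "Dom E P' = Dom E c'" using c' by (simp_all add: P'_def)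
  obtain h h' where inv: "are_inverse E h h'" "Dom E h = Dom E P" "Cod E h = Dom E P'" "P' \<bullet> h = P"
    and apph: "\<And>u t b. span i P u t b \<Longrightarrow> glue (\<lambda>t b. appV (a' \<bullet> t) b) c' u (h \<bullet> t) b = appP u t b"
    using ldp_iso[OF L(1) P] unfolding P'_def by blast
  have h: "h \<in> Arr E" "Cod E h = Dom E c'" using inv P' by (simp_all add: are_inverse_def)
  note L' = L(2-4)[folded P'_def]
  have q1c: "q1 \<bullet> (c' \<bullet> h) = P" using inv(4) h c' by (simp add: P'_def)
  have Va: "V \<bullet> (a' \<bullet> h) = P" using inv(4) E.comp_extend[OF L'(1), of h] h a' ac by simp
  have t: "t \<in> Arr E" "Cod E t = Dom E P" if "span i P u t b" for u t b using spanD[OF that] by simp_all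
  have sp': "span i P' u (h \<bullet> t) b" if "span i P u t b" for u t b
    using that span_comp[OF P'(1,2) h(1) inv(3)] inv(4) by simp
  have "a' \<bullet> h = a"
  proof (rule E.dprod_ext[OF pow[OF i] Cmp_arr[OF g i], folded V_def])
    fix t b assume "dspan E fi (V \<bullet> (a' \<bullet> h)) t b"
    then have d: "dspan E fi P t b" unfolding Va .
    then have s: "span i P (Id I i) t b" using span_Id[OF x i] by simp
    have d': "dspan E fi P' (h \<bullet> t) b" using sp'[OF s] span_Id[OF P'(1,2) i] by simp
    show "appV (a' \<bullet> h \<bullet> t) b = appV (a \<bullet> t) b"
      using L'(2)[OF d'] apph[OF s] a(5)[OF d] t[OF s] h a' ac inv(2) by simp
  qed (use a a' ac h Va inv(2) in simp_all)
  moreover have "c' \<bullet> h = c"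
  proof (rule q_eqI)
    fix u assume u: "low i u"
    have u': "u \<in> Arr I" "Dom I u = i" using u by auto
    have pp: "p (Cod I u) \<bullet> (pr u \<bullet> (q2 \<bullet> (c' \<bullet> h))) = FArr A u \<bullet> P"
      using p_pr[OF u, of "c' \<bullet> h"] q1c c' h by simp
    have pp': "p (Cod I u) \<bullet> (pr u \<bullet> (q2 \<bullet> c)) = FArr A u \<bullet> P"
      using p_pr[OF u, of c] c by simp
    show "pr u \<bullet> (q2 \<bullet> (c' \<bullet> h)) = pr u \<bullet> (q2 \<bullet> c)"
    proof (rule ldp_eqI[OF ldp_low[OF u]])
      fix v t' b assume "span (Cod I u) (p (Cod I u) \<bullet> (pr u \<bullet> (q2 \<bullet> (c' \<bullet> h)))) v t' b"
      then have v: "v \<in> Arr I" "Dom I v = Cod I u" and s: "span i P (v \<star> u) t' b"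
        unfolding pp using span_shift[OF x(1) _ u'(1), of v t' b] x u' by auto
      show "app (Cod I u) v (pr u \<bullet> (q2 \<bullet> (c' \<bullet> h)) \<bullet> t') b = app (Cod I u) v (pr u \<bullet> (q2 \<bullet> c) \<bullet> t') b"
        using L'(3)[OF u v sp'[OF s]] apph[OF s] c(5)[OF u v s] t[OF s] h c' c(1-3) u inv(2) by simp
    qed (use pp pp' u c c' h inv(2) in simp_all)
  qed (use c c' h inv(2) q1c in simp_all)
  ultimately show ?thesis
    using E.is_pullback_iso[OF pb inv(1)] h ac by simp
qed

end

section \<open>Right adjoints from universal arrows\<close>

text \<open>The adjoint sends \<open>k\<close> to the unique arrow making \<open>e\<close> natural,
  so naturality of the counit holds by construction and the functor laws by uniqueness.\<close>

lemma universal_arrows_right_adjoint: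
  fixes C :: "('o1, 'a1) cat" and D :: "('o2, 'a2) cat"
  assumes "category C" "category D" and F: "is_functor C D F"
    and R: "\<And>d. d \<in> Obj D \<Longrightarrow> R d \<in> Obj C"
    and e: "\<And>d. d \<in> Obj D \<Longrightarrow> e d \<in> hom D (FObj F (R d)) d"
    and uni: "\<And>d x k. d \<in> Obj D \<Longrightarrow> x \<in> Obj C \<Longrightarrow> k \<in> hom D (FObj F x) d \<Longrightarrow>
      \<exists>!h. h \<in> hom C x (R d) \<and> e d \<cdot>\<^bsub>D\<^esub> FArr F h = k"
  shows "\<exists>G. is_right_adjoint C D F G e"
proof -
  interpret C: category C by fact
  interpret D: category D by fact
  have e': "e d \<in> Arr D" "Dom D (e d) = FObj F (R d)" "Cod D (e d) = d" if "d \<in> Obj D" for d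
    using e[OF that] by (simp_all add: hom_def)
  have F': "FArr F h \<in> Arr D" "Dom D (FArr F h) = FObj F (Dom C h)" "Cod D (FArr F h) = FObj F (Cod C h)" if "h \<in> Arr C" for h
    using F that unfolding is_functor_def by (auto simp: hom_def)
  have FO: "FObj F x \<in> Obj D" "FArr F (Id C x) = Id D (FObj F x)" if "x \<in> Obj C" for x
    using F that unfolding is_functor_def by auto
  have Fc: "FArr F (h' \<cdot>\<^bsub>C\<^esub> h) = FArr F h' \<cdot>\<^bsub>D\<^esub> FArr F h" if "h \<in> Arr C" "h' \<in> Arr C" "Cod C h = Dom C h'" for h h'
    using F that unfolding is_functor_def by auto
  define Q where "Q k h \<longleftrightarrow> h \<in> hom C (R (Dom D k)) (R (Cod D k)) \<and> e (Cod D k) \<cdot>\<^bsub>D\<^esub> FArr F h = k \<cdot>\<^bsub>D\<^esub> e (Dom D k)" for k h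
  have exQ: "\<exists>!h. Q k h" if k: "k \<in> Arr D" for k
  proof -
    have "k \<cdot>\<^bsub>D\<^esub> e (Dom D k) \<in> hom D (FObj F (R (Dom D k))) (Cod D k)"
      using e' k by (simp add: hom_def)
    then show ?thesis unfolding Q_def using uni[of "Cod D k" "R (Dom D k)"] R k by simp
  qed
  define g where "g k = (THE h. Q k h)" for k
  have g: "Q k (g k)" if "k \<in> Arr D" for k
    unfolding g_def using theI'[OF exQ[OF that]] .
  have gU: "Q k h \<Longrightarrow> k \<in> Arr D \<Longrightarrow> g k = h" for k h
    using exQ[of k] g[of k] by blast
  have g': "g k \<in> Arr C" "Dom C (g k) = R (Dom D k)" "Cod C (g k) = R (Cod D k)"
    "e (Cod D k) \<cdot>\<^bsub>D\<^esub> FArr F (g k) = k \<cdot>\<^bsub>D\<^esub> e (Dom D k)" if "k \<in> Arr D" for k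
    using g[OF that] by (simp_all add: Q_def hom_def)
  define G where "G = \<lparr>FObj = R, FArr = g\<rparr>"
  have "is_functor D C G"
    unfolding is_functor_def
  proof (intro conjI ballI impI)
    fix x assume x: "x \<in> Obj D"
    show "FObj G x \<in> Obj C" using R[OF x] by (simp add: G_def)
    have "Q (Id D x) (Id C (R x))"
      unfolding Q_def using x R[OF x] FO[OF R[OF x]] e'[OF x] by (simp add: hom_def)
    then show "FArr G (Id D x) = Id C (FObj G x)"
      using gU x by (simp add: G_def)
  next
    fix u assume u: "u \<in> Arr D"
    show "FArr G u \<in> hom C (FObj G (Dom D u)) (FObj G (Cod D u))"
      using g'[OF u] by (simp add: G_def hom_def)
    fix v assume v: "v \<in> Arr D" "Cod D u = Dom D v"
    note gu = g'[OF u] and gv = g'[OF v(1)]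
    have "e (Cod D v) \<cdot>\<^bsub>D\<^esub> (FArr F (g v) \<cdot>\<^bsub>D\<^esub> FArr F (g u)) = v \<cdot>\<^bsub>D\<^esub> (e (Dom D v) \<cdot>\<^bsub>D\<^esub> FArr F (g u))"
      using D.comp_extend[OF gv(4), of "FArr F (g u)"] F'[OF gu(1)] F'[OF gv(1)] gu(1-3) gv(1-3) e' u v by simp
    also have "\<dots> = v \<cdot>\<^bsub>D\<^esub> u \<cdot>\<^bsub>D\<^esub> e (Dom D u)"
      using gu(4) v u e' by simp
    finally have "Q (v \<cdot>\<^bsub>D\<^esub> u) (g v \<cdot>\<^bsub>C\<^esub> g u)"
      unfolding Q_def using gu(1-3) gv(1-3) u v Fc[OF gu(1) gv(1)] by (simp add: hom_def)
    then show "FArr G (v \<cdot>\<^bsub>D\<^esub> u) = FArr G v \<cdot>\<^bsub>C\<^esub> FArr G u"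
      using gU u v by (simp add: G_def)
  qed
  moreover have "bij_betw (\<lambda>h. e d \<cdot>\<^bsub>D\<^esub> FArr F h) (hom C x (R d)) (hom D (FObj F x) d)"
    if x: "x \<in> Obj C" and d: "d \<in> Obj D" for x d
  proof (rule bij_betwI')
    fix h h' assume h: "h \<in> hom C x (R d)" "h' \<in> hom C x (R d)"
    have "e d \<cdot>\<^bsub>D\<^esub> FArr F h \<in> hom D (FObj F x) d"
      using h F' e'[OF d] by (auto simp: hom_def)
    from uni[OF d x this] h show "(e d \<cdot>\<^bsub>D\<^esub> FArr F h = e d \<cdot>\<^bsub>D\<^esub> FArr F h') = (h = h')" by metis
  next
    fix h assume "h \<in> hom C x (R d)"
    then show "e d \<cdot>\<^bsub>D\<^esub> FArr F h \<in> hom D (FObj F x) d"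
      using F' e'[OF d] by (auto simp: hom_def)
  next
    fix k assume "k \<in> hom D (FObj F x) d"
    from uni[OF d x this] show "\<exists>h\<in>hom C x (R d). k = e d \<cdot>\<^bsub>D\<^esub> FArr F h" by blast
  qed
  ultimately have "is_right_adjoint C D F G e"
    unfolding is_right_adjoint_def using F e g'(4) by (simp add: G_def)
  then show ?thesis ..
qed

section \<open>Existence of local dependent products\<close>

context dep_prod
begin

text \<open>The predicate \<open>K\<close> marks a class of objects, closed under arrows, on which
  universal sections are known. It is instantiated with the objects below a given degree during the
  induction and with all objects afterwards. The choice in \<open>h\<close> is harmless since
  transition maps are unique.\<close>

lemma transition_functor:
  assumes S: "\<And>j. j \<in> Obj I \<Longrightarrow> K j \<Longrightarrow> ldp j (p j) (app j)"
    and K: "\<And>u. u \<in> Arr I \<Longrightarrow> K (Dom I u) \<Longrightarrow> K (Cod I u)"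
  defines "h u \<equiv> (SOME h. transition p app u h)"
  shows "u \<in> Arr I \<Longrightarrow> K (Dom I u) \<Longrightarrow> transition p app u (h u)"
    and "i \<in> Obj I \<Longrightarrow> K i \<Longrightarrow> h (Id I i) = Id E (Dom E (p i))"
    and "u \<in> Arr I \<Longrightarrow> v \<in> Arr I \<Longrightarrow> K (Dom I u) \<Longrightarrow> Cod I u = Dom I v \<Longrightarrow> h (v \<star> u) = h v \<bullet> h u"
proof -
  show t: "transition p app u (h u)" if u: "u \<in> Arr I" "K (Dom I u)" for u
    unfolding h_def by (rule someI_ex[OF transition_ex[OF u(1)]]) (use S K u in simp_all)
  have uni: "h u = k" if "u \<in> Arr I" "K (Dom I u)" "transition p app u k" for u k
    by (rule transition_unique[OF that(1) _ _ t[OF that(1,2)] that(3)]) (use S K that ldp_sec in auto)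
  show "h (Id I i) = Id E (Dom E (p i))" if i: "i \<in> Obj I" "K i"
    by (rule uni) (use i transition_Id[OF i(1), of p app] ldp_sec[OF S[OF i]] in simp_all)
  show "h (v \<star> u) = h v \<bullet> h u" if uv: "u \<in> Arr I" "v \<in> Arr I" "K (Dom I u)" "Cod I u = Dom I v"
  proof (rule uni)
    have Kc: "K (Cod I u)" "K (Dom I v)" "K (Cod I v)" using K[of u] K[of v] uv by simp_all
    show "transition p app (v \<star> u) (h v \<bullet> h u)"
      by (rule transition_comp) (use uv Kc t S ldp_sec in simp_all)
  qed (use uv in simp_all)
qed

text \<open>Only existence at each object passes through the induction. Universal sections at all
  objects below \<open>i\<close> are chosen afresh in the step, and the transition maps between them
  are then determined.\<close>

lemma ldp_ex: "i \<in> Obj I \<Longrightarrow> \<exists>p app. ldp i p app"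
proof (induction "deg i" arbitrary: i rule: less_induct)
  case less
  define pa where "pa j = (SOME r. ldp j (fst r) (snd r))" for j
  have ldp: "ldp j (fst (pa j)) (snd (pa j))" if j: "j \<in> Obj I" "deg j < deg i" for j
  proof -
    obtain p app where "ldp j p app" using less(1)[OF j(2,1)] by blast
    then have "ldp j (fst (p, app)) (snd (p, app))" by simp
    then show ?thesis unfolding pa_def by (rule someI)
  qed
  define p where "p j = fst (pa j)" for j
  define app where "app j = snd (pa j)" for j
  have l: "ldp j (p j) (app j)" if "j \<in> Obj I" "deg j < deg i" for j
    using ldp[OF that] by (simp add: p_def app_def)
  \<comment> \<open>On arrows out of objects that are not below \<open>deg i\<close> the choice may
    be arbitrary; \<open>low_functor\<close> never looks at them.\<close>
  define X where "X = \<lparr>FObj = (\<lambda>j. Dom E (p j)), FArr = (\<lambda>u. SOME h. transition p app u h)\<rparr>"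
  have cod: "deg (Cod I u) < deg i" if "u \<in> Arr I" "deg (Dom I u) < deg i" for u
    using deg_le[OF that(1)] that(2) by simp
  note tf = transition_functor[of "\<lambda>j. deg j < deg i" p app, OF l cod]
  have tr: "transition p app u (FArr X u)" if "u \<in> Arr I" "deg (Dom I u) < deg i" for u
    using that by (simp add: X_def tf(1))
  have lf: "low_functor i X"
    unfolding low_functor_def
  proof (intro conjI ballI impI)
    fix j assume j: "j \<in> Obj I" "deg j < deg i"
    show "FObj X j \<in> Obj E" using sec_arr[OF ldp_sec[OF l[OF j]]] by (simp add: X_def)
    show "FArr X (Id I j) = Id E (FObj X j)" using j by (simp add: X_def tf(2))
  next
    fix u assume u: "u \<in> Arr I" "deg (Dom I u) < deg i"
    show "FArr X u \<in> Arr E" "Dom E (FArr X u) = FObj X (Dom I u)" "Cod E (FArr X u) = FObj X (Cod I u)"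
      using transitionD(1-3)[OF tr[OF u]] by (simp_all add: X_def)
  next
    fix u v assume "u \<in> Arr I" "v \<in> Arr I" "deg (Dom I u) < deg i" "Cod I u = Dom I v"
    then show "FArr X (v \<star> u) = FArr X v \<bullet> FArr X u"
      by (simp add: X_def tf(3))
  qed
  interpret S: dep_prod_step I E deg f g i X p app
    by unfold_locales (use less(2) lf l tr in \<open>simp_all add: X_def\<close>)
  obtain w where w: "S.is_w2 w" using S.w2_ex by blast
  let ?w = "Pi_gap_map I deg E i f g"
  have W: "?w \<in> Arr E" "Cod E ?w = Dom E S.W" "w \<in> Arr E" "Cod E w = Dom E S.W"
    using S.is_w1_gap w unfolding S.is_w1_def S.is_w2_def by blast+
  have "is_pullback E ?w w (pb1 E ?w w) (pb2 E ?w w)"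
    by (rule E.chosen_pullback) (use W in simp_all)
  from S.pullback_ldp(1)[OF S.is_w1_gap w this] show ?case by blast
qed

end

section \<open>Pointwise dependent products in the functor category\<close>

context dep_prod
begin

text \<open>Universality passes along an isomorphism. This is applied with an identity, merely to
  present the same section as \<open>ksec\<close>, and with the components of an isomorphism between
  two universal arrows of the functor category.\<close>

lemma ldp_transport:
  assumes p: "ldp i p app" and h: "are_inverse E h h'" "Cod E h = Dom E p" "p \<bullet> h = p'"
    and s: "sec i p' app'" and eq: "\<And>u t b. span i p' u t b \<Longrightarrow> app u (h \<bullet> t) b = app' u t b"
  shows "ldp i p' app'"
proof (rule ldpI[OF s])
  have H: "h \<in> Arr E" "h' \<in> Arr E" "Dom E h' = Dom E p" "Cod E h' = Dom E h" "h \<bullet> h' = Id E (Dom E p)" "h' \<bullet> h = Id E (Dom E h)"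
    using h by (auto simp: are_inverse_def hom_def)
  note x = sec_arr[OF ldp_sec[OF p]] sec_cod[OF ldp_sec[OF p]] and x' = sec_arr[OF s] sec_cod[OF s]
  have Dp': "Dom E p' = Dom E h" using h(3)[symmetric] H(1) h(2) x by simp
  {
    fix y s assume sec: "sec i y s"
    obtain k where k: "k \<in> Arr E" "Dom E k = Dom E y" "Cod E k = Dom E p" "p \<bullet> k = y"
      "\<And>u t b. span i y u t b \<Longrightarrow> app u (k \<bullet> t) b = s u t b"
      using ldp_lift[OF p sec] by blast
    have hk: "h \<bullet> (h' \<bullet> k) = k" using E.comp_extend[OF H(5), of k] H(1-4) h k(1-3) by simp
    have pk: "p' \<bullet> (h' \<bullet> k) = y"
      using E.comp_extend[OF h(3), of "h' \<bullet> k"] hk k H(1-4) h(2) x by simp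
    have "app' u ((h' \<bullet> k) \<bullet> t) b = s u t b" if sp: "span i y u t b" for u t b
    proof -
      have t: "t \<in> Arr E" "Cod E t = Dom E k" using spanD[OF sp] k by simp_all
      have "span i p' u ((h' \<bullet> k) \<bullet> t) b"
      proof -
        have c: "h' \<bullet> k \<in> Arr E" "Cod E (h' \<bullet> k) = Dom E p'"
          using H(1-4) k(1-3) Dp' by simp_all
        have "span i (p' \<bullet> (h' \<bullet> k)) u t b" unfolding pk by (rule sp)
        then show ?thesis using span_comp[OF x' c] by blast
      qed
      from eq[OF this] have "app' u ((h' \<bullet> k) \<bullet> t) b = app u (h \<bullet> ((h' \<bullet> k) \<bullet> t)) b" ..
      also have "h \<bullet> ((h' \<bullet> k) \<bullet> t) = k \<bullet> t"
        using E.comp_extend[OF hk, of t] t H(1-4) k(1-3) h(2) by simp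
      finally show ?thesis using k(5)[OF sp] by simp
    qed
    then show "\<exists>h. h \<in> Arr E \<and> Dom E h = Dom E y \<and> Cod E h = Dom E p' \<and> p' \<bullet> h = y \<and>
        (\<forall>u t b. span i y u t b \<longrightarrow> app' u (h \<bullet> t) b = s u t b)"
      using pk k(1-3) H(1-4) Dp' by (intro exI[of _ "h' \<bullet> k"]) simp
  next
    fix k k' assume k: "k \<in> Arr E" "k' \<in> Arr E" "Dom E k = Dom E k'" "Cod E k = Dom E p'" "Cod E k' = Dom E p'"
      and over: "p' \<bullet> k = p' \<bullet> k'"
      and app: "\<And>u t b. span i (p' \<bullet> k) u t b \<Longrightarrow> app' u (k \<bullet> t) b = app' u (k' \<bullet> t) b"
    have ck: "Cod E k = Dom E h" "Cod E k' = Dom E h" using k Dp' by simp_all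
    have pk: "p \<bullet> (h \<bullet> k) = p' \<bullet> k" "p \<bullet> (h \<bullet> k') = p' \<bullet> k'"
      using E.comp_extend[OF h(3), of k] E.comp_extend[OF h(3), of k'] ck k(1,2) H(1) h(2) x by simp_all
    have "h \<bullet> k = h \<bullet> k'"
    proof (rule ldp_eqI[OF p])
      show "p \<bullet> (h \<bullet> k) = p \<bullet> (h \<bullet> k')" unfolding pk over ..
      fix u t b assume "span i (p \<bullet> (h \<bullet> k)) u t b"
      then have sp: "span i (p' \<bullet> k) u t b" unfolding pk .
      have t: "t \<in> Arr E" "Cod E t = Dom E k" using spanD[OF sp] x' k(1,4) by simp_all
      have s1: "span i p' u (k \<bullet> t) b" using sp span_comp[OF x' k(1,4)] by simp
      have s2: "span i p' u (k' \<bullet> t) b" using sp[unfolded over] span_comp[OF x' k(2,5)] by simp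
      show "app u (h \<bullet> k \<bullet> t) b = app u (h \<bullet> k' \<bullet> t) b"
        using eq[OF s1] eq[OF s2] app[OF sp] t k(1-3) ck H(1) by simp
    qed (use k(1-3) ck H(1) h(2) in simp_all)
    then have "h' \<bullet> (h \<bullet> k) = h' \<bullet> (h \<bullet> k')" by simp
    then show "k = k'"
      using E.comp_extend[OF H(6), of k] E.comp_extend[OF H(6), of k'] H(1-4) h(2) ck k(1,2) by simp
  }
qed

section \<open>Generalised elements of pullbacks along \<open>f\<close> in the functor
  category\<close>

definition over :: "('i, 'u, 'o, 'a) nat_trans \<Rightarrow> bool" where
  "over x \<longleftrightarrow> x \<in> Arr FC \<and> Tgt x = A"

abbreviation "P1 \<equiv> pb1 FC f"
abbreviation "P2 \<equiv> pb2 FC f"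

lemma pbs_f [simp]: "has_pullbacks_along FC f"
  by (simp add: has_pullbacks_along_FC)

lemma over_simps [simp]:
  assumes "over x"
  shows "x \<in> Arr FC" "Tgt x = A" "P1 x \<in> Arr FC" "P2 x \<in> Arr FC" "Src (P2 x) = Src (P1 x)"
    "Tgt (P1 x) = B" "Tgt (P2 x) = Src x"
  using assms FC.cod_pb1[of f x] FC.cod_pb2[of f x] FC.dom_pb2[of f x] unfolding over_def by simp_all

lemma pb_over:
  assumes "over x"
  shows "is_pullback FC f x (P1 x) (P2 x)"
  by (rule FC.chosen_pullback) (use assms in simp_all)

text \<open>The element of the chosen pullback at \<open>j\<close> with projections \<open>b\<close>
  and \<open>y\<close>. It is written with \<open>eval_pb_iso\<close> so that the values of the
  transpose in \<open>Pi_proj_dprod\<close> take this form directly.\<close>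

definition med :: "('i, 'u, 'o, 'a) nat_trans \<Rightarrow> 'i \<Rightarrow> 'a \<Rightarrow> 'a \<Rightarrow> 'a" where
  "med x j b y = eval_pb_iso I E j f x \<bullet> pb_pair E (Cmp f j) (Cmp x j) b y"

lemma med:
  assumes x: "over x" and j: "j \<in> Obj I" and d: "dspan E (Cmp f j) (Cmp x j) y b"
  shows "med x j b y \<in> Arr E" "Dom E (med x j b y) = Dom E y" "Cod E (med x j b y) = FObj (Src (P1 x)) j"
    "Cmp (P1 x) j \<bullet> med x j b y = b" "Cmp (P2 x) j \<bullet> med x j b y = y"
  using E.comparison_inverse[OF Cmp_pullback[OF pb_over[OF x] j], of b y] d x j
  unfolding med_def eval_pb_iso_def dspan_def by simp_all

lemma med_unique:
  assumes x: "over x" and j: "j \<in> Obj I" and m: "m \<in> Arr E" "Cod E m = FObj (Src (P1 x)) j"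
    "Cmp (P1 x) j \<bullet> m = b" "Cmp (P2 x) j \<bullet> m = y"
  shows "med x j b y = m"
proof -
  note PB = Cmp_pullback[OF pb_over[OF x] j]
  have "dspan E (Cmp f j) (Cmp x j) (Cmp (P2 x) j \<bullet> m) (Cmp (P1 x) j \<bullet> m)"
    using E.comp_extend[OF E.is_pullbackD(8)[OF PB], of m] x j m(1,2) by (simp add: dspan_def)
  note M = med[OF x j this[unfolded m(3,4)]]
  have "Dom E y = Dom E m" unfolding m(4)[symmetric] using m(1,2) x j by simp
  show ?thesis
    by (rule E.pullback_eqI[OF PB]) (use M m x j \<open>Dom E y = Dom E m\<close> in simp_all)
qed

text \<open>The sections given by a map \<open>k : B \<times> X \<rightarrow> C\<close> over \<open>B\<close>.\<close>

definition ksec :: "('i, 'u, 'o, 'a) nat_trans \<Rightarrow> ('i, 'u, 'o, 'a) nat_trans \<Rightarrow> 'u \<Rightarrow> 'a \<Rightarrow> 'a \<Rightarrow> 'a" where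
  "ksec x k u t b = Cmp k (Cod I u) \<bullet> med x (Cod I u) b (FArr (Src x) u \<bullet> t)"

definition over_pb :: "('i, 'u, 'o, 'a) nat_trans \<Rightarrow> ('i, 'u, 'o, 'a) nat_trans \<Rightarrow> bool" where
  "over_pb x k \<longleftrightarrow> k \<in> Arr FC \<and> Src k = Src (P1 x) \<and> Tgt k = C \<and> g \<cdot>\<^bsub>FC\<^esub> k = P1 x"

lemma over_pb_simps [simp]:
  assumes "over_pb x k"
  shows "k \<in> Arr FC" "Src k = Src (P1 x)" "Tgt k = C"
  using assms unfolding over_pb_def by blast+

lemma over_pb_Cmp: "over_pb x k \<Longrightarrow> j \<in> Obj I \<Longrightarrow> Cmp g j \<bullet> Cmp k j = Cmp (P1 x) j"
  unfolding over_pb_def using Cmp_Comp by metis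

lemma span_eval:
  assumes x: "over x" and sp: "span i (Cmp x i) u t b"
  shows "dspan E (Cmp f (Cod I u)) (Cmp x (Cod I u)) (FArr (Src x) u \<bullet> t) b"
proof -
  note S = spanD[OF sp]
  have i: "i \<in> Obj I" using S(1,2) by auto
  show ?thesis
    using S x i naturality_extend[of x u t] by (simp add: dspan_def)
qed

lemma span_P:
  assumes x: "over x" and i: "i \<in> Obj I"
  shows "span i (Cmp x i) (Id I i) (Cmp (P2 x) i) (Cmp (P1 x) i)"
  using E.is_pullbackD(8)[OF Cmp_pullback[OF pb_over[OF x] i]] x i by (simp add: span_def)

text \<open>At the generic span, formed by the two projections, the mediating arrow is an identity.
  Thus \<open>k\<close> can be read off from its sections, which gives
  \<open>ksec_inj\<close>.\<close>

lemma ksec_Id: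
  assumes x: "over x" and i: "i \<in> Obj I" and k: "over_pb x k"
  shows "ksec x k (Id I i) (Cmp (P2 x) i) (Cmp (P1 x) i) = Cmp k i"
  using med_unique[OF x i, of "Id E (FObj (Src (P1 x)) i)"] x i k by (simp add: ksec_def)

lemma ksec_inj:
  assumes x: "over x" and k: "over_pb x k" "over_pb x k'"
    and eq: "\<And>i u t b. i \<in> Obj I \<Longrightarrow> span i (Cmp x i) u t b \<Longrightarrow> ksec x k u t b = ksec x k' u t b"
  shows "k = k'"
proof (rule FC_eqI)
  fix i assume i: "i \<in> Obj I"
  show "Cmp k i = Cmp k' i"
    using eq[OF i span_P[OF x i]] ksec_Id[OF x i k(1)] ksec_Id[OF x i k(2)] by simp
qed (use k in simp_all)

lemma ksec_sec:
  assumes x: "over x" and k: "over_pb x k" and i: "i \<in> Obj I"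
  shows "sec i (Cmp x i) (ksec x k)"
proof (rule secI)
  show "Cmp x i \<in> Arr E" "Cod E (Cmp x i) = FObj A i" using x i by simp_all
  fix u t b assume sp: "span i (Cmp x i) u t b"
  note S = spanD[OF sp]
  have j: "Cod I u \<in> Obj I" using S by simp
  note d = span_eval[OF x sp]
  note M = med[OF x j d]
  have t: "Dom E (FArr (Src x) u \<bullet> t) = Dom E t" using S x i by simp
  show "ksec x k u t b \<in> Arr E" "Dom E (ksec x k u t b) = Dom E t" "Cod E (ksec x k u t b) = FObj C (Cod I u)"
    unfolding ksec_def using M t k j by simp_all
  show "Cmp g (Cod I u) \<bullet> ksec x k u t b = b"
    unfolding ksec_def using E.comp_extend[OF over_pb_Cmp[OF k j]] M k j by simp
  show "ksec x k u (t \<bullet> r) (b \<bullet> r) = ksec x k u t b \<bullet> r" if r: "r \<in> Arr E" "Cod E r = Dom E t" for r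
  proof -
    have "med x (Cod I u) (b \<bullet> r) (FArr (Src x) u \<bullet> (t \<bullet> r)) = med x (Cod I u) b (FArr (Src x) u \<bullet> t) \<bullet> r"
      by (rule med_unique[OF x j])
        (use M t r j x i S E.comp_extend[OF M(4), of r] E.comp_extend[OF M(5), of r] in simp_all)
    then show ?thesis unfolding ksec_def using M t r k j by simp
  qed
  show "FArr C v \<bullet> ksec x k u t b = ksec x k (v \<star> u) t (FArr B v \<bullet> b)" if v: "v \<in> Arr I" "Dom I v = Cod I u" for v
  proof -
    let ?m = "med x (Cod I u) b (FArr (Src x) u \<bullet> t)"
    have "med x (Cod I v) (FArr B v \<bullet> b) (FArr (Src x) (v \<star> u) \<bullet> t) = FArr (Src (P1 x)) v \<bullet> ?m"
    proof (rule med_unique[OF x])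
      show "Cmp (P1 x) (Cod I v) \<bullet> (FArr (Src (P1 x)) v \<bullet> ?m) = FArr B v \<bullet> b"
        using naturality_extend[of "P1 x" v ?m] M v x by simp
      show "Cmp (P2 x) (Cod I v) \<bullet> (FArr (Src (P1 x)) v \<bullet> ?m) = FArr (Src x) (v \<star> u) \<bullet> t"
        using naturality_extend[of "P2 x" v ?m] M v x S i by simp
    qed (use M v x in simp_all)
    then show ?thesis
      unfolding ksec_def using naturality_extend[of k v ?m] M v x S k by simp
  qed
qed

section \<open>Transposition against a candidate counit\<close>

definition hom_over :: "('i, 'u, 'o, 'a) nat_trans \<Rightarrow> ('i, 'u, 'o, 'a) nat_trans \<Rightarrow> ('i, 'u, 'o, 'a) nat_trans \<Rightarrow> bool" where
  "hom_over x N h \<longleftrightarrow> h \<in> Arr FC \<and> Src h = Src x \<and> Tgt h = Src N \<and> N \<cdot>\<^bsub>FC\<^esub> h = x"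

lemma hom_overD:
  assumes "hom_over x N h"
  shows "h \<in> Arr FC" "Src h = Src x" "Tgt h = Src N" "N \<cdot>\<^bsub>FC\<^esub> h = x" 
    "i \<in> Obj I \<Longrightarrow> Cmp N i \<bullet> Cmp h i = Cmp x i"
  using assms Cmp_Comp unfolding hom_over_def by metis+

text \<open>The transpose of \<open>h : X \<rightarrow> N\<close> under the would-be counit \<open>e\<close>.\<close>

definition uncurry :: "('i, 'u, 'o, 'a) nat_trans \<Rightarrow> ('i, 'u, 'o, 'a) nat_trans \<Rightarrow> ('i, 'u, 'o, 'a) nat_trans \<Rightarrow>
   ('i, 'u, 'o, 'a) nat_trans \<Rightarrow> ('i, 'u, 'o, 'a) nat_trans" where
  "uncurry N e x h = e \<cdot>\<^bsub>FC\<^esub> pb_pair FC f N (P1 x) (h \<cdot>\<^bsub>FC\<^esub> P2 x)"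

text \<open>The induced arrow between the two pullbacks carries the mediating arrow for
  \<open>x\<close> to the one for \<open>N\<close>. Hence evaluating the section of \<open>e\<close>
  at the image of an element under \<open>h\<close> is evaluating the section of the transpose of
  \<open>h\<close>.\<close>

lemma uncurry:
  assumes N: "over N" and e: "over_pb N e" and x: "over x" and h: "hom_over x N h"
  shows uncurry_over: "over_pb x (uncurry N e x h)"
    and ksec_uncurry: "i \<in> Obj I \<Longrightarrow> span i (Cmp x i) u t b \<Longrightarrow>
      ksec N e u (Cmp h i \<bullet> t) b = ksec x (uncurry N e x h) u t b"
proof -
  note H = hom_overD[OF h]
  let ?q = "pb_pair FC f N (P1 x) (h \<cdot>\<^bsub>FC\<^esub> P2 x)"
  have pre: "Cod FC x = Cod FC f" "Cod FC N = Cod FC f" "Dom FC h = Dom FC x" "Cod FC h = Dom FC N"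
    using H(2,3) x N by simp_all
  note q = FC.pb_map[OF f pbs_f over_simps(1)[OF x] pre(1) over_simps(1)[OF N] pre(2) H(1) pre(3,4) H(4), unfolded Dom_FC Cod_FC]
  have ge: "g \<cdot>\<^bsub>FC\<^esub> e = P1 N" using e unfolding over_pb_def by blast
  have "g \<cdot>\<^bsub>FC\<^esub> (e \<cdot>\<^bsub>FC\<^esub> ?q) = P1 x"
    using FC.comp_extend[OF ge, of ?q] q e N by simp
  then show "over_pb x (uncurry N e x h)"
    unfolding over_pb_def uncurry_def using q e by simp
  assume i: "i \<in> Obj I" and sp: "span i (Cmp x i) u t b"
  note S = spanD[OF sp]
  have j: "Cod I u \<in> Obj I" using S by simp
  note M = med[OF x j span_eval[OF x sp]]
  let ?j = "Cod I u" and ?m = "med x (Cod I u) b (FArr (Src x) u \<bullet> t)"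
  have q': "Cmp (P1 N) ?j \<bullet> Cmp ?q ?j = Cmp (P1 x) ?j" "Cmp (P2 N) ?j \<bullet> Cmp ?q ?j = Cmp h ?j \<bullet> Cmp (P2 x) ?j"
    using arg_cong[OF q(4), of "\<lambda>s. Cmp s ?j"] arg_cong[OF q(5), of "\<lambda>s. Cmp s ?j"] j by simp_all
  have "med N ?j b (FArr (Src N) u \<bullet> (Cmp h i \<bullet> t)) = Cmp ?q ?j \<bullet> ?m"
  proof (rule med_unique[OF N j])
    show "Cmp (P1 N) ?j \<bullet> (Cmp ?q ?j \<bullet> ?m) = b"
      using E.comp_extend[OF q'(1), of ?m] M q j N x by simp
    show "Cmp (P2 N) ?j \<bullet> (Cmp ?q ?j \<bullet> ?m) = FArr (Src N) u \<bullet> (Cmp h i \<bullet> t)"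
      using E.comp_extend[OF q'(2), of ?m] M q(1-3) j N x H(1-3) naturality_extend[OF H(1) S(1), of t] S i by simp
  qed (use M q j in simp_all)
  then show "ksec N e u (Cmp h i \<bullet> t) b = ksec x (uncurry N e x h) u t b"
    unfolding ksec_def uncurry_def using j M q(1-3) e by simp
qed

text \<open>Phrased through \<open>ksec\<close>, universality at every object can be asked of any
  \<open>N\<close> with a candidate counit \<open>e\<close>, whether it was constructed from local
  data or comes from an arbitrarily chosen adjoint.\<close>

definition pointwise :: "('i, 'u, 'o, 'a) nat_trans \<Rightarrow> ('i, 'u, 'o, 'a) nat_trans \<Rightarrow> bool" where
  "pointwise N e \<longleftrightarrow> over N \<and> over_pb N e \<and> (\<forall>i\<in>Obj I. ldp i (Cmp N i) (ksec N e))"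

lemma pointwise_unique:
  assumes N: "pointwise N e" and x: "over x" and h: "hom_over x N h" "hom_over x N h'"
    and eq: "uncurry N e x h = uncurry N e x h'"
  shows "h = h'"
proof (rule FC_eqI)
  have N': "over N" "over_pb N e" using N by (simp_all add: pointwise_def)
  note H = hom_overD[OF h(1)] and H' = hom_overD[OF h(2)]
  fix i assume i: "i \<in> Obj I"
  then have l: "ldp i (Cmp N i) (ksec N e)" using N by (simp add: pointwise_def)
  show "Cmp h i = Cmp h' i"
  proof (rule ldp_eqI[OF l])
    fix u t b assume "span i (Cmp N i \<bullet> Cmp h i) u t b"
    then have "span i (Cmp x i) u t b" using H(5)[OF i] by simp
    then show "ksec N e u (Cmp h i \<bullet> t) b = ksec N e u (Cmp h' i \<bullet> t) b"
      using ksec_uncurry[OF N' x h(1) i] ksec_uncurry[OF N' x h(2) i] eq by simp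
  qed (use H H' i x N' in simp_all)
qed (use hom_overD[OF h(1)] hom_overD[OF h(2)] in simp_all)

lemma ksec_shift:
  assumes x: "over x" and w: "w \<in> Arr I" "v \<in> Arr I" "Dom I v = Cod I w" and t: "t \<in> Arr E" "Cod E t = FObj (Src x) (Dom I w)"
  shows "ksec x k v (FArr (Src x) w \<bullet> t) b = ksec x k (v \<star> w) t b"
  unfolding ksec_def using assms by simp

text \<open>The components of the transpose exist by universality at each object. They are natural
  because the two ways around the square at \<open>u\<close> represent the same section, the
  restriction along \<open>u\<close> of the section belonging to \<open>k\<close>.\<close>

lemma pointwise_lift:
  assumes N: "pointwise N e" and x: "over x" and k: "over_pb x k"
  shows "\<exists>h. hom_over x N h \<and> uncurry N e x h = k"
proof -
  have N': "over N" "over_pb N e" using N by (simp_all add: pointwise_def)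
  have l: "ldp i (Cmp N i) (ksec N e)" if "i \<in> Obj I" for i using N that by (simp add: pointwise_def)
  define Q where "Q i h \<longleftrightarrow> h \<in> Arr E \<and> Dom E h = FObj (Src x) i \<and> Cod E h = FObj (Src N) i \<and> Cmp N i \<bullet> h = Cmp x i \<and>
     (\<forall>u t b. span i (Cmp x i) u t b \<longrightarrow> ksec N e u (h \<bullet> t) b = ksec x k u t b)" for i h
  have exQ: "\<exists>h. Q i h" if i: "i \<in> Obj I" for i
    using ldp_lift[OF l[OF i] ksec_sec[OF x k i]] i x N' unfolding Q_def by (metis Dom_Cmp over_simps(1))
  define h where "h i = (SOME h. Q i h)" for i
  have h: "h i \<in> Arr E" "Dom E (h i) = FObj (Src x) i" "Cod E (h i) = FObj (Src N) i" "Cmp N i \<bullet> h i = Cmp x i"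
    and app: "\<And>u t b. span i (Cmp x i) u t b \<Longrightarrow> ksec N e u (h i \<bullet> t) b = ksec x k u t b" if "i \<in> Obj I" for i
    using someI_ex[OF exQ[OF that], folded h_def] unfolding Q_def by blast+
  define hh where "hh = mk_nat (Src x) (Src N) h"
  have nat: "FArr (Src N) u \<bullet> h (Dom I u) = h (Cod I u) \<bullet> FArr (Src x) u" if u: "u \<in> Arr I" for u
  proof -
    have ij: "Dom I u \<in> Obj I" "Cod I u \<in> Obj I" using u by simp_all
    note hi = h[OF ij(1)] and hj = h[OF ij(2)]
    have o1: "Cmp N (Cod I u) \<bullet> (FArr (Src N) u \<bullet> h (Dom I u)) = FArr A u \<bullet> Cmp x (Dom I u)"
      using naturality_extend[of N u "h (Dom I u)"] N' u hi by simp
    have o2: "Cmp N (Cod I u) \<bullet> (h (Cod I u) \<bullet> FArr (Src x) u) = FArr A u \<bullet> Cmp x (Dom I u)"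
      using E.comp_extend[OF hj(4), of "FArr (Src x) u"] naturality[of x u] x N' u hj(1-3) by simp
    show ?thesis
    proof (rule ldp_eqI[OF l[OF ij(2)]])
      fix v t b assume "span (Cod I u) (Cmp N (Cod I u) \<bullet> (FArr (Src N) u \<bullet> h (Dom I u))) v t b"
      then have v: "v \<in> Arr I" "Dom I v = Cod I u" and sp: "span (Dom I u) (Cmp x (Dom I u)) (v \<star> u) t b"
        unfolding o1 using span_shift[of "Cmp x (Dom I u)" u v t b] x u by auto
      have t: "t \<in> Arr E" "Cod E t = FObj (Src x) (Dom I u)" using spanD[OF sp] x u by simp_all
      have sp': "span (Cod I u) (Cmp x (Cod I u)) v (FArr (Src x) u \<bullet> t) b"
        using spanD[OF sp] v u x t naturality_extend[of x u t] by (simp add: span_def)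
      have "ksec N e v (FArr (Src N) u \<bullet> (h (Dom I u) \<bullet> t)) b = ksec N e (v \<star> u) (h (Dom I u) \<bullet> t) b"
        by (rule ksec_shift) (use N' u v t hi in simp_all)
      also have "\<dots> = ksec x k v (FArr (Src x) u \<bullet> t) b"
        using app[OF ij(1) sp] ksec_shift[OF x u v t] by simp
      also have "\<dots> = ksec N e v (h (Cod I u) \<bullet> (FArr (Src x) u \<bullet> t)) b"
        using app[OF ij(2) sp'] by simp
      finally show "ksec N e v (FArr (Src N) u \<bullet> h (Dom I u) \<bullet> t) b = ksec N e v (h (Cod I u) \<bullet> FArr (Src x) u \<bullet> t) b"
        using N' u t hi hj x by simp
    next
      show "Cmp N (Cod I u) \<bullet> (FArr (Src N) u \<bullet> h (Dom I u)) = Cmp N (Cod I u) \<bullet> (h (Cod I u) \<bullet> FArr (Src x) u)"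
        unfolding o1 o2 ..
    qed (use N' u hi hj x in simp_all)
  qed
  have hh: "hh \<in> Arr FC"
    unfolding hh_def by (rule mk_nat_arr) (use x N' h nat in simp_all)
  have ho: "hom_over x N hh"
    unfolding hom_over_def
  proof (intro conjI)
    show "N \<cdot>\<^bsub>FC\<^esub> hh = x"
      by (rule FC_eqI) (use hh N' x h in \<open>simp_all add: hh_def\<close>)
  qed (use hh in \<open>simp_all add: hh_def\<close>)
  have "uncurry N e x hh = k"
  proof (rule ksec_inj[OF x uncurry_over[OF N' x ho] k])
    fix i u t b assume i: "i \<in> Obj I" and sp: "span i (Cmp x i) u t b"
    show "ksec x (uncurry N e x hh) u t b = ksec x k u t b"
      using ksec_uncurry[OF N' x ho i sp] app[OF i sp] i by (simp add: hh_def)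
  qed
  with ho show ?thesis by blast
qed

text \<open>The local universal sections and their transition maps form a functor. Its counit at
  \<open>i\<close> is the value of the universal section at the identity on the generic span, and
  the transition maps show that these values determine the sections entirely.\<close>

lemma pointwise_ex: "\<exists>N e. pointwise N e"
proof -
  define pa where "pa j = (SOME r. ldp j (fst r) (snd r))" for j
  have pa: "ldp j (fst (pa j)) (snd (pa j))" if j: "j \<in> Obj I" for j
  proof -
    obtain p app where "ldp j p app" using ldp_ex[OF j] by blast
    then have "ldp j (fst (p, app)) (snd (p, app))" by simp
    then show ?thesis unfolding pa_def by (rule someI)
  qed
  define p where "p j = fst (pa j)" for j
  define app where "app j = snd (pa j)" for j
  have l: "ldp j (p j) (app j)" if "j \<in> Obj I" for j
    using pa[OF that] by (simp add: p_def app_def)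
  note x = sec_arr[OF ldp_sec[OF l]] sec_cod[OF ldp_sec[OF l]]
  define h where "h u = (SOME h. transition p app u h)" for u
  note tf = transition_functor[of "\<lambda>_. True" p app, folded h_def]
  have tr: "transition p app u (h u)" if "u \<in> Arr I" for u
    by (rule tf(1)) (use l that in simp_all)
  have h_Id: "h (Id I j) = Id E (Dom E (p j))" if "j \<in> Obj I" for j
    by (rule tf(2)) (use l that in simp_all)
  have h_comp: "h (v \<star> u) = h v \<bullet> h u" if "u \<in> Arr I" "v \<in> Arr I" "Cod I u = Dom I v" for u v
    by (rule tf(3)) (use l that in simp_all)
  note T = transitionD[OF tr]
  define X where "X = mk_funct (\<lambda>j. Dom E (p j)) h"
  have X: "X \<in> Obj FC"
    unfolding X_def by (rule mk_funct_Obj) (use x T(1-3) h_Id h_comp in simp_all)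
  define N where "N = mk_nat X A p"
  have "N \<in> Arr FC"
    unfolding N_def
  proof (rule mk_nat_arr)
    show "X \<in> Obj FC" by (rule X)
    show "A \<in> Obj FC" by simp
    fix i assume i: "i \<in> Obj I"
    show "p i \<in> Arr E" "Cod E (p i) = FObj A i" using x i by auto
    show "Dom E (p i) = FObj X i" using i by (simp add: X_def)
  next
    fix u assume u: "u \<in> Arr I"
    then show "FArr A u \<bullet> p (Dom I u) = p (Cod I u) \<bullet> FArr X u"
      using T(4)[OF u] by (simp add: X_def)
  qed
  then have N: "over N" unfolding over_def by (simp add: N_def)
  have SN: "Src N = X" "\<And>i. i \<in> Obj I \<Longrightarrow> Cmp N i = p i" "\<And>u. u \<in> Arr I \<Longrightarrow> FArr X u = h u"
     "\<And>i. i \<in> Obj I \<Longrightarrow> FObj X i = Dom E (p i)"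
    by (simp_all add: N_def X_def)
  define c where "c i = app i (Id I i) (Cmp (P2 N) i) (Cmp (P1 N) i)" for i
  have spP: "span i (p i) (Id I i) (Cmp (P2 N) i) (Cmp (P1 N) i)" if "i \<in> Obj I" for i
    using span_P[OF N that] SN(2)[OF that] by simp
  note S = secD[OF ldp_sec[OF l]]
  have c: "c i \<in> Arr E" "Dom E (c i) = FObj (Src (P1 N)) i" "Cod E (c i) = FObj C i" "Cmp g i \<bullet> c i = Cmp (P1 N) i"
    if i: "i \<in> Obj I" for i
    using S(3-6)[OF i spP[OF i]] i N unfolding c_def by simp_all
  \<comment> \<open>The transition map along \<open>u\<close> reduces the index to an identity; the
    pair over \<open>Cod I u\<close> is then the generic one precomposed with a mediating
    arrow.\<close>
  have app_c: "app i u t b = c (Cod I u) \<bullet> med N (Cod I u) b (h u \<bullet> t)" if i: "i \<in> Obj I" and sp: "span i (p i) u t b" for i u t b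
  proof -
    note s = spanD[OF sp]
    have j: "Cod I u \<in> Obj I" using s by simp
    have spN: "span i (Cmp N i) u t b" using sp SN(2)[OF i] by simp
    note M = med[OF N j span_eval[OF N spN], unfolded SN(1) SN(3)[OF s(1)]]
    let ?m = "med N (Cod I u) b (h u \<bullet> t)"
    have "app i u t b = app (Cod I u) (Id I (Cod I u)) (h u \<bullet> t) b"
      using T(5)[OF s(1), of "Id I (Cod I u)" t b] s sp j by simp
    also have "\<dots> = app (Cod I u) (Id I (Cod I u)) (Cmp (P2 N) (Cod I u) \<bullet> ?m) (Cmp (P1 N) (Cod I u) \<bullet> ?m)"
      unfolding M(4,5) ..
    also have "\<dots> = c (Cod I u) \<bullet> ?m"
      unfolding c_def by (rule sec_stage[OF ldp_sec[OF l[OF j]] spP[OF j]]) (use M N j in simp_all)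
    finally show ?thesis .
  qed
  define e where "e = mk_nat (Src (P1 N)) C c"
  have e: "e \<in> Arr FC"
    unfolding e_def
  proof (rule mk_nat_arr)
    fix u assume u: "u \<in> Arr I"
    let ?i = "Dom I u"
    have ij: "?i \<in> Obj I" "Cod I u \<in> Obj I" using u by simp_all
    have sp: "span ?i (p ?i) u (Cmp (P2 N) ?i) (FArr B u \<bullet> Cmp (P1 N) ?i)"
      using span_natural[OF x(1)[OF ij(1)] x(2)[OF ij(1)] spP[OF ij(1)], of u] u by simp
    have "FArr C u \<bullet> c ?i = app ?i u (Cmp (P2 N) ?i) (FArr B u \<bullet> Cmp (P1 N) ?i)"
      unfolding c_def using sec_natural[OF ldp_sec[OF l[OF ij(1)]] spP[OF ij(1)], of u] u by simp
    also have "\<dots> = c (Cod I u) \<bullet> med N (Cod I u) (FArr B u \<bullet> Cmp (P1 N) ?i) (h u \<bullet> Cmp (P2 N) ?i)"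
      by (rule app_c[OF ij(1) sp])
    also have "med N (Cod I u) (FArr B u \<bullet> Cmp (P1 N) ?i) (h u \<bullet> Cmp (P2 N) ?i) = FArr (Src (P1 N)) u"
      by (rule med_unique[OF N ij(2)])
        (use naturality[of "P1 N" u] naturality[of "P2 N" u] N u SN in simp_all)
    finally show "FArr C u \<bullet> c ?i = c (Cod I u) \<bullet> FArr (Src (P1 N)) u" .
  qed (use c N in simp_all)
  have "g \<cdot>\<^bsub>FC\<^esub> e = P1 N"
    by (rule FC_eqI) (use e c N in \<open>simp_all add: e_def\<close>)
  then have ov: "over_pb N e"
    unfolding over_pb_def using e by (simp add: e_def)
  have "ldp i (Cmp N i) (ksec N e)" if i: "i \<in> Obj I" for i
  proof (rule ldp_transport[OF l[OF i], of "Id E (Dom E (p i))" "Id E (Dom E (p i))"])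
    show "sec i (Cmp N i) (ksec N e)" by (rule ksec_sec[OF N ov i])
    fix u t b assume "span i (Cmp N i) u t b"
    then have sp: "span i (p i) u t b" using SN(2)[OF i] by simp
    note s = spanD[OF sp]
    show "app i u (Id E (Dom E (p i)) \<bullet> t) b = ksec N e u t b"
      using app_c[OF i sp] s SN unfolding ksec_def by (simp add: e_def)
  qed (use x i SN in \<open>simp_all add: are_inverse_def hom_def\<close>)
  then show ?thesis unfolding pointwise_def using N ov by blast
qed

text \<open>Universal arrows are unique up to isomorphism, so \<open>M\<close> inherits universality
  at each object from the constructed \<open>N\<close>. The two composites are compared with
  identities after transposition, and transposes are determined by their sections.\<close>

lemma universal_pointwise:
  assumes M: "over M" "over_pb M m"
    and ex: "\<And>x k. over x \<Longrightarrow> over_pb x k \<Longrightarrow> \<exists>h. hom_over x M h \<and> uncurry M m x h = k"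
    and uni: "\<And>x h h'. over x \<Longrightarrow> hom_over x M h \<Longrightarrow> hom_over x M h' \<Longrightarrow> uncurry M m x h = uncurry M m x h' \<Longrightarrow> h = h'"
  shows "pointwise M m"
proof -
  obtain N e where Ne: "pointwise N e" using pointwise_ex by blast
  then have N: "over N" "over_pb N e" by (simp_all add: pointwise_def)
  obtain h where h: "hom_over M N h" "uncurry N e M h = m" using pointwise_lift[OF Ne M] by blast
  obtain k where k: "hom_over N M k" "uncurry M m N k = e" using ex[OF N] by blast
  note H = hom_overD[OF h(1)] and K = hom_overD[OF k(1)]
  have hk: "hom_over N N (h \<cdot>\<^bsub>FC\<^esub> k)" and kh: "hom_over M M (k \<cdot>\<^bsub>FC\<^esub> h)"
    unfolding hom_over_def
    using H(1-4) K(1-4) FC.comp_extend[OF H(4), of k] FC.comp_extend[OF K(4), of h] M N by simp_all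
  have Id: "hom_over N N (Id FC (Src N))" "hom_over M M (Id FC (Src M))"
    unfolding hom_over_def using M N FC.dom_id[of "Src N"] FC.cod_id[of "Src N"] FC.dom_id[of "Src M"] FC.cod_id[of "Src M"] by simp_all
  have "h \<cdot>\<^bsub>FC\<^esub> k = Id FC (Src N)"
  proof (rule pointwise_unique[OF Ne N(1) hk Id(1)], rule ksec_inj[OF N(1) uncurry_over[OF N N(1) hk] uncurry_over[OF N N(1) Id(1)]])
    fix i u t b assume i: "i \<in> Obj I" and sp: "span i (Cmp N i) u t b"
    note s = spanD[OF sp]
    have sp': "span i (Cmp M i) u (Cmp k i \<bullet> t) b"
      using sp span_comp[of "Cmp M i" i "Cmp k i" u t b] K i M by simp
    have "ksec N e u (Cmp (h \<cdot>\<^bsub>FC\<^esub> k) i \<bullet> t) b = ksec N e u (Cmp h i \<bullet> (Cmp k i \<bullet> t)) b"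
      using H(1-3) K(1-3) i s M N by simp
    also have "\<dots> = ksec N e u t b"
      using ksec_uncurry[OF N M(1) h(1) i sp'] ksec_uncurry[OF M N(1) k(1) i sp] h(2) k(2) by simp
    also have "\<dots> = ksec N e u (Cmp (Id FC (Src N)) i \<bullet> t) b"
      using s i N by simp
    finally show "ksec N (uncurry N e N (h \<cdot>\<^bsub>FC\<^esub> k)) u t b = ksec N (uncurry N e N (Id FC (Src N))) u t b"
      using ksec_uncurry[OF N N(1) hk i sp] ksec_uncurry[OF N N(1) Id(1) i sp] by simp
  qed
  moreover have "k \<cdot>\<^bsub>FC\<^esub> h = Id FC (Src M)"
  proof (rule uni[OF M(1) kh Id(2)], rule ksec_inj[OF M(1) uncurry_over[OF M M(1) kh] uncurry_over[OF M M(1) Id(2)]])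
    fix i u t b assume i: "i \<in> Obj I" and sp: "span i (Cmp M i) u t b"
    note s = spanD[OF sp]
    have sp': "span i (Cmp N i) u (Cmp h i \<bullet> t) b"
      using sp span_comp[of "Cmp N i" i "Cmp h i" u t b] H i N by simp
    have "ksec M m u (Cmp (k \<cdot>\<^bsub>FC\<^esub> h) i \<bullet> t) b = ksec M m u (Cmp k i \<bullet> (Cmp h i \<bullet> t)) b"
      using H(1-3) K(1-3) i s M N by simp
    also have "\<dots> = ksec M m u t b"
      using ksec_uncurry[OF M N(1) k(1) i sp'] ksec_uncurry[OF N M(1) h(1) i sp] h(2) k(2) by simp
    also have "\<dots> = ksec M m u (Cmp (Id FC (Src M)) i \<bullet> t) b"
      using s i M by simp
    finally show "ksec M (uncurry M m M (k \<cdot>\<^bsub>FC\<^esub> h)) u t b = ksec M (uncurry M m M (Id FC (Src M))) u t b"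
      using ksec_uncurry[OF M M(1) kh i sp] ksec_uncurry[OF M M(1) Id(2) i sp] by simp
  qed
  ultimately have inv: "are_inverse FC h k"
    using H(1-3) K(1-3) by (simp add: are_inverse_def hom_def)
  have "ldp i (Cmp M i) (ksec M m)" if i: "i \<in> Obj I" for i
  proof (rule ldp_transport[OF _ Cmp_inverse[OF inv i]])
    show "ldp i (Cmp N i) (ksec N e)" using Ne i by (simp add: pointwise_def)
    show "sec i (Cmp M i) (ksec M m)" by (rule ksec_sec[OF M i])
    fix u t b assume sp: "span i (Cmp M i) u t b"
    show "ksec N e u (Cmp h i \<bullet> t) b = ksec M m u t b"
      using ksec_uncurry[OF N M(1) h(1) i sp] h(2) by simp
  qed (use H i N in simp_all)
  then show ?thesis unfolding pointwise_def using M by blast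
qed

end

section \<open>The dependent product along a natural transformation\<close>

context dep_prod
begin

lemma over_pb_slice: "over x \<Longrightarrow> w \<in> hom (slice FC B) (P1 x) g \<longleftrightarrow> (\<exists>k. w = (P1 x, k, g) \<and> over_pb x k)"
  by (cases w) (auto simp: hom_slice over_pb_def simp del: over_pb_simps)

lemma hom_over_slice: "over x \<Longrightarrow> over N \<Longrightarrow> w \<in> hom (slice FC A) x N \<longleftrightarrow> (\<exists>h. w = (x, h, N) \<and> hom_over x N h)"
  by (cases w) (auto simp: hom_slice hom_over_def)

text \<open>The universal property of a pointwise \<open>N\<close>, rephrased in the slices, where
  an arrow carries its end points as part of a triple.\<close>

lemma universal_arrow_ex:
  "\<exists>N e. N \<in> Obj (slice FC A) \<and> e \<in> hom (slice FC B) (P1 N) g \<and>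
     (\<forall>x\<in>Obj (slice FC A). \<forall>k\<in>hom (slice FC B) (P1 x) g.
        \<exists>!h. h \<in> hom (slice FC A) x N \<and> e \<cdot>\<^bsub>slice FC B\<^esub> FArr (pb_functor FC f) h = k)"
proof -
  obtain N e where Ne: "pointwise N e" using pointwise_ex by blast
  then have N: "over N" and e: "over_pb N e" unfolding pointwise_def by blast+
  have ev: "(P1 N, e, g) \<cdot>\<^bsub>slice FC B\<^esub> FArr (pb_functor FC f) (x, h, N) = (P1 x, uncurry N e x h, g)" for x h
    by (simp add: uncurry_def)
  have "\<exists>!h. h \<in> hom (slice FC A) x N \<and> (P1 N, e, g) \<cdot>\<^bsub>slice FC B\<^esub> FArr (pb_functor FC f) h = w"
    if x: "x \<in> Obj (slice FC A)" and w: "w \<in> hom (slice FC B) (P1 x) g" for x w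
  proof -
    have x': "over x" using x unfolding over_def by simp
    obtain k where k: "w = (P1 x, k, g)" "over_pb x k" using w over_pb_slice[OF x'] by blast
    obtain h where h: "hom_over x N h" "uncurry N e x h = k" using pointwise_lift[OF Ne x' k(2)] by blast
    show ?thesis
    proof (rule ex1I[of _ "(x, h, N)"])
      show "(x, h, N) \<in> hom (slice FC A) x N \<and> (P1 N, e, g) \<cdot>\<^bsub>slice FC B\<^esub> FArr (pb_functor FC f) (x, h, N) = w"
        unfolding ev k(1) hom_over_slice[OF x' N] using h by blast
    next
      fix v assume v: "v \<in> hom (slice FC A) x N \<and> (P1 N, e, g) \<cdot>\<^bsub>slice FC B\<^esub> FArr (pb_functor FC f) v = w"
      then obtain h' where h': "v = (x, h', N)" "hom_over x N h'"
        using hom_over_slice[OF x' N] by blast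
      then have "uncurry N e x h' = k" using v unfolding h'(1) ev k(1) by blast
      then show "v = (x, h, N)"
        using pointwise_unique[OF Ne x' h'(2) h(1)] h(2) h'(1) by simp
    qed
  qed
  moreover have "(P1 N, e, g) \<in> hom (slice FC B) (P1 N) g"
    using over_pb_slice[OF N] e by blast
  moreover have "N \<in> Obj (slice FC A)" using N by simp
  ultimately show ?thesis by blast
qed

end

context matching
begin

text \<open>The locale \<open>dep_prod\<close> fixes one object over the source of \<open>f\<close>.
  Here it is opened at each such object \<open>d\<close> in turn, and the resulting universal arrows
  assemble into the adjoint.\<close>

theorem powerful_FC:
  assumes f: "f \<in> Arr FC" and pow: "\<And>i. i \<in> Obj I \<Longrightarrow> powerful E (Cmp f i)"
  shows "powerful FC f"
proof -
  let ?A = "slice FC (Tgt f)" and ?B = "slice FC (Src f)"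
  \<comment> \<open>The object and its universal arrow are kept as one pair, so that a single choice
    for each \<open>d\<close> yields both compatibly.\<close>
  define U where "U d r \<longleftrightarrow> fst r \<in> Obj ?A \<and> snd r \<in> hom ?B (pb1 FC f (fst r)) d \<and>
     (\<forall>x\<in>Obj ?A. \<forall>k\<in>hom ?B (pb1 FC f x) d.
        \<exists>!h. h \<in> hom ?A x (fst r) \<and> snd r \<cdot>\<^bsub>?B\<^esub> FArr (pb_functor FC f) h = k)" for d r
  have "\<exists>r. U d r" if d: "d \<in> Obj ?B" for d
  proof -
    interpret D: dep_prod I E deg f d
      by unfold_locales (use f d pow in simp_all)
    show ?thesis unfolding U_def using D.universal_arrow_ex by simp
  qed
  then have U: "U d (SOME r. U d r)" if "d \<in> Obj ?B" for d
    using someI_ex[of "U d"] that by blast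
  define R where "R d = fst (SOME r. U d r)" for d
  define e where "e d = snd (SOME r. U d r)" for d
  note U' = U[unfolded U_def[of _ "SOME r. U _ r"], folded R_def e_def]
  have "\<exists>G. is_right_adjoint ?A ?B (pb_functor FC f) G e"
  proof (rule universal_arrows_right_adjoint[where R = R, OF FC.category_slice FC.category_slice])
    show "is_functor ?A ?B (pb_functor FC f)"
      using FC.is_functor_pb_functor[OF f has_pullbacks_along_FC[OF f]] by simp
  next
    fix d assume d: "d \<in> Obj ?B"
    show "R d \<in> Obj ?A" using U'[OF d] by blast
    show "e d \<in> hom ?B (FObj (pb_functor FC f) (R d)) d"
      unfolding FObj_pb_functor using U'[OF d] by blast
    fix x k assume "x \<in> Obj ?A" "k \<in> hom ?B (FObj (pb_functor FC f) x) d"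
    then show "\<exists>!h. h \<in> hom ?A x (R d) \<and> e d \<cdot>\<^bsub>?B\<^esub> FArr (pb_functor FC f) h = k"
      unfolding FObj_pb_functor using U'[OF d] by blast
  qed
  then show ?thesis
    unfolding powerful_def using f has_pullbacks_along_FC[OF f] by auto
qed

lemma match_arr_comp:
  assumes i: "i \<in> Obj I" and s: "s \<in> Arr FC" and t: "t \<in> Arr FC" "Tgt t = Src s"
  shows "match_arr I deg E i (s \<cdot>\<^bsub>FC\<^esub> t) = match_arr I deg E i s \<bullet> match_arr I deg E i t"
proof (rule lim_eqI[OF i, of "Tgt s"])
  have st: "s \<cdot>\<^bsub>FC\<^esub> t \<in> Arr FC" using s t by simp
  fix u assume u: "low i u"
  have j: "Cod I u \<in> Obj I" using u by auto
  show "prj i (Tgt s) u \<bullet> match_arr I deg E i (s \<cdot>\<^bsub>FC\<^esub> t) =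
     prj i (Tgt s) u \<bullet> (match_arr I deg E i s \<bullet> match_arr I deg E i t)"
    using prj_match_arr[OF i st u] E.comp_extend[OF prj_match_arr[OF i s u], of "match_arr I deg E i t"]
      prj_match_arr[OF i t(1) u] i s t u j by simp
qed (use i s t in simp_all)

end

section \<open>The maps of the statement, computed on generalised elements\<close>

context dep_prod
begin

text \<open>The canonical isomorphism for M_i, applied to a pairing, projects to the mediating
  arrows \<open>med\<close> at the objects below \<open>i\<close>. Therefore the transpose of
  M_i(ev), evaluated and projected to \<open>Cod I u\<close>, is the section of \<open>e\<close>
  there, taken at the projected arguments.\<close>

lemma match_ev_transpose_ksec:
  assumes i: "i \<in> Obj I" and pM: "powerful E (match_arr I deg E i f)" and N: "over N" and e: "over_pb N e"
  defines "m \<equiv> dprod_transpose E (match_arr I deg E i f) (match_arr I deg E i N) (match_arr I deg E i g)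
     (match_arr I deg E i e \<bullet> match_pb_iso I deg E i f N)"
  shows "m \<in> Arr E" "Dom E m = Lim i (Src N)"
    "Cod E m = Dom E (FObj (dprod E (match_arr I deg E i f)) (match_arr I deg E i g))"
    "FObj (dprod E (match_arr I deg E i f)) (match_arr I deg E i g) \<bullet> m = match_arr I deg E i N"
    and "low i u \<Longrightarrow> dspan E (match_arr I deg E i f) (match_arr I deg E i N) y b \<Longrightarrow>
      prj i C u \<bullet> dapp E (match_arr I deg E i f) (match_arr I deg E i g) (m \<bullet> y) b =
      ksec N e (Id I (Cod I u)) (prj i (Src N) u \<bullet> y) (prj i B u \<bullet> b)"
proof -
  let ?M = "match_arr I deg E i"
  let ?iso = "match_pb_iso I deg E i f N"
  note oN = over_simps[OF N] and oe = over_pb_simps[OF e]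
  note pb = match_arr_pullback[OF pb_over[OF N] i]
  have tM: "?M f \<in> Arr E" "?M N \<in> Arr E" "Cod E (?M N) = Cod E (?M f)" "has_pullbacks_along E (?M f)"
    "?M e \<in> Arr E" "Dom E (?M e) = Lim i (Src (P1 N))" "Cod E (?M e) = Lim i C"
    "?M (P1 N) \<in> Arr E" "Dom E (?M (P1 N)) = Lim i (Src (P1 N))" "Dom E (?M N) = Lim i (Src N)"
    using i oN oe by simp_all
  have Mge: "?M g \<bullet> ?M e = ?M (P1 N)"
    using match_arr_comp[OF i g, of e] oe e unfolding over_pb_def by simp
  have pbM: "pb1 E (?M f) (?M N) \<in> Arr E" "pb2 E (?M f) (?M N) \<in> Arr E" 
    "Dom E (pb2 E (?M f) (?M N)) = Dom E (pb1 E (?M f) (?M N))"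
    "Cod E (pb1 E (?M f) (?M N)) = Dom E (?M f)" "Cod E (pb2 E (?M f) (?M N)) = Dom E (?M N)"
    using tM by simp_all
  note cmp = E.comparison_inverse[OF pb tM(4), folded match_pb_iso_def]
  note c1 = cmp[OF pbM(1,2) pbM(3)[symmetric] pbM(4,5) E.pb_comm[OF tM(4,2,3)]]
  have pair: "pb_pair E (?M f) (?M N) (pb1 E (?M f) (?M N)) (pb2 E (?M f) (?M N)) = Id E (Dom E (pb1 E (?M f) (?M N)))"
    by (rule E.pb_pair_eqI[OF tM(4,2,3)]) (use pbM in simp_all)
  have iso: "?iso \<in> Arr E" "Dom E ?iso = Dom E (pb1 E (?M f) (?M N))" "Cod E ?iso = Lim i (Src (P1 N))"
    "?M (P1 N) \<bullet> ?iso = pb1 E (?M f) (?M N)"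
    using c1 unfolding pair using tM by simp_all
  let ?k = "?M e \<bullet> ?iso"
  have k: "?k \<in> Arr E" "Dom E ?k = Dom E (pb1 E (?M f) (?M N))" "Cod E ?k = Dom E (?M g)" "?M g \<bullet> ?k = pb1 E (?M f) (?M N)"
    using E.comp_extend[OF Mge, of ?iso] tM iso i by simp_all
  have dg: "?M g \<in> Arr E" "Cod E (?M g) = Dom E (?M f)" using i by simp_all
  note tr = E.dprod_transpose[OF pM dg tM(2,3) k, folded m_def]
  show "m \<in> Arr E" "Dom E m = Lim i (Src N)" "Cod E m = Dom E (FObj (dprod E (?M f)) (?M g))"
    "FObj (dprod E (?M f)) (?M g) \<bullet> m = ?M N"
    using tr(1-4) tM by simp_all
  assume u: "low i u" and s: "dspan E (?M f) (?M N) y b"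
  let ?j = "Cod I u"
  have j: "?j \<in> Obj I" using u by auto
  have yb: "y \<in> Arr E" "b \<in> Arr E" "Dom E b = Dom E y" "Cod E b = Dom E (?M f)" "Cod E y = Dom E (?M N)" "?M f \<bullet> b = ?M N \<bullet> y"
    using s by (simp_all add: dspan_def)
  let ?h = "?iso \<bullet> pb_pair E (?M f) (?M N) b y"
  note h = cmp(4-8)[OF yb(2,1,3-6)]
  have h': "Cod E ?h = Lim i (Src (P1 N))" using h(3) tM by simp
  have P1h: "Cmp (P1 N) ?j \<bullet> (prj i (Src (P1 N)) u \<bullet> ?h) = prj i B u \<bullet> b"
  proof -
    have "Cmp (P1 N) ?j \<bullet> (prj i (Src (P1 N)) u \<bullet> ?h) = prj i B u \<bullet> (?M (P1 N) \<bullet> ?h)"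
      using E.comp_extend[OF prj_match_arr[OF i oN(3) u], of ?h] oN h(1) h' u i j by simp
    then show ?thesis unfolding h(4) .
  qed
  have P2h: "Cmp (P2 N) ?j \<bullet> (prj i (Src (P1 N)) u \<bullet> ?h) = prj i (Src N) u \<bullet> y"
  proof -
    have "Cmp (P2 N) ?j \<bullet> (prj i (Src (P1 N)) u \<bullet> ?h) = prj i (Src N) u \<bullet> (?M (P2 N) \<bullet> ?h)"
      using E.comp_extend[OF prj_match_arr[OF i oN(4) u], of ?h] oN h(1) h' u i j by simp
    then show ?thesis unfolding h(5) .
  qed
  have md: "med N ?j (prj i B u \<bullet> b) (prj i (Src N) u \<bullet> y) = prj i (Src (P1 N)) u \<bullet> ?h"
    by (rule med_unique[OF N j _ _ P1h P2h]) (use oN h(1) h' u i in simp_all)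
  have pp: "pb_pair E (?M f) (?M N) b y \<in> Arr E" "Cod E (pb_pair E (?M f) (?M N) b y) = Dom E ?iso"
    using E.pb_pair(1,3)[OF tM(4,2,3) yb(2,1,3-6)] iso(2) by simp_all
  have "dapp E (?M f) (?M g) (m \<bullet> y) b = ?M e \<bullet> ?h"
    using tr(5)[OF s] tM iso pp by simp
  then have "prj i C u \<bullet> dapp E (?M f) (?M g) (m \<bullet> y) b = Cmp e ?j \<bullet> (prj i (Src (P1 N)) u \<bullet> ?h)"
    using E.comp_extend[OF prj_match_arr[OF i oe(1) u], of ?h] oN oe h(1) h' tM u i j by simp
  also have "\<dots> = ksec N e (Id I ?j) (prj i (Src N) u \<bullet> y) (prj i B u \<bullet> b)"
    unfolding md[symmetric] ksec_def using j oN yb tM u i by simp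
  finally show "prj i C u \<bullet> dapp E (?M f) (?M g) (m \<bullet> y) b =
      ksec N e (Id I (Cod I u)) (prj i (Src N) u \<bullet> y) (prj i B u \<bullet> b)" .
qed

text \<open>On elements \<open>base_change_iso\<close> merely regroups a pair. What remains, after
  projection to M_i C, is evaluation for the dependent product along M_i f at the image of
  \<open>b\<close> under the matching map of \<open>B\<close>.\<close>

lemma pb_ev_transpose_dapp:
  assumes i: "i \<in> Obj I" and pM: "powerful E (match_arr I deg E i f)"
  defines "p \<equiv> FObj (dprod E (match_arr I deg E i f)) (match_arr I deg E i g)"
    and "r \<equiv> pb1 E (match_map I deg E i B) (match_arr I deg E i g)"
    and "x \<equiv> pb1 E (match_map I deg E i A) (FObj (dprod E (match_arr I deg E i f)) (match_arr I deg E i g))"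
    and "w \<equiv> pb_ev_transpose I deg E i f g"
  shows "w \<in> Arr E" "Dom E w = Dom E x" "Cod E w = Dom E (FObj (dprod E (Cmp f i)) r)"
    "FObj (dprod E (Cmp f i)) r \<bullet> w = x"
    and "dspan E (Cmp f i) x y b \<Longrightarrow>
      pb2 E (match_map I deg E i B) (match_arr I deg E i g) \<bullet> dapp E (Cmp f i) r (w \<bullet> y) b =
      dapp E (match_arr I deg E i f) (match_arr I deg E i g)
        (pb2 E (match_map I deg E i A) p \<bullet> y) (match_map I deg E i B \<bullet> b)"
proof -
  let ?f = "match_arr I deg E i f" and ?g = "match_arr I deg E i g"
  let ?mA = "match_map I deg E i A" and ?mB = "match_map I deg E i B" and ?fi = "Cmp f i"
  define toB where "toB = pb1 E ?fi x"
  define toP where "toP = pb2 E ?mA p \<bullet> pb2 E ?fi x"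
  define p1 where "p1 = pb1 E ?f p"
  define ev where "ev = underlying (dprod_ev E ?f ?g)"
  define inner where "inner = pb_pair E ?f p (?mB \<bullet> toB) toP"
  have dg: "?g \<in> Arr E" "Cod E ?g = Dom E ?f" using i by simp_all
  have p: "p \<in> Arr E" "Cod E p = Cod E ?f" "Cod E p = Lim i A"
    unfolding p_def using E.dprod_arr[OF pM dg] E.cod_dprod[OF pM dg] i by simp_all
  have pp [simp]: "has_pullbacks_along E ?f" "has_pullbacks_along E ?mA" "has_pullbacks_along E ?mB" "has_pullbacks_along E ?fi"
    using i by simp_all
  have ev: "ev \<in> Arr E" "Dom E ev = Dom E p1" "Cod E ev = Dom E ?g" "?g \<bullet> ev = p1" "dprod_ev E ?f ?g = (p1, ev, ?g)"
    unfolding ev_def p1_def p_def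
    using E.dprod_ev_arr[OF pM dg] E.dom_dprod_ev[OF pM dg] E.cod_dprod_ev[OF pM dg] E.dprod_ev_over[OF pM dg] E.dprod_ev_in[OF pM dg]
    by blast+
  have p1: "p1 \<in> Arr E" "Cod E p1 = Lim i B" "Dom E (pb2 E ?f p) = Dom E p1" "pb2 E ?f p \<in> Arr E" "Cod E (pb2 E ?f p) = Dom E p"
    unfolding p1_def using p i by simp_all
  have x: "x \<in> Arr E" "Cod E x = FObj A i" "pb2 E ?mA p \<in> Arr E" "Cod E (pb2 E ?mA p) = Dom E p" "Dom E (pb2 E ?mA p) = Dom E x"
    unfolding x_def p_def[symmetric] using p i by simp_all
  have xc: "?mA \<bullet> x = p \<bullet> pb2 E ?mA p"
    unfolding x_def p_def[symmetric] by (rule E.pb_comm) (use p i in simp_all)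
  have b: "toB \<in> Arr E" "Cod E toB = FObj B i" "pb2 E ?fi x \<in> Arr E" "Dom E (pb2 E ?fi x) = Dom E toB" "Cod E (pb2 E ?fi x) = Dom E x"
    "?fi \<bullet> toB = x \<bullet> pb2 E ?fi x"
    unfolding toB_def using x i E.pb_comm[of ?fi x] by simp_all
  have toP: "toP \<in> Arr E" "Dom E toP = Dom E toB" "Cod E toP = Dom E p"
    unfolding toP_def using b x by simp_all
  have nat: "?mA \<bullet> ?fi = ?f \<bullet> ?mB" by (rule match_naturality[OF i f])
  \<comment> \<open>The inner pairing is well defined because naturality of matching maps moves the
    equation from Bi to Ai, where the squares defining \<open>toB\<close> and \<open>x\<close>
    apply.\<close>
  have c1: "?f \<bullet> (?mB \<bullet> toB) = p \<bullet> toP"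
  proof -
    have "?f \<bullet> (?mB \<bullet> toB) = ?mA \<bullet> (?fi \<bullet> toB)"
      using E.comp_extend[OF nat, of toB] b i by simp
    also have "\<dots> = p \<bullet> toP"
      unfolding b(6) toP_def using E.comp_extend[OF xc, of "pb2 E ?fi x"] b x p i by simp
    finally show ?thesis .
  qed
  have mb: "?mB \<bullet> toB \<in> Arr E" "Dom E (?mB \<bullet> toB) = Dom E toP" "Cod E (?mB \<bullet> toB) = Dom E ?f"
    using b toP i by simp_all
  note inner = E.pb_pair[OF pp(1) p(1,2) mb(1) toP(1) mb(2,3) toP(3) c1, folded inner_def p1_def]
  have q1: "Cod E p1 = Cod E ?mB" "Dom E toB = Dom E inner" "Cod E toB = Dom E ?mB" using p1 inner toP b i by simp_all
  define base where "base = pb_pair E ?mB p1 toB inner"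
  note base = E.pb_pair[OF pp(3) p1(1) q1(1) b(1) inner(1) q1(2,3) inner(3) inner(4)[symmetric], folded base_def]
  have base': "base_change_iso I deg E i f g = base"
    by (simp add: base_change_iso_def Let_def base_def inner_def toB_def toP_def p1_def x_def p_def)
  define k2 where "k2 = pb_pair E ?mB ?g (pb1 E ?mB p1) (ev \<bullet> pb2 E ?mB p1)"
  have mBa: "?mB \<in> Arr E" "Cod E ?g = Cod E ?mB" using i by simp_all
  note k2 = E.pb_map[OF mBa(1) pp(3) p1(1) q1(1) dg(1) mBa(2) ev(1-4), folded k2_def r_def]
  have k2': "underlying (FArr (pb_functor E ?mB) (dprod_ev E ?f ?g)) = k2"
    unfolding ev(5) k2_def by simp
  let ?K = "k2 \<bullet> base"
  have r: "r \<in> Arr E" "Cod E r = Dom E ?fi" "pb2 E ?mB ?g \<in> Arr E" "Dom E (pb2 E ?mB ?g) = Dom E r" "Cod E (pb2 E ?mB ?g) = Lim i C"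
    unfolding r_def using i by simp_all
  have pbm: "pb2 E ?mB p1 \<in> Arr E" "Dom E (pb2 E ?mB p1) = Dom E (pb1 E ?mB p1)" "Cod E (pb2 E ?mB p1) = Dom E p1"
    "pb1 E ?mB p1 \<in> Arr E"
    using p1 q1 i by simp_all
  have K: "?K \<in> Arr E" "Dom E ?K = Dom E (pb1 E ?fi x)" "Cod E ?K = Dom E r" "r \<bullet> ?K = pb1 E ?fi x"
    "pb2 E ?mB ?g \<bullet> ?K = ev \<bullet> inner"
    using E.comp_extend[OF k2(4), of base] E.comp_extend[OF k2(5), of base] base k2(1-3) r q1 pbm inner(1-3) ev(1-3) toP(2) by (simp_all add: toB_def)
  have w: "w = dprod_transpose E ?fi x r ?K"
    unfolding w_def pb_ev_transpose_def base' k2' x_def r_def ..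
  have xc': "Cod E x = Cod E ?fi" using x i by simp
  note tr = E.dprod_transpose[OF pow[OF i] r(1,2) x(1) xc' K(1-4), folded w]
  show "w \<in> Arr E" "Dom E w = Dom E x" "Cod E w = Dom E (FObj (dprod E (Cmp f i)) r)"
    "FObj (dprod E (Cmp f i)) r \<bullet> w = x"
    by (fact tr(1-4))+
  fix y b assume s: "dspan E ?fi x y b"
  then have yb: "y \<in> Arr E" "b \<in> Arr E" "Dom E b = Dom E y" "Cod E b = Dom E ?fi" "Cod E y = Dom E x" "?fi \<bullet> b = x \<bullet> y"
    by (simp_all add: dspan_def)
  let ?m = "pb_pair E ?fi x b y"
  note m = E.pb_pair[OF pp(4) x(1) xc' yb(2,1,3-6), folded toB_def]
  have im: "inner \<bullet> ?m = pb_pair E ?f p (?mB \<bullet> b) (pb2 E ?mA p \<bullet> y)"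
  proof (rule E.pb_pair_eqI[OF pp(1) p(1,2), symmetric])
    show "pb1 E ?f p \<bullet> (inner \<bullet> ?m) = ?mB \<bullet> b"
      using E.comp_extend[OF inner(4), of ?m] inner(1-3) m p1 toP b i unfolding p1_def[symmetric] by simp
    show "pb2 E ?f p \<bullet> (inner \<bullet> ?m) = pb2 E ?mA p \<bullet> y"
      using E.comp_extend[OF inner(5), of ?m] inner(1-3) m p1 toP b x unfolding toP_def by simp
  qed (use inner m toP in \<open>simp_all add: p1_def\<close>)
  have "pb2 E ?mB ?g \<bullet> dapp E ?fi r (w \<bullet> y) b = ev \<bullet> (inner \<bullet> ?m)"
    unfolding tr(5)[OF s] using E.comp_extend[OF K(5), of ?m] K(1-3) m r inner(1-3) ev(1-3) toP(2) by (simp add: toB_def)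
  then show "pb2 E ?mB ?g \<bullet> dapp E ?fi r (w \<bullet> y) b = dapp E ?f ?g (pb2 E ?mA p \<bullet> y) (?mB \<bullet> b)"
    unfolding im dapp_def ev_def p_def .
qed

text \<open>The right adjoint in the statement is an arbitrary choice, but its counit is universal,
  so \<open>universal_pointwise\<close> applies. At this counit \<open>uncurry\<close> is evaluation
  \<open>dapp\<close> at the generic pair, which makes the rules for dependent products
  available.\<close>

lemma chosen_dprod_pointwise:
  assumes powf: "powerful FC f"
  shows "pointwise (Pi_arr I E f g) (Pi_ev I E f g)"
proof -
  let ?N = "Pi_arr I E f g" and ?e = "Pi_ev I E f g"
  have gC: "Cod FC g = Dom FC f" by simp
  have N: "over ?N"
    unfolding over_def Pi_arr_def using FC.dprod_arr[OF powf g gC] FC.cod_dprod[OF powf g gC] by simp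
  have e: "over_pb ?N ?e"
    unfolding over_pb_def Pi_arr_def Pi_ev_def
    using FC.dprod_ev_arr[OF powf g gC] FC.dom_dprod_ev[OF powf g gC] FC.cod_dprod_ev[OF powf g gC] FC.dprod_ev_over[OF powf g gC]
    by (simp only: Dom_FC Cod_FC)
  have un: "uncurry ?N ?e x h = dapp FC f g (h \<cdot>\<^bsub>FC\<^esub> P2 x) (P1 x)" for x h
    by (simp add: uncurry_def dapp_def Pi_arr_def Pi_ev_def)
  show ?thesis
  proof (rule universal_pointwise[OF N e])
    fix x k assume x: "over x" and k: "over_pb x k"
    have xC: "Cod FC x = Cod FC f" using x by simp
    have k': "k \<in> Arr FC" "Dom FC k = Dom FC (P1 x)" "Cod FC k = Dom FC g" "g \<cdot>\<^bsub>FC\<^esub> k = P1 x"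
      using k unfolding over_pb_def Dom_FC Cod_FC by blast+
    note tr = FC.dprod_transpose[OF powf g gC over_simps(1)[OF x] xC k']
    have s: "dspan FC f x (P2 x) (P1 x)"
      using FC.pb_comm[OF pbs_f over_simps(1)[OF x] xC] x by (simp add: dspan_def)
    have "pb_pair FC f x (P1 x) (P2 x) = Id FC (Src (P1 x))"
      by (rule FC.pb_pair_eqI[OF pbs_f over_simps(1)[OF x] xC])
        (use x FC.cod_id[of "Src (P1 x)"] in simp_all)
    then have "uncurry ?N ?e x (dprod_transpose FC f x g k) = k"
      unfolding un tr(5)[OF s] using k' by simp
    moreover have "hom_over x ?N (dprod_transpose FC f x g k)"
      unfolding hom_over_def Pi_arr_def using tr(1-4) by simp
    ultimately show "\<exists>h. hom_over x ?N h \<and> uncurry ?N ?e x h = k" by blast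
  next
    fix x h h' assume x: "over x" and h: "hom_over x ?N h" and h': "hom_over x ?N h'"
      and eq: "uncurry ?N ?e x h = uncurry ?N ?e x h'"
    note H = hom_overD(1-4)[OF h] and H' = hom_overD(1-4)[OF h']
    show "h = h'"
      by (rule FC.dprod_eqI_pb[OF powf g gC, of h h' x])
        (use H H' eq in \<open>simp_all add: Pi_arr_def[symmetric] un\<close>)
  qed
qed

text \<open>The dependent product is fed into the inductive step as its own lower diagram. The two
  maps of the statement meet the specifications \<open>is_w1\<close> and \<open>is_w2\<close>, and
  the value at \<open>i\<close> carries a universal section, so \<open>ldp_pullback\<close>
  applies.\<close>

theorem Pi_pullback:
  assumes powf: "powerful FC f" and i: "i \<in> Obj I" and pM: "powerful E (match_arr I deg E i f)"
  shows "is_pullback E (Pi_gap_map I deg E i f g)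
    (pb_ev_transpose I deg E i f g \<bullet> pb_match_ev_transpose I deg E i f g)
    (Pi_proj_dprod I E i f g) (Pi_proj_match I deg E i f g)"
proof -
  define N where "N = Pi_arr I E f g"
  define e where "e = Pi_ev I E f g"
  have pw: "pointwise N e" unfolding N_def e_def by (rule chosen_dprod_pointwise[OF powf])
  then have N: "over N" and e: "over_pb N e" and l: "\<And>i. i \<in> Obj I \<Longrightarrow> ldp i (Cmp N i) (ksec N e)"
    unfolding pointwise_def by blast+
  note oN = over_simps[OF N] and oe = over_pb_simps[OF e]
  have tr: "transition (Cmp N) (\<lambda>_. ksec N e) u (FArr (Src N) u)" if u: "u \<in> Arr I" for u
    unfolding transition_def
  proof (intro conjI allI impI)
    fix v y b assume v: "v \<in> Arr I" "Dom I v = Cod I u" and s: "span (Dom I u) (Cmp N (Dom I u)) (v \<star> u) y b"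
    show "ksec N e v (FArr (Src N) u \<bullet> y) b = ksec N e (v \<star> u) y b"
      by (rule ksec_shift[OF N u v]) (use spanD[OF s] u oN in simp_all)
  qed (use u oN naturality[OF oN(1) u] in simp_all)
  interpret S: dep_prod_step I E deg f g i "Src N" "Cmp N" "\<lambda>_. ksec N e"
    by unfold_locales (use i oN l tr in simp_all)
  \<comment> \<open>With the dependent product as lower diagram, L is its matching object, so
    \<open>q1\<close> and \<open>q2\<close> are the projections of the pullback occurring in the
    statement.\<close>
  have lM: "S.l = match_arr I deg E i N"
    unfolding S.l_def S.L_def S.pr_def match_arr_def match_obj_eq oN(2) ..
  let ?f = "match_arr I deg E i f" and ?g = "match_arr I deg E i g"
  define p where "p = FObj (dprod E ?f) ?g"
  define m where "m = match_ev_transpose I deg E i f g"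
  define z where "z = pb_match_ev_transpose I deg E i f g"
  define w where "w = pb_ev_transpose I deg E i f g"
  have m': "m = dprod_transpose E ?f (match_arr I deg E i N) ?g (match_arr I deg E i e \<bullet> match_pb_iso I deg E i f N)"
    unfolding m_def match_ev_transpose_def N_def e_def ..
  note M = match_ev_transpose_ksec[OF i pM N e, folded m' p_def]
  note W = pb_ev_transpose_dapp[OF i pM, folded w_def p_def S.r_def, folded S.W_def]
  let ?x = "pb1 E S.mA p"
  have p: "p \<in> Arr E" "Cod E p = Lim i A" unfolding p_def using pM i by simp_all
  have z': "z = pb_pair E S.mA p S.q1 (m \<bullet> S.q2)"
    unfolding z_def pb_match_ev_transpose_def m_def[symmetric] N_def[symmetric] p_def[symmetric] S.q1_def S.q2_def lM
    by simp
  have pre: "S.mA \<in> Arr E" "has_pullbacks_along E S.mA" "match_arr I deg E i N \<in> Arr E"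
    "Cod E (match_arr I deg E i N) = Cod E S.mA" "Cod E p = Cod E S.mA" "Dom E m = Dom E (match_arr I deg E i N)"
    using i oN p M by simp_all
  note Z = E.pb_map[OF pre(1-4) p(1) pre(5) M(1) pre(6) M(3,4), folded lM, folded S.q1_def S.q2_def, folded z']
  have x: "?x \<in> Arr E" "pb2 E S.mA p \<in> Arr E" "Dom E (pb2 E S.mA p) = Dom E ?x" "Cod E (pb2 E S.mA p) = Dom E p"
    "Cod E ?x = FObj A i" using p i by simp_all
  have w2: "S.is_w2 (w \<bullet> z)"
    unfolding S.is_w2_def
  proof (intro conjI allI impI)
    show "w \<bullet> z \<in> Arr E" "Dom E (w \<bullet> z) = Dom E S.q1" "Cod E (w \<bullet> z) = Dom E S.W"
      using W(1-3) Z(1-3) by simp_all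
    show "S.W \<bullet> (w \<bullet> z) = S.q1"
      using E.comp_extend[OF W(4), of z] W(1-3) Z(1-4) by simp
    fix y b u assume s: "dspan E (Cmp f i) S.q1 y b" and u: "low i u"
    have j: "Cod I u \<in> Obj I" using u by auto
    have yb: "y \<in> Arr E" "b \<in> Arr E" "Dom E b = Dom E y" "Cod E b = FObj B i" "Cod E y = Dom E S.q1" "Cmp f i \<bullet> b = S.q1 \<bullet> y"
      using s i by (simp_all add: dspan_def)
    have sz: "dspan E (Cmp f i) ?x (z \<bullet> y) b"
      using E.comp_extend[OF Z(4), of y] Z(1-3) x yb i by (simp add: dspan_def)
    have p2z: "pb2 E S.mA p \<bullet> (z \<bullet> y) = m \<bullet> (S.q2 \<bullet> y)"
      using E.comp_extend[OF Z(5), of y] Z(1-3) x yb M(1-3) lM S.l_simps S.L_def by simp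
    have dsp: "dspan E ?f (match_arr I deg E i N) (S.q2 \<bullet> y) (S.mB \<bullet> b)"
    proof -
      have "match_arr I deg E i N \<bullet> (S.q2 \<bullet> y) = S.mA \<bullet> (S.q1 \<bullet> y)"
        using E.comp_extend[OF S.q_comm, of y] yb i S.l_simps unfolding lM[symmetric] by simp
      also have "\<dots> = ?f \<bullet> (S.mB \<bullet> b)"
        unfolding yb(6)[symmetric] using E.comp_extend[OF match_naturality[OF i f], of b] yb i by simp
      finally show ?thesis using yb i oN S.L_def by (simp add: dspan_def)
    qed
    have aW: "dspan E (Cmp f i) S.W (w \<bullet> (z \<bullet> y)) b"
      using sz W(1-3) E.comp_extend[OF W(4), of "z \<bullet> y"] Z(1-3) yb by (simp add: dspan_def)
    \<comment> \<open>The composite is evaluated from the outside in: first the transpose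
      \<open>w\<close>, then the pulled-back map \<open>z\<close>, which projects to
      \<open>m\<close>, and finally \<open>m\<close> itself.\<close>
    have "S.rho u \<bullet> S.appW (w \<bullet> (z \<bullet> y)) b =
       prj i C u \<bullet> (pb2 E S.mB ?g \<bullet> S.appW (w \<bullet> (z \<bullet> y)) b)"
      unfolding S.rho_def using S.appW[OF aW] u i by (simp add: S.r_def)
    also have "\<dots> = prj i C u \<bullet> dapp E ?f ?g (m \<bullet> (S.q2 \<bullet> y)) (S.mB \<bullet> b)"
      unfolding W(5)[OF sz] p2z ..
    also have "\<dots> = ksec N e (Id I (Cod I u)) (prj i (Src N) u \<bullet> (S.q2 \<bullet> y)) (prj i B u \<bullet> (S.mB \<bullet> b))"
      by (rule M(5)[OF u dsp])
    also have "prj i B u \<bullet> (S.mB \<bullet> b) = FArr B u \<bullet> b"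
      using E.comp_extend[OF prj_match_map[OF i Src_functor[OF f] u], of b] yb i u by simp
    finally show "S.rho u \<bullet> S.appW (w \<bullet> z \<bullet> y) b =
       ksec N e (Id I (Cod I u)) (S.pr u \<bullet> (S.q2 \<bullet> y)) (FArr B u \<bullet> b)"
      using W(1-3) Z(1-3) yb by (simp add: S.pr_def)
  qed
  let ?a = "Pi_proj_dprod I E i f g" and ?c = "Pi_proj_match I deg E i f g"
  have Ni: "Cmp N i \<in> Arr E" "Cod E (Cmp N i) = Cod E (Cmp f i)" using oN i by simp_all
  let ?ev = "eval_pb_iso I E i f N"
  have pbN: "pb1 E (Cmp f i) (Cmp N i) \<in> Arr E" "pb2 E (Cmp f i) (Cmp N i) \<in> Arr E" 
    "Dom E (pb2 E (Cmp f i) (Cmp N i)) = Dom E (pb1 E (Cmp f i) (Cmp N i))"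
    "Cod E (pb1 E (Cmp f i) (Cmp N i)) = FObj B i" "Cod E (pb2 E (Cmp f i) (Cmp N i)) = FObj (Src N) i"
    using Ni oN i by simp_all
  have dN: "dspan E (Cmp f i) (Cmp N i) (pb2 E (Cmp f i) (Cmp N i)) (pb1 E (Cmp f i) (Cmp N i))"
    using pbN E.pb_comm[of "Cmp f i" "Cmp N i"] oN i by (simp add: dspan_def)
  have pair: "pb_pair E (Cmp f i) (Cmp N i) (pb1 E (Cmp f i) (Cmp N i)) (pb2 E (Cmp f i) (Cmp N i)) =
      Id E (Dom E (pb1 E (Cmp f i) (Cmp N i)))"
    by (rule E.pb_pair_eqI) (use pbN Ni oN i in simp_all)
  have evI: "?ev \<in> Arr E" "Dom E ?ev = Dom E (pb1 E (Cmp f i) (Cmp N i))"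
    using E.comparison_inverse(1,2)[OF Cmp_pullback[OF pb_over[OF N] i], folded eval_pb_iso_def,
        OF _ pbN(1,2) pbN(3)[symmetric]] pbN dN oN i by (simp_all add: dspan_def)
  have "med N i (pb1 E (Cmp f i) (Cmp N i)) (pb2 E (Cmp f i) (Cmp N i)) = ?ev"
    unfolding med_def pair using evI by simp
  note md = med[OF N i dN, unfolded this]
  let ?k = "Cmp e i \<bullet> ?ev"
  have k: "?k \<in> Arr E" "Dom E ?k = Dom E (pb1 E (Cmp f i) (Cmp N i))" "Cod E ?k = Dom E (Cmp g i)" 
      "Cmp g i \<bullet> ?k = pb1 E (Cmp f i) (Cmp N i)"
    using E.comp_extend[OF over_pb_Cmp[OF e i], of ?ev] md pbN oe i by simp_all
  have gi: "Cmp g i \<in> Arr E" "Cod E (Cmp g i) = Dom E (Cmp f i)" using i by simp_all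
  have a': "?a = dprod_transpose E (Cmp f i) (Cmp N i) (Cmp g i) ?k"
    unfolding Pi_proj_dprod_def N_def e_def ..
  note a = E.dprod_transpose[OF pow[OF i] gi Ni k, folded a', folded S.V_def]
  have c': "?c = pb_pair E S.mA (match_arr I deg E i N) (Cmp N i) (match_map I deg E i (Src N))"
    unfolding Pi_proj_match_def N_def ..
  have nat: "S.mA \<bullet> Cmp N i = match_arr I deg E i N \<bullet> match_map I deg E i (Src N)"
    using match_naturality[OF i oN(1)] oN by simp
  note c = E.pb_pair[OF pre(2-4) _ _ _ _ _ nat, folded c', folded lM, folded S.q1_def S.q2_def]
  have c1: "?c \<in> Arr E" "Dom E ?c = Dom E (Cmp N i)" "Cod E ?c = Dom E S.q1" "S.q1 \<bullet> ?c = Cmp N i"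
    "S.q2 \<bullet> ?c = match_map I deg E i (Src N)"
    using c oN i by (simp_all add: S.L_def)
  \<comment> \<open>It remains to compute the two projections on elements: the transpose of the
    counit at \<open>i\<close> evaluates to the section at the identity, and the matching map of the
    dependent product projects to its action along \<open>u\<close>.\<close>
  show ?thesis
    unfolding w_def[symmetric] z_def[symmetric]
  proof (rule S.ldp_pullback[OF S.is_w1_gap w2 l[OF i] a(1-4) _ c1(1-4)])
    fix t b assume s: "dspan E (Cmp f i) (Cmp N i) t b"
    have t: "t \<in> Arr E" "Cod E t = FObj (Src N) i" "Dom E b = Dom E t" using s i oN by (simp_all add: dspan_def)
    have pp: "pb_pair E (Cmp f i) (Cmp N i) b t \<in> Arr E" "Cod E (pb_pair E (Cmp f i) (Cmp N i) b t) = Dom E ?ev"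
      using E.pb_pair(1,3)[of "Cmp f i" "Cmp N i" b t] s Ni evI i by (simp_all add: dspan_def)
    show "S.appV (?a \<bullet> t) b = ksec N e (Id I i) t b"
      unfolding a(5)[OF s] ksec_def med_def using pp evI md oe oN t i by simp
  next
    fix u v t b assume u: "low i u" and v: "v \<in> Arr I" "Dom I v = Cod I u" and s: "span i (Cmp N i) (v \<star> u) t b"
    have t: "t \<in> Arr E" "Cod E t = FObj (Src N) i" using spanD[OF s] oN i by simp_all
    have u': "u \<in> Arr I" "Dom I u = i" using u by auto
    have "S.pr u \<bullet> (S.q2 \<bullet> (?c \<bullet> t)) = FArr (Src N) u \<bullet> t"
      using E.comp_extend[OF c1(5), of t] E.comp_extend[OF prj_match_map[OF i Src_functor[OF oN(1)] u], of t]
        c1(1-4) t oN u i S.L_def by (simp add: S.pr_def)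
    then show "ksec N e v (S.pr u \<bullet> (S.q2 \<bullet> (?c \<bullet> t))) b = ksec N e (v \<star> u) t b"
      using ksec_shift[OF N u'(1) v, of t e b] t u' by simp
  qed
qed

end

theorem corollary5p5:
  fixes I :: "('i, 'u) cat" and deg :: "'i \<Rightarrow> nat" and E :: "('o, 'a) cat"
    and f :: "('i, 'u, 'o, 'a) nat_trans"
  assumes "generalised_inverse_category I deg"
    and "category E"
    and "has_pullbacks E"
    and "\<forall>i\<in>Obj I. has_limits_of_shape (lower_coslice I deg i) E"
    and "f \<in> Arr (functor_cat I E)"
    and "\<forall>i\<in>Obj I. powerful E (Cmp f i)"
    and "\<forall>n. \<forall>i\<in>Obj (deg_groupoid I deg n). powerful E (match_arr I deg E i f)"
    and "(\<forall>n. connected_cat (deg_groupoid I deg n)) \<or> has_initial_object E"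
  shows "powerful (functor_cat I E) f \<and>
    (\<forall>g\<in>Obj (slice (functor_cat I E) (Dom (functor_cat I E) f)). \<forall>i\<in>Obj I.
       is_pullback E
         (Pi_gap_map I deg E i f g)
         (pb_ev_transpose I deg E i f g \<cdot>\<^bsub>E\<^esub> pb_match_ev_transpose I deg E i f g)
         (Pi_proj_dprod I E i f g)
         (Pi_proj_match I deg E i f g))"
proof -
  interpret I: category I
    using assms(1) unfolding generalised_inverse_category_def by blast
  interpret E: category E by fact
  interpret M: matching I E deg
    by unfold_locales (use assms(1-4) in auto)
  have pow: "powerful E (Cmp f i)" if "i \<in> Obj I" for i
    using assms(6) that by blast
  \<comment> \<open>Every object \<open>i\<close> lies in the groupoid of its own degree.\<close>
  have powM: "powerful E (match_arr I deg E i f)" if "i \<in> Obj I" for i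
    using assms(7) that by (simp add: deg_groupoid_def)
  have powf: "powerful (functor_cat I E) f"
    by (rule M.powerful_FC[OF assms(5) pow])
  moreover have "is_pullback E (Pi_gap_map I deg E i f g)
      (pb_ev_transpose I deg E i f g \<cdot>\<^bsub>E\<^esub> pb_match_ev_transpose I deg E i f g)
      (Pi_proj_dprod I E i f g) (Pi_proj_match I deg E i f g)"
    if g: "g \<in> Obj (slice (functor_cat I E) (Dom (functor_cat I E) f))" and i: "i \<in> Obj I" for g i
  proof -
    interpret D: dep_prod I E deg f g
      by unfold_locales (use assms(5) g pow in simp_all)
    show ?thesis by (rule D.Pi_pullback[OF powf i powM[OF i]])
  qed
  ultimately show ?thesis by blast
qed

end
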